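(* Let $X$ be a compact convex set and let $H$ be an intermediate function space on $X$. (a) Assume that $X$ is a simplex and $A_1(X)\subset H\subset (A_c(X))^\sigma$. Then $\iota(x)\in\operatorname{ext}S(H)$ whenever $x\in\operatorname{ext}X$. Hence $Z(H)=M(H)$. (b) If $H=A_1(X)$ and $\operatorname{ext}X$ is a Lindelöf resolvable set, then $Z(H)=M(H)$.
   Context: A compact convex set is a compact convex subset of a (Hausdorff) locally convex real topological vector space; $\operatorname{ext}X$ is the set of its extreme points. $A_c(X)$ is the space of continuous affine real functions on $X$ and $A_b(X)$ the space of bounded affine real functions on $X$, with the supremum norm and pointwise order. An intermediate function space on $X$ is a (norm-)closed linear subspace $H\subset A_b(X)$ with $A_c(X)\subset H$. $A_1(X)$ is the space of affine functions on $X$ that are pointwise limits of sequences of continuous functions (Baire-one). For a family $F$ of bounded functions on $X$, $F^\sigma$ is the smallest family of functions on $X$ that contains $F$ and is closed with respect to limits of pointwise converging bounded sequences. A function $f:X\to\mathbb R$ is fragmented if for any $\epsilon>0$ and any nonempty closed $F\subset X$ there is a nonempty relatively open $U\subset F$ with $\operatorname{diam}f(U)<\epsilon$; a set $A\subset X$ is resolvable if its characteristic function $1_A$ is fragmented. $X$ is a simplex if each $x\in X$ is the barycenter of a unique Radon probability measure on $X$ that is maximal in the dilation order ($\mu\prec\nu$ iff $\int f\,d\mu\le\int f\,d\nu$ for all convex continuous $f$). $S(H)=\{\varphi\in H^*:\|\varphi\|\le1,\ \varphi(1_X)=1\}$ with the weak$^*$ topology is the state space of $H$, and $\iota:X\to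 S(H)$ is $\iota(x)(a)=a(x)$, $a\in H$. $\mathfrak D(H)$ is the set of bounded linear operators $T:H\to H$ with $-\lambda I\le T\le\lambda I$ for some $\lambda\ge0$ ($T\ge0$ means $Ta\ge0$ for $a\ge0$). Center: $Z(H)=\{T(1_X):T\in\mathfrak D(H)\}$. Multipliers: $M(H)=\{u\in H:\forall a\in H\ \exists b\in H\colon b=u\cdot a\text{ on }\operatorname{ext}X\}$. *)

theory Defs
  imports "HOL-Probability.Probability" "HOL-Library.Function_Algebras"
begin

class topological_vector_space = real_vector + topological_ab_group_add + t2_space +
  assumes tendsto_scaleR_Pair:
    "((\<lambda>p. fst p *\<^sub>R snd p) \<longlongrightarrow> r *\<^sub>R x) (nhds r \<times>\<^sub>F nhds x)"

(* The last clause says that V is convex; the constant convex carries the sort constraint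
   real_vector and cannot be used inside a class specification. *)
class locally_convex_space = topological_vector_space +
  assumes convex_nhds_base:
    "open U \<Longrightarrow> x \<in> U \<Longrightarrow> \<exists>V. open V \<and> x \<in> V \<and> V \<subseteq> U \<and>
      (\<forall>a\<in>V. \<forall>b\<in>V. \<forall>t\<in>{0..1}. (1 - t) *\<^sub>R a + t *\<^sub>R b \<in> V)"

(* The pointwise vector space structure makes subspace, convex and extreme_point_of
   available for spaces of functions and for spaces of functionals on them. *)
instantiation "fun" :: (type, real_vector) real_vector
begin

definition scaleR_fun :: "real \<Rightarrow> ('a \<Rightarrow> 'b) \<Rightarrow> 'a \<Rightarrow> 'b"
  where "scaleR_fun r f = (\<lambda>x. r *\<^sub>R f x)"

instance
  by standard (simp_all add: scaleR_fun_def plus_fun_def scaleR_add_right scaleR_add_left)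

end

definition extreme_points :: "'v::real_vector set \<Rightarrow> 'v set"
  where "extreme_points X = {x. x extreme_point_of X}"


section \<open>Functions on a compact convex set\<close>

(* A real function on X is represented by its extension by 0 to the whole type, so that
   functions on X are equal iff they agree on X, the algebraic operations and the order on
   the function type are the pointwise ones on X, and indicat_real X is the constant 1. *)
definition functions_on :: "'a set \<Rightarrow> ('a \<Rightarrow> real) set"
  where "functions_on X = {f. \<forall>x. x \<notin> X \<longrightarrow> f x = 0}"

definition affine_functions :: "'a::real_vector set \<Rightarrow> ('a \<Rightarrow> real) set"
  where "affine_functions X = {f \<in> functions_on X. \<forall>x\<in>X. \<forall>y\<in>X. \<forall>t\<in>{0..1}.
    f ((1 - t) *\<^sub>R x + t *\<^sub>R y) = (1 - t) * f x + t * f y}"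

definition A\<^sub>c :: "'a::{real_vector,topological_space} set \<Rightarrow> ('a \<Rightarrow> real) set"
  where "A\<^sub>c X = {f \<in> affine_functions X. continuous_on X f}"

definition A\<^sub>b :: "'a::real_vector set \<Rightarrow> ('a \<Rightarrow> real) set"
  where "A\<^sub>b X = {f \<in> affine_functions X. bounded (f ` X)}"

definition A\<^sub>1 :: "'a::{real_vector,topological_space} set \<Rightarrow> ('a \<Rightarrow> real) set"
  where "A\<^sub>1 X = {f \<in> affine_functions X.
    \<exists>g. (\<forall>n::nat. continuous_on X (g n)) \<and> (\<forall>x\<in>X. (\<lambda>n. g n x) \<longlonglongrightarrow> f x)}"

definition sup_norm :: "'a set \<Rightarrow> ('a \<Rightarrow> real) \<Rightarrow> real"
  where "sup_norm X f = (SUP x\<in>X. \<bar>f x\<bar>)"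

definition intermediate_function_space ::
    "'a::{real_vector,topological_space} set \<Rightarrow> ('a \<Rightarrow> real) set \<Rightarrow> bool"
  where "intermediate_function_space X H \<longleftrightarrow>
    subspace H \<and> A\<^sub>c X \<subseteq> H \<and> H \<subseteq> A\<^sub>b X \<and>
    (\<forall>f\<in>A\<^sub>b X. (\<forall>e>0. \<exists>h\<in>H. sup_norm X (f - h) < e) \<longrightarrow> f \<in> H)"

(* For F contained in functions_on X, every member again lies in functions_on X, so
   boundedness and convergence outside X are no additional conditions. *)
inductive_set sigma_closure :: "('a \<Rightarrow> real) set \<Rightarrow> ('a \<Rightarrow> real) set"
  for F :: "('a \<Rightarrow> real) set" where
  base: "f \<in> F \<Longrightarrow> f \<in> sigma_closure F"
| limit: "(\<And>n::nat. g n \<in> sigma_closure F) \<Longrightarrow> \<exists>C. \<forall>n x. \<bar>g n x\<bar> \<le> C \<Longrightarrow>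
    (\<And>x. (\<lambda>n. g n x) \<longlonglongrightarrow> f x) \<Longrightarrow> f \<in> sigma_closure F"

(* diameter is a supremum in the reals and hence meaningless on unbounded sets, so
   finiteness of the diameter is required separately. *)
definition fragmented_on :: "'a::topological_space set \<Rightarrow> ('a \<Rightarrow> real) \<Rightarrow> bool"
  where "fragmented_on X f \<longleftrightarrow>
    (\<forall>e>0. \<forall>F. closedin (top_of_set X) F \<and> F \<noteq> {} \<longrightarrow>
      (\<exists>U. openin (top_of_set F) U \<and> U \<noteq> {} \<and> bounded (f ` U) \<and> diameter (f ` U) < e))"

definition resolvable_in :: "'a::topological_space set \<Rightarrow> 'a set \<Rightarrow> bool"
  where "resolvable_in X A \<longleftrightarrow> A \<subseteq> X \<and> fragmented_on X (indicat_real A)"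


section \<open>Simplices\<close>

definition radon_prob :: "'a::topological_space set \<Rightarrow> 'a measure \<Rightarrow> bool"
  where "radon_prob X \<mu> \<longleftrightarrow>
    prob_space \<mu> \<and> sets \<mu> = sets (restrict_space borel X) \<and>
    (\<forall>B\<in>sets \<mu>. emeasure \<mu> B = (SUP K\<in>{K. compact K \<and> K \<subseteq> B}. emeasure \<mu> K))"

definition dilation_le ::
    "'a::{real_vector,topological_space} set \<Rightarrow> 'a measure \<Rightarrow> 'a measure \<Rightarrow> bool"
  where "dilation_le X \<mu> \<nu> \<longleftrightarrow>
    (\<forall>f. convex_on X f \<and> continuous_on X f \<longrightarrow> integral\<^sup>L \<mu> f \<le> integral\<^sup>L \<nu> f)"

definition maximal_prob :: "'a::{real_vector,topological_space} set \<Rightarrow> 'a measure \<Rightarrow> bool"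
  where "maximal_prob X \<mu> \<longleftrightarrow> radon_prob X \<mu> \<and>
    (\<forall>\<nu>. radon_prob X \<nu> \<and> dilation_le X \<mu> \<nu> \<longrightarrow> \<nu> = \<mu>)"

definition is_barycenter ::
    "'a::{real_vector,topological_space} set \<Rightarrow> 'a measure \<Rightarrow> 'a \<Rightarrow> bool"
  where "is_barycenter X \<mu> x \<longleftrightarrow> x \<in> X \<and> (\<forall>f\<in>A\<^sub>c X. integral\<^sup>L \<mu> f = f x)"

definition choquet_simplex :: "'a::{real_vector,topological_space} set \<Rightarrow> bool"
  where "choquet_simplex X \<longleftrightarrow>
    (\<forall>x\<in>X. \<exists>!\<mu>. maximal_prob X \<mu> \<and> is_barycenter X \<mu> x)"


section \<open>State space, center and multipliers\<close>

(* Linear maps defined on a subspace H only; the value 0 off H makes two maps equal iff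
   they agree on H. *)
definition linear_maps_on :: "'v::real_vector set \<Rightarrow> ('v \<Rightarrow> 'w::real_vector) set"
  where "linear_maps_on H = {T.
    (\<forall>a\<in>H. \<forall>b\<in>H. T (a + b) = T a + T b) \<and>
    (\<forall>r. \<forall>a\<in>H. T (r *\<^sub>R a) = r *\<^sub>R T a) \<and>
    (\<forall>a. a \<notin> H \<longrightarrow> T a = 0)}"

definition dual_space :: "'a set \<Rightarrow> ('a \<Rightarrow> real) set \<Rightarrow> (('a \<Rightarrow> real) \<Rightarrow> real) set"
  where "dual_space X H =
    {\<phi> \<in> linear_maps_on H. \<exists>C. \<forall>a\<in>H. \<bar>\<phi> a\<bar> \<le> C * sup_norm X a}"

definition dual_norm :: "'a set \<Rightarrow> ('a \<Rightarrow> real) set \<Rightarrow> (('a \<Rightarrow> real) \<Rightarrow> real) \<Rightarrow> real"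
  where "dual_norm X H \<phi> = (SUP a\<in>{a \<in> H. sup_norm X a \<le> 1}. \<bar>\<phi> a\<bar>)"

definition state_space :: "'a set \<Rightarrow> ('a \<Rightarrow> real) set \<Rightarrow> (('a \<Rightarrow> real) \<Rightarrow> real) set"
  where "state_space X H =
    {\<phi> \<in> dual_space X H. dual_norm X H \<phi> \<le> 1 \<and> \<phi> (indicat_real X) = 1}"

definition evaluation :: "('a \<Rightarrow> real) set \<Rightarrow> 'a \<Rightarrow> ('a \<Rightarrow> real) \<Rightarrow> real"
  where "evaluation H x = (\<lambda>a. if a \<in> H then a x else 0)"

definition order_bounded_operators ::
    "'a set \<Rightarrow> ('a \<Rightarrow> real) set \<Rightarrow> (('a \<Rightarrow> real) \<Rightarrow> ('a \<Rightarrow> real)) set"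
  where "order_bounded_operators X H = {T \<in> linear_maps_on H.
    (\<forall>a\<in>H. T a \<in> H) \<and>
    (\<exists>C. \<forall>a\<in>H. sup_norm X (T a) \<le> C * sup_norm X a) \<and>
    (\<exists>l\<ge>0. \<forall>a\<in>H. 0 \<le> a \<longrightarrow> - (l *\<^sub>R a) \<le> T a \<and> T a \<le> l *\<^sub>R a)}"

definition center :: "'a set \<Rightarrow> ('a \<Rightarrow> real) set \<Rightarrow> ('a \<Rightarrow> real) set"
  where "center X H = {T (indicat_real X) | T. T \<in> order_bounded_operators X H}"

definition multipliers :: "'a::real_vector set \<Rightarrow> ('a \<Rightarrow> real) set \<Rightarrow> ('a \<Rightarrow> real) set"
  where "multipliers X H =
    {u \<in> H. \<forall>a\<in>H. \<exists>b\<in>H. \<forall>x\<in>extreme_points X. b x = u x * a x}"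

end

theory Submission
  imports Defs
begin

text \<open>
  An order bounded operator \<open>T\<close> on \<open>H\<close> gives, for \<open>x \<in> ext X\<close>, a positive functional \<open>a \<mapsto> (Ta)(x) + l a(x)\<close> dominated by a
  multiple of \<open>\<delta>\<^sub>x\<close>. Once all such functionals are multiples of \<open>\<delta>\<^sub>x\<close>, \<open>T\<close> is multiplication by \<open>T 1\<close> on \<open>ext X\<close>.

  On a simplex, \<open>x \<in> ext X\<close> admits, for every countable \<open>D \<subseteq> A\<^sub>c X\<close>, an affine Baire-one \<open>w\<close> with \<open>w(x) = 1\<close> such that each \<open>y\<close> agrees
  on \<open>D\<close> with \<open>w(y) x + (1 - w(y)) z\<close> for some \<open>z\<close>. A functional dominated by \<open>\<delta>\<^sub>x\<close> vanishes on \<open>1 - w\<close>, hence on every \<open>a \<in> H\<close> with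
  \<open>a(x) = 0\<close>, which is bounded by a multiple of such a \<open>1 - w\<close>.

  For \<open>H = A\<^sub>1 X\<close> the domination argument is elementary on \<open>A\<^sub>c X\<close>. If \<open>a\<close> is the limit of a bounded sequence \<open>a\<^sub>n \<in> A\<^sub>c X\<close>, then
  \<open>b = lim T a\<^sub>n\<close> exists and equals \<open>T 1 \<cdot> a\<close> on \<open>ext X\<close>. Since \<open>ext X\<close> is Lindelof and resolvable, it lies in an ambiguous set on which
  \<open>b\<close> agrees with the Baire-one function \<open>T 1 \<cdot> a\<close>, and a Mazur-type argument makes \<open>b\<close> itself Baire-one.
\<close>

section \<open>Hahn--Banach and Riesz representation\<close>

text \<open>\<open>X\<close> need not be metrizable, so \<open>ext X\<close> need not be Borel and a
  measure cannot simply be said to be carried by it. The remedy is that every function of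
  \<open>sigma_closure (A\<^sub>c X)\<close> depends on a countable
  \<open>D \<subseteq> A\<^sub>c X\<close> only: modulo \<open>D\<close> the set is metrizable, and
  each point has a measure, representing it on \<open>D\<close>, almost every point of which is
  indistinguishable by \<open>D\<close> from an extreme point. This gives the minimum principle on
  \<open>ext X\<close>, and with it M(H) \<subseteq> Z(H) in both parts. The same countability
  shapes \<open>w\<close>: the function that assigns to \<open>y\<close> the mass of
  \<open>x\<close> under its maximal measure may fail to lie in \<open>H\<close>, whereas
  \<open>w\<close> is of the first Baire class and \<open>A\<^sub>1 X \<subseteq> H\<close>. In (b)
  the inclusion \<open>A\<^sub>1 X \<subseteq> sigma_closure (A\<^sub>c X)\<close> is itself a
  theorem; it rests on the barycentric formula for affine functions of the first Baire class.
  Separating functionals, representing measures and maximal measures come from one Hahn--Banach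
  theorem for consistent systems of linear inequalities.\<close>

text \<open>A pair \<open>(v, t)\<close> of the cone stands for the inequality
  \<open>\<phi> v \<le> t\<close>; the condition on \<open>(0, t)\<close> says that no contradiction
  \<open>\<phi> 0 \<le> t < 0\<close> can be derived. A Zorn-maximal consistent cone leaves no
  freedom: the best bounds that it gives for \<open>v\<close> and for \<open>- v\<close> add up to
  0, so the best bound \<open>p\<close> is linear.\<close>

lemma hahn_banach_cone:
  fixes W :: "'v::real_vector set" and C :: "('v \<times> real) set"
  assumes W: "subspace W"
    and add: "\<And>u v s t. (u, s) \<in> C \<Longrightarrow> (v, t) \<in> C \<Longrightarrow> (u + v, s + t) \<in> C"
    and scale: "\<And>r v t. 0 \<le> r \<Longrightarrow> (v, t) \<in> C \<Longrightarrow> (r *\<^sub>R v, r * t) \<in> C"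
    and dom: "\<And>v. v \<in> W \<Longrightarrow> \<exists>t. (v, t) \<in> C"
    and nonneg: "\<And>t. (0, t) \<in> C \<Longrightarrow> 0 \<le> t"
  obtains \<phi> where "\<And>u v. u \<in> W \<Longrightarrow> v \<in> W \<Longrightarrow> \<phi> (u + v) = \<phi> u + \<phi> v"
    and "\<And>r v. v \<in> W \<Longrightarrow> \<phi> (r *\<^sub>R v) = r * \<phi> v"
    and "\<And>v t. v \<in> W \<Longrightarrow> (v, t) \<in> C \<Longrightarrow> \<phi> v \<le> (t::real)"
proof -
  define cone where "cone D \<longleftrightarrow> C \<subseteq> D \<and>
    (\<forall>u s v t. (u, s) \<in> D \<longrightarrow> (v, t) \<in> D \<longrightarrow> (u + v, s + t) \<in> D) \<and>
    (\<forall>r v t. 0 \<le> r \<longrightarrow> (v, t) \<in> D \<longrightarrow> (r *\<^sub>R v, r * t) \<in> D) \<and>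
    (\<forall>t. (0, t) \<in> D \<longrightarrow> 0 \<le> t)" for D :: "('v \<times> real) set"
  have "cone C" unfolding cone_def using add scale nonneg by blast
  have "\<exists>M\<in>Collect cone. \<forall>Y\<in>Collect cone. M \<subseteq> Y \<longrightarrow> Y = M"
  proof (rule subset_Zorn_nonempty)
    show "Collect cone \<noteq> {}" using \<open>cone C\<close> by blast
  next
    fix \<C> assume ne: "\<C> \<noteq> {}" and ch: "subset.chain (Collect cone) \<C>"
    have co: "cone D" if "D \<in> \<C>" for D using ch that by (auto simp: subset_chain_def)
    have tot: "D \<subseteq> D' \<or> D' \<subseteq> D" if "D \<in> \<C>" "D' \<in> \<C>" for D D'
      using ch that by (auto simp: subset_chain_def)
    have "(u + v, s + t) \<in> \<Union>\<C>" if "(u, s) \<in> \<Union>\<C>" "(v, t) \<in> \<Union>\<C>" for u v s t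
    proof -
      obtain D where D: "D \<in> \<C>" "(u, s) \<in> D" "(v, t) \<in> D"
        using \<open>(u, s) \<in> \<Union>\<C>\<close> \<open>(v, t) \<in> \<Union>\<C>\<close> tot by blast
      then show ?thesis using co[OF D(1)] unfolding cone_def by blast
    qed
    then show "\<Union>\<C> \<in> Collect cone"
      using ne co unfolding cone_def mem_Collect_eq by (meson Union_iff Union_upper ex_in_conv subset_trans)
  qed
  then obtain M where M: "cone M" and max: "\<And>D. cone D \<Longrightarrow> M \<subseteq> D \<Longrightarrow> D = M" by auto
  have CM: "C \<subseteq> M" and Madd: "\<And>u s v t. (u, s) \<in> M \<Longrightarrow> (v, t) \<in> M \<Longrightarrow> (u + v, s + t) \<in> M"
    and Msc: "\<And>r v t. 0 \<le> r \<Longrightarrow> (v, t) \<in> M \<Longrightarrow> (r *\<^sub>R v, r * t) \<in> M"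
    and Mnn: "\<And>t. (0, t) \<in> M \<Longrightarrow> 0 \<le> t"
    using M unfolding cone_def by blast+
  have Wm: "- v \<in> W" if "v \<in> W" for v using W that by (rule subspace_neg)
  have W0: "0 \<in> W" and Wa: "u + v \<in> W" if "u \<in> W" "v \<in> W" for u v
    using W that by (auto intro: subspace_0 subspace_add)
  have M00: "(0, 0) \<in> M"
  proof -
    obtain t where "(0, t) \<in> M" using dom[of 0] W subspace_0 CM by blast
    from Msc[of 0, OF _ this] show ?thesis by simp
  qed
  define p where "p v = Inf {t. (v, t) \<in> M}" for v
  have ne: "{t. (v, t) \<in> M} \<noteq> {}" if "v \<in> W" for v using dom[OF that] CM by blast
  have bd: "bdd_below {t. (v, t) \<in> M}" if v: "v \<in> W" for v
  proof -
    obtain t where t: "(-v, t) \<in> M" using dom[OF Wm[OF v]] CM by blast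
    show ?thesis
      by (rule bdd_belowI[of _ "-t"]) (use Madd[OF t] Mnn in force)
  qed
  have ple: "p v \<le> t" if "v \<in> W" "(v, t) \<in> M" for v t
    unfolding p_def by (rule cInf_lower) (use that bd in auto)
  have psub: "p (u + v) \<le> p u + p v" if uv: "u \<in> W" "v \<in> W" for u v
  proof (rule field_le_epsilon)
    fix e :: real assume "0 < e"
    obtain s where s: "(u, s) \<in> M" "s < p u + e/2"
      using cInf_lessD[OF ne[OF uv(1)], of "p u + e/2"] \<open>0 < e\<close> by (auto simp: p_def)
    obtain t where t: "(v, t) \<in> M" "t < p v + e/2"
      using cInf_lessD[OF ne[OF uv(2)], of "p v + e/2"] \<open>0 < e\<close> by (auto simp: p_def)
    show "p (u + v) \<le> p u + p v + e"
      using ple[OF Wa[OF uv] Madd[OF s(1) t(1)]] s t by linarith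
  qed
  have p0: "p 0 = 0"
    using ple[OF _ M00] W subspace_0 psub[of 0 0] by force
  have pneg: "p (- v) \<le> - s" if v: "v \<in> W" and s: "s < p v" for v s
  proof (rule ccontr)
    assume neg: "\<not> p (- v) \<le> - s"
    \<comment> \<open>Adjoins the inequality \<open>\<phi> v \<le> s\<close>. The negated claim
      makes this consistent, and maximality then forces it into \<open>M\<close>, against
      \<open>s < p v\<close>.\<close>
    define D where "D = {(u + r *\<^sub>R v, t + r * s) | u t r. (u, t) \<in> M \<and> 0 \<le> r}"
    have MD: "M \<subseteq> D"
    proof (rule subsetI)
      fix z assume "z \<in> M"
      then show "z \<in> D" unfolding D_def mem_Collect_eq
        by (intro exI[of _ "fst z"] exI[of _ "snd z"] exI[of _ "0::real"]) auto
    qed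
    have "cone D" unfolding cone_def
    proof (intro conjI allI impI)
      show "C \<subseteq> D" using CM MD by blast
    next
      fix u1 s1 u2 s2 assume "(u1, s1) \<in> D" "(u2, s2) \<in> D"
      then obtain a b r a' b' r' where *: "u1 = a + r *\<^sub>R v" "s1 = b + r * s" "(a, b) \<in> M" "0 \<le> r"
        "u2 = a' + r' *\<^sub>R v" "s2 = b' + r' * s" "(a', b') \<in> M" "0 \<le> r'" unfolding D_def by auto
      show "(u1 + u2, s1 + s2) \<in> D" unfolding D_def mem_Collect_eq
        by (rule exI[of _ "a + a'"], rule exI[of _ "b + b'"], rule exI[of _ "r + r'"])
          (use * Madd in \<open>auto simp: algebra_simps\<close>)
    next
      fix q u1 s1 assume "(0::real) \<le> q" "(u1, s1) \<in> D"
      then obtain a b r where *: "u1 = a + r *\<^sub>R v" "s1 = b + r * s" "(a, b) \<in> M" "0 \<le> r"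
        unfolding D_def by auto
      show "(q *\<^sub>R u1, q * s1) \<in> D" unfolding D_def mem_Collect_eq
        by (rule exI[of _ "q *\<^sub>R a"], rule exI[of _ "q * b"], rule exI[of _ "q * r"])
          (use * Msc \<open>0 \<le> q\<close> in \<open>auto simp: distrib_left scaleR_add_right mult.assoc\<close>)
    next
      fix t assume "(0, t) \<in> D"
      then obtain a b r where *: "0 = a + r *\<^sub>R v" "t = b + r * s" "(a, b) \<in> M" "0 \<le> r"
        unfolding D_def by auto
      show "0 \<le> t"
      proof (cases "r = 0")
        case True then show ?thesis using * Mnn by auto
      next
        case False
        have "a = - (r *\<^sub>R v)" using *(1) by (simp add: eq_neg_iff_add_eq_0)
        then have "(1/r) *\<^sub>R a = - v" using False by simp
        then have "(- v, b / r) \<in> M" using Msc[of "1/r", OF _ *(3)] *(4) by simp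
        from ple[OF Wm[OF v] this] have "- s < b / r" using neg by linarith
        then show ?thesis using *(2,4) False by (simp add: field_simps)
      qed
    qed
    then have "D = M" using max MD by blast
    moreover have "(v, s) \<in> D" unfolding D_def mem_Collect_eq
      by (rule exI[of _ 0], rule exI[of _ 0], rule exI[of _ 1]) (use M00 in auto)
    ultimately have "p v \<le> s" using ple[OF v] by blast
    then show False using s by simp
  qed
  have pm: "p (- v) = - p v" if v: "v \<in> W" for v
  proof (rule antisym)
    have "s \<le> - p (- v)" if "s < p v" for s
      using pneg[OF v that] by linarith
    then show "p (- v) \<le> - p v"
      using dense_ge_bounded[of "p v - 1" "p v"] by (meson dense_le le_minus_iff)
    show "- p v \<le> p (- v)" using psub[OF v Wm[OF v]] p0 by simp
  qed
  have padd: "p (u + v) = p u + p v" if "u \<in> W" "v \<in> W" for u v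
  proof (rule antisym)
    show "p (u + v) \<le> p u + p v" using that psub by blast
    have "p (- (u + v)) \<le> p (- u) + p (- v)" using psub[OF Wm Wm, OF that] by (simp only: minus_add_distrib)
    then show "p u + p v \<le> p (u + v)"
      unfolding pm[OF Wa[OF that]] pm[OF that(1)] pm[OF that(2)] by linarith
  qed
  have pos: "p (r *\<^sub>R v) \<le> r * p v" if rv: "0 < r" "v \<in> W" for r v
  proof (rule field_le_epsilon)
    fix e :: real assume "0 < e"
    obtain t where t: "(v, t) \<in> M" "t < p v + e/r"
      using cInf_lessD[OF ne[OF rv(2)], of "p v + e/r"] \<open>0 < e\<close> rv by (auto simp: p_def)
    have "p (r *\<^sub>R v) \<le> r * t"
      using ple[OF _ Msc[OF _ t(1)], of r] rv W by (simp add: subspace_scale)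
    also have "\<dots> \<le> r * p v + e" using t(2) rv by (simp add: field_simps)
    finally show "p (r *\<^sub>R v) \<le> r * p v + e" .
  qed
  have posE: "p (r *\<^sub>R v) = r * p v" if r: "0 < r" and v: "v \<in> W" for r v
  proof (rule antisym[OF pos[OF r v]])
    have "p ((1/r) *\<^sub>R (r *\<^sub>R v)) \<le> (1/r) * p (r *\<^sub>R v)"
      by (rule pos) (use r v W subspace_scale in auto)
    then show "r * p v \<le> p (r *\<^sub>R v)" using r by (simp add: field_simps)
  qed
  have psc: "p (r *\<^sub>R v) = r * p v" if v: "v \<in> W" for r v
  proof -
    consider "r = 0" | "0 < r" | "r < 0" by linarith
    then show ?thesis
    proof cases
      case 3
      have "p (- ((- r) *\<^sub>R v)) = - ((- r) * p v)"
        using pm[of "(-r) *\<^sub>R v"] posE[of "-r" v] 3 v W by (simp add: subspace_scale subspace_neg del: scaleR_minus_left)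
      then show ?thesis by simp
    qed (use p0 posE v in auto)
  qed
  show thesis by (rule that[of p]) (use padd psc ple CM in auto)
qed

section \<open>Urysohn functions and elementary facts on Radon probability measures\<close>

lemma Hausdorff_space_euclidean_t2: "Hausdorff_space (euclidean :: 'a::t2_space topology)"
  unfolding Hausdorff_space_def disjnt_def using hausdorff by (metis open_openin)

lemma urysohn_on:
  fixes X :: "'a::t2_space set"
  assumes "compact X" "closedin (top_of_set X) K" "closedin (top_of_set X) L" "K \<inter> L = {}"
  obtains f :: "'a \<Rightarrow> real" where "continuous_on X f" "\<And>x. x \<in> X \<Longrightarrow> 0 \<le> f x \<and> f x \<le> 1"
    "\<And>x. x \<in> K \<Longrightarrow> f x = 1" "\<And>x. x \<in> L \<Longrightarrow> f x = 0"
proof -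
  have "normal_space (top_of_set X)"
    using assms(1) compact_Hausdorff_or_regular_imp_normal_space[of "top_of_set X"]
    by (simp add: compact_space_subtopology Hausdorff_space_subtopology Hausdorff_space_euclidean_t2)
  then obtain f where f: "continuous_map (top_of_set X) (top_of_set {0..1::real}) f" "f ` L \<subseteq> {0}" "f ` K \<subseteq> {1}"
    by (rule Urysohn_lemma[of _ L K 0 1]) (use assms in \<open>auto simp: disjnt_def\<close>)
  show thesis
    by (rule that[of f]) (use f in \<open>auto simp: continuous_map_in_subtopology Pi_iff\<close>)
qed

lemma ennreal_mult_half:
  assumes "0 \<le> e" shows "(\<Sum>i. ennreal (e * (1/2)^Suc i)) = ennreal e"
  using sums_mult[OF power_half_series, of e] assms
  by (intro suminf_ennreal_eq) (auto simp: mult_ac)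

lemma radon_prob_space: "radon_prob X \<mu> \<Longrightarrow> prob_space \<mu>"
  and radon_sets: "radon_prob X \<mu> \<Longrightarrow> sets \<mu> = sets (restrict_space borel X)"
  by (simp_all add: radon_prob_def)

lemma radon_space: "radon_prob X \<mu> \<Longrightarrow> space \<mu> = X"
  using sets_eq_imp_space_eq[OF radon_sets] by (simp add: space_restrict_space)

lemma radon_measurable: "radon_prob X \<mu> \<Longrightarrow> continuous_on X f \<Longrightarrow> f \<in> borel_measurable \<mu>"
  using borel_measurable_continuous_on_restrict[of X f] measurable_cong_sets[OF radon_sets refl] by blast

lemma continuous_bound:
  fixes f :: "'a::topological_space \<Rightarrow> real"
  assumes "compact X" "continuous_on X f"
  obtains C where "0 < C" "\<And>x. x \<in> X \<Longrightarrow> \<bar>f x\<bar> \<le> C"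
  using compact_imp_bounded[OF compact_continuous_image[OF assms(2,1)]] that by (auto simp: bounded_pos)

lemma radon_integrable:
  fixes f :: "'a::t2_space \<Rightarrow> real"
  assumes X: "compact X" and \<mu>: "radon_prob X \<mu>" and f: "continuous_on X f"
  shows "integrable \<mu> f"
proof -
  interpret prob_space \<mu> using \<mu> by (rule radon_prob_space)
  obtain C where "\<And>x. x \<in> X \<Longrightarrow> \<bar>f x\<bar> \<le> C"
    using continuous_bound[OF X f] by blast
  then show ?thesis
    by (intro integrable_const_bound[of _ C] radon_measurable[OF \<mu> f] AE_I2) (auto simp: radon_space[OF \<mu>])
qed

section \<open>Riesz representation of normalized positive functionals on C(X)\<close>

locale riesz_functional =
  fixes X :: "'a::t2_space set" and \<psi> :: "('a \<Rightarrow> real) \<Rightarrow> real"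
  assumes compact: "compact X"
    and add: "continuous_on X f \<Longrightarrow> continuous_on X g \<Longrightarrow> \<psi> (\<lambda>x. f x + g x) = \<psi> f + \<psi> g"
    and scale: "continuous_on X f \<Longrightarrow> \<psi> (\<lambda>x. c * f x) = c * \<psi> f"
    and nonneg: "continuous_on X f \<Longrightarrow> (\<And>x. x \<in> X \<Longrightarrow> 0 \<le> f x) \<Longrightarrow> 0 \<le> \<psi> f"
    and one: "\<psi> (\<lambda>_. 1) = 1"
begin

lemma diff: "continuous_on X f \<Longrightarrow> continuous_on X g \<Longrightarrow> \<psi> (\<lambda>x. f x - g x) = \<psi> f - \<psi> g"
  using add[of f "\<lambda>x. -1 * g x"] scale[of g "-1"] by (simp add: continuous_on_minus)

lemma mono: "continuous_on X f \<Longrightarrow> continuous_on X g \<Longrightarrow> (\<And>x. x \<in> X \<Longrightarrow> f x \<le> g x) \<Longrightarrow> \<psi> f \<le> \<psi> g"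
  using nonneg[of "\<lambda>x. g x - f x"] diff[of g f] by (force intro: continuous_intros)

lemma const: "\<psi> (\<lambda>_. c) = c"
  using scale[of "\<lambda>_. 1" c] one by simp

lemma sum: "finite I \<Longrightarrow> (\<And>i. i \<in> I \<Longrightarrow> continuous_on X (f i)) \<Longrightarrow> \<psi> (\<lambda>x. \<Sum>i\<in>I. f i x) = (\<Sum>i\<in>I. \<psi> (f i))"
  by (induction I rule: finite_induct) (auto simp: const add continuous_on_sum)

text \<open>Compact support in \<open>U\<close> is not asked for, in contrast to the usual
  definition; \<open>cutoff\<close> recovers compactness at the cost of \<open>e\<close>.\<close>

definition dominated :: "'a set \<Rightarrow> ('a \<Rightarrow> real) set" where
  "dominated U = {f. continuous_on X f \<and> (\<forall>x\<in>X. 0 \<le> f x \<and> f x \<le> 1 \<and> (x \<notin> U \<longrightarrow> f x = 0))}"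

definition inner_content :: "'a set \<Rightarrow> ennreal" where
  "inner_content U = (SUP f\<in>dominated U. ennreal (\<psi> f))"

definition outer :: "'a set \<Rightarrow> ennreal" where
  "outer E = (INF U\<in>{U. openin (top_of_set X) U \<and> E \<subseteq> U}. inner_content U)"

lemma dominated_mono: "U \<inter> X \<subseteq> V \<Longrightarrow> dominated U \<subseteq> dominated V"
  unfolding dominated_def by blast

lemma inner_content_mono: "U \<inter> X \<subseteq> V \<Longrightarrow> inner_content U \<le> inner_content V"
  unfolding inner_content_def by (rule SUP_subset_mono[OF dominated_mono]) auto

lemma zero_dominated: "(\<lambda>_. 0) \<in> dominated U"
  by (auto simp: dominated_def)

lemma inner_content_empty: "inner_content {} = 0"
proof -
  have "\<psi> f = 0" if "f \<in> dominated {}" for f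
  proof -
    have "continuous_on X f" "\<And>x. x \<in> X \<Longrightarrow> f x = 0"
      using that by (force simp: dominated_def)+
    then have "\<psi> f \<le> \<psi> (\<lambda>_. 0)" "\<psi> (\<lambda>_. 0) \<le> \<psi> f" by (auto intro!: mono)
    then show ?thesis by (simp add: const)
  qed
  then have "inner_content {} = (SUP f\<in>dominated {}. 0)"
    unfolding inner_content_def by (intro SUP_cong) auto
  then show ?thesis using zero_dominated by (auto simp: image_constant_conv)
qed

lemma inner_content_space: "inner_content X = 1"
proof (rule antisym)
  show "inner_content X \<le> 1" unfolding inner_content_def
  proof (rule SUP_least)
    fix f assume "f \<in> dominated X"
    then have "\<psi> f \<le> \<psi> (\<lambda>_. 1)" by (intro mono) (auto simp: dominated_def)
    then show "ennreal (\<psi> f) \<le> 1" by (simp add: one)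
  qed
  have "(\<lambda>_. 1) \<in> dominated X" by (auto simp: dominated_def)
  then show "1 \<le> inner_content X" unfolding inner_content_def
    by (rule SUP_upper2) (simp add: one)
qed

text \<open>Cutting off at height \<open>e\<close> turns \<open>f \<le> 1\<^sub>U\<close> into a function supported by a compact subset of \<open>U\<close>.\<close>

lemma cutoff:
  assumes f: "f \<in> dominated U" and e: "0 < e"
    and K_def: "K = {x\<in>X. e \<le> f x}" and f'_def: "f' = (\<lambda>x. max (f x - e) 0)"
  shows "compact K" "K \<subseteq> U" "closedin (top_of_set X) K" "continuous_on X f'" "\<psi> f \<le> \<psi> f' + e"
    "\<And>x. x \<in> X \<Longrightarrow> 0 \<le> f' x \<and> f' x \<le> 1 \<and> (x \<notin> K \<longrightarrow> f' x = 0)"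
proof -
  have fc: "continuous_on X f" and fb: "\<And>x. x \<in> X \<Longrightarrow> 0 \<le> f x \<and> f x \<le> 1 \<and> (x \<notin> U \<longrightarrow> f x = 0)"
    using f by (auto simp: dominated_def)
  have cl: "closedin (top_of_set X) (X \<inter> f -` {e..})"
    using fc by (rule continuous_closedin_preimage) simp
  then show 1: "closedin (top_of_set X) K" by (simp add: K_def vimage_def Int_def)
  show "compact K" using closedin_compact[OF compact 1] .
  show "K \<subseteq> U" using fb e by (force simp: K_def)
  show 2: "continuous_on X f'" unfolding f'_def by (intro continuous_intros fc)
  have "\<psi> f \<le> \<psi> (\<lambda>x. f' x + e)"
    by (rule mono) (auto simp: f'_def intro!: continuous_intros fc)
  also have "\<dots> = \<psi> f' + e" using add[OF 2, of "\<lambda>_. e"] by (simp add: const)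
  finally show "\<psi> f \<le> \<psi> f' + e" .
  show "0 \<le> f' x \<and> f' x \<le> 1 \<and> (x \<notin> K \<longrightarrow> f' x = 0)" if "x \<in> X" for x
    using fb[OF that] that e by (auto simp: f'_def K_def)
qed

text \<open>A partition of unity on the compact set \<open>K\<close>: the Urysohn function
  \<open>k\<close> is 0 on \<open>K - U\<close> and 1 on \<open>K - V\<close>, so
  \<open>f' k\<close> lives in \<open>U\<close> and \<open>f' (1 - k)\<close> in
  \<open>V\<close>.\<close>

lemma inner_content_Un:
  assumes "openin (top_of_set X) U" "openin (top_of_set X) V"
  shows "inner_content (U \<union> V) \<le> inner_content U + inner_content V"
  unfolding inner_content_def[of "U \<union> V"]
proof (rule SUP_least, rule ennreal_le_epsilon)
  fix f and e :: real assume f: "f \<in> dominated (U \<union> V)" and e: "0 < e"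
  define K where "K = {x\<in>X. e \<le> f x}"
  define f' where "f' = (\<lambda>x. max (f x - e) 0)"
  note c = cutoff[OF f e K_def f'_def]
  have cl: "closedin (top_of_set X) (K - U)" "closedin (top_of_set X) (K - V)"
    using c(3) assms by (auto intro: closedin_diff)
  obtain k :: "'a \<Rightarrow> real" where k: "continuous_on X k" "\<And>x. x \<in> X \<Longrightarrow> 0 \<le> k x \<and> k x \<le> 1"
    "\<And>x. x \<in> K - V \<Longrightarrow> k x = 1" "\<And>x. x \<in> K - U \<Longrightarrow> k x = 0"
    using urysohn_on[OF compact cl(2) cl(1)] c(2) by blast
  have kc: "continuous_on X (\<lambda>x. f' x * k x)" "continuous_on X (\<lambda>x. f' x * (1 - k x))"
    by (intro continuous_intros c(4) k(1))+
  have f'1: "f' x \<le> 1" "x \<notin> K \<Longrightarrow> f' x = 0" "0 \<le> f' x" if "x \<in> X" for x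
    using c(6)[OF that] by auto
  have 1: "(\<lambda>x. f' x * k x) \<in> dominated U" "(\<lambda>x. f' x * (1 - k x)) \<in> dominated V"
    using kc f'1 k c(2) by (auto simp: dominated_def mult_le_one) (metis DiffI mult_eq_0_iff)+
  have "\<psi> f \<le> \<psi> f' + e" by (rule c(5))
  also have "\<psi> f' = \<psi> (\<lambda>x. f' x * k x) + \<psi> (\<lambda>x. f' x * (1 - k x))"
    using add[OF kc] by (simp add: algebra_simps)
  finally have "ennreal (\<psi> f) \<le> ennreal (\<psi> (\<lambda>x. f' x * k x) + \<psi> (\<lambda>x. f' x * (1 - k x)) + e)"
    by (rule ennreal_leI)
  also have "\<dots> = ennreal (\<psi> (\<lambda>x. f' x * k x)) + ennreal (\<psi> (\<lambda>x. f' x * (1 - k x))) + ennreal e"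
    using nonneg[OF kc(1)] nonneg[OF kc(2)] e f'1 k(2) by (simp add: ennreal_plus)
  also have "\<dots> \<le> inner_content U + inner_content V + ennreal e"
    unfolding inner_content_def using 1 by (intro add_mono SUP_upper order_refl)
  finally show "ennreal (\<psi> f) \<le> inner_content U + inner_content V + ennreal e" .
qed

lemma inner_content_UN_finite:
  fixes U :: "nat \<Rightarrow> 'a set"
  assumes "\<And>i. openin (top_of_set X) (U i)"
  shows "inner_content (\<Union>i<n. U i) \<le> (\<Sum>i<n. inner_content (U i))"
proof (induction n)
  case 0 then show ?case by (simp add: inner_content_empty)
next
  case (Suc n)
  have "inner_content (\<Union>i<Suc n. U i) \<le> inner_content (\<Union>i<n. U i) + inner_content (U n)"
    unfolding lessThan_Suc UN_insert by (subst Un_commute, rule inner_content_Un) (use assms in auto)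
  also have "\<dots> \<le> (\<Sum>i<Suc n. inner_content (U i))"
    using Suc.IH by (simp add: add_right_mono)
  finally show ?case .
qed

text \<open>The cut-off function lives on a compact set, which finitely many of the
  \<open>U i\<close> cover.\<close>

lemma inner_content_UN:
  fixes U :: "nat \<Rightarrow> 'a set"
  assumes U: "\<And>i. openin (top_of_set X) (U i)"
  shows "inner_content (\<Union>i. U i) \<le> (\<Sum>i. inner_content (U i))"
  unfolding inner_content_def[of "\<Union>i. U i"]
proof (rule SUP_least, rule ennreal_le_epsilon)
  fix f and e :: real assume f: "f \<in> dominated (\<Union>i. U i)" and e: "0 < e"
  define K where "K = {x\<in>X. e \<le> f x}"
  define f' where "f' = (\<lambda>x. max (f x - e) 0)"
  note c = cutoff[OF f e K_def f'_def]
  have "\<forall>i. \<exists>T. open T \<and> U i = X \<inter> T" using U by (simp add: openin_open)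
  then obtain T where T: "\<And>i. open (T i)" "\<And>i. U i = X \<inter> T i" by metis
  have "K \<subseteq> (\<Union>i\<in>UNIV. T i)" using c(2) T(2) by blast
  then obtain I where I: "finite I" "K \<subseteq> (\<Union>i\<in>I. T i)"
    using compactE_image[OF c(1), of UNIV T] T(1) by metis
  obtain n where n: "I \<subseteq> {..<n}" using I(1) finite_nat_iff_bounded by blast
  have Kn: "K \<subseteq> (\<Union>i<n. U i)" using I(2) n T(2) unfolding K_def by blast
  have f'd: "f' \<in> dominated (\<Union>i<n. U i)"
    unfolding dominated_def
  proof (intro CollectI conjI c(4) ballI)
    fix x assume "x \<in> X"
    then show "0 \<le> f' x" "f' x \<le> 1" "x \<notin> (\<Union>i<n. U i) \<longrightarrow> f' x = 0"
      using c(6)[of x] Kn by auto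
  qed
  have "0 \<le> \<psi> f'" using nonneg[OF c(4)] c(6) by blast
  then have "ennreal (\<psi> f) \<le> ennreal (\<psi> f') + ennreal e"
    using ennreal_leI[OF c(5)] e by (simp add: ennreal_plus)
  also have "ennreal (\<psi> f') \<le> inner_content (\<Union>i<n. U i)"
    unfolding inner_content_def using f'd by (rule SUP_upper)
  also have "\<dots> \<le> (\<Sum>i<n. inner_content (U i))" using U by (rule inner_content_UN_finite)
  also have "\<dots> \<le> (\<Sum>i. inner_content (U i))" by (rule sum_le_suminf) auto
  finally show "ennreal (\<psi> f) \<le> (\<Sum>i. inner_content (U i)) + ennreal e" by (simp add: add_right_mono)
qed

lemma outer_open: "openin (top_of_set X) U \<Longrightarrow> outer U = inner_content U"
  unfolding outer_def
  by (rule antisym) (auto intro!: INF_lower INF_greatest inner_content_mono)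

lemma outer_mono: "A \<subseteq> B \<Longrightarrow> outer A \<le> outer B"
  unfolding outer_def by (rule INF_superset_mono) auto

lemma outer_UN:
  fixes A :: "nat \<Rightarrow> 'a set"
  assumes "\<And>i. A i \<subseteq> X"
  shows "outer (\<Union>i. A i) \<le> (\<Sum>i. outer (A i))"
proof (rule ennreal_le_epsilon)
  fix e :: real assume e: "0 < e" and fin: "(\<Sum>i. outer (A i)) < top"
  have "\<exists>U. openin (top_of_set X) U \<and> A i \<subseteq> U \<and> inner_content U \<le> outer (A i) + ennreal (e * (1/2)^Suc i)" for i
  proof -
    have "outer (A i) < top" using fin by (auto dest!: ennreal_suminf_lessD)
    moreover have "0 < ennreal (e * (1/2)^Suc i)" using e by simp
    ultimately have "outer (A i) < outer (A i) + ennreal (e * (1/2)^Suc i)"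
      using ennreal_add_left_cancel_less[of "outer (A i)" 0] by simp
    then show ?thesis unfolding outer_def[of "A i"] INF_less_iff by (auto simp: less_imp_le)
  qed
  then obtain U where U: "\<And>i. openin (top_of_set X) (U i)" "\<And>i. A i \<subseteq> U i"
    "\<And>i. inner_content (U i) \<le> outer (A i) + ennreal (e * (1/2)^Suc i)" by metis
  have "outer (\<Union>i. A i) \<le> inner_content (\<Union>i. U i)"
    unfolding outer_def by (rule INF_lower) (use U in blast)
  also have "\<dots> \<le> (\<Sum>i. inner_content (U i))" using U(1) by (rule inner_content_UN)
  also have "\<dots> \<le> (\<Sum>i. outer (A i) + ennreal (e * (1/2)^Suc i))"
    using U(3) by (intro suminf_le) auto
  also have "\<dots> = (\<Sum>i. outer (A i)) + (\<Sum>i. ennreal (e * (1/2)^Suc i))"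
    by (rule suminf_add[symmetric]) auto
  finally show "outer (\<Union>i. A i) \<le> (\<Sum>i. outer (A i)) + ennreal e" using ennreal_mult_half[OF less_imp_le[OF e]] by (simp only:)
qed

lemma outer_empty: "outer {} = 0"
  using outer_open[of "{}"] inner_content_empty by simp

lemma outer_Un:
  assumes "A \<subseteq> X" "B \<subseteq> X"
  shows "outer (A \<union> B) \<le> outer A + outer B"
proof -
  have "(\<Union>i. (if i = 0 then A else if i = Suc 0 then B else {})) = A \<union> B"
    by (auto split: if_splits)
  moreover have "(\<Sum>i. outer (if i = 0 then A else if i = Suc 0 then B else {})) = outer A + outer B"
    by (subst suminf_finite[of "{0, 1}"]) (auto simp: outer_empty)
  ultimately show ?thesis
    using outer_UN[of "\<lambda>i. if i = 0 then A else if i = Suc 0 then B else {}"] assms by auto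
qed

text \<open>A function nearly exhausting \<open>W \<inter> U\<close> can be cut off to live on a
  compact \<open>K \<subseteq> W \<inter> U\<close>. Whatever is dominated by \<open>W - K\<close>
  can then be added without exceeding height 1, and \<open>W - K\<close> still contains
  \<open>W - U\<close>.\<close>

lemma outer_open_split:
  assumes U: "openin (top_of_set X) U" and W: "openin (top_of_set X) W"
  shows "outer (W \<inter> U) + outer (W - U) \<le> inner_content W"
proof -
  have "ennreal (\<psi> f) + outer (W - U) \<le> inner_content W" if f: "f \<in> dominated (W \<inter> U)" for f
  proof (rule ennreal_le_epsilon)
    fix e :: real assume e: "0 < e"
    define K where "K = {x\<in>X. e \<le> f x}"
    define f' where "f' = (\<lambda>x. max (f x - e) 0)"
    note c = cutoff[OF f e K_def f'_def]
    have WK: "openin (top_of_set X) (W - K)" using W c(3) by (rule openin_diff)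
    have f'0: "0 \<le> \<psi> f'" using nonneg[OF c(4)] c(6) by blast
    have "ennreal (\<psi> f') + ennreal (\<psi> g) \<le> inner_content W" if g: "g \<in> dominated (W - K)" for g
    proof -
      have gc: "continuous_on X g" and g0: "0 \<le> \<psi> g" using g nonneg by (auto simp: dominated_def)
      have "(\<lambda>x. f' x + g x) \<in> dominated W" unfolding dominated_def
      proof (intro CollectI conjI ballI)
        show "continuous_on X (\<lambda>x. f' x + g x)" using c(4) gc by (rule continuous_on_add)
        fix x assume x: "x \<in> X"
        have "0 \<le> g x \<and> g x \<le> 1 \<and> (x \<notin> W - K \<longrightarrow> g x = 0)" using g x by (auto simp: dominated_def)
        then show "0 \<le> f' x + g x" "f' x + g x \<le> 1" "x \<notin> W \<longrightarrow> f' x + g x = 0"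
          using c(6)[OF x] c(2) by (cases "x \<in> K"; auto)+
      qed
      then have "ennreal (\<psi> (\<lambda>x. f' x + g x)) \<le> inner_content W"
        unfolding inner_content_def by (rule SUP_upper)
      then show ?thesis using add[OF c(4) gc] f'0 g0 by (simp add: ennreal_plus)
    qed
    then have "ennreal (\<psi> f') + inner_content (W - K) \<le> inner_content W"
      unfolding inner_content_def[of "W - K"] using zero_dominated
      by (subst ennreal_SUP_add_right) (auto intro!: SUP_least)
    moreover have "outer (W - U) \<le> inner_content (W - K)"
      unfolding outer_open[OF WK, symmetric] by (rule outer_mono) (use c(2) in auto)
    ultimately have *: "ennreal (\<psi> f') + outer (W - U) \<le> inner_content W"
      by (meson add_left_mono order_trans)
    have "ennreal (\<psi> f) \<le> ennreal (\<psi> f') + ennreal e"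
      using ennreal_leI[OF c(5)] e f'0 by (simp add: ennreal_plus)
    then have "ennreal (\<psi> f) + outer (W - U) \<le> (ennreal (\<psi> f') + outer (W - U)) + ennreal e"
      using add_right_mono[of "ennreal (\<psi> f)" "ennreal (\<psi> f') + ennreal e" "outer (W - U)"]
      by (simp add: ac_simps)
    also have "\<dots> \<le> inner_content W + ennreal e" using * by (rule add_right_mono)
    finally show "ennreal (\<psi> f) + outer (W - U) \<le> inner_content W + ennreal e" .
  qed
  then have "inner_content (W \<inter> U) + outer (W - U) \<le> inner_content W"
    unfolding inner_content_def[of "W \<inter> U"] using zero_dominated
    by (subst ennreal_SUP_add_left[symmetric]) (auto intro!: SUP_least)
  then show ?thesis using outer_open[OF openin_Int[OF W U]] by simp
qed

lemma open_caratheodory: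
  assumes "openin (top_of_set X) U"
  shows "U \<in> lambda_system X (Pow X) outer"
  unfolding lambda_system_def
proof (intro CollectI conjI ballI)
  show U: "U \<in> Pow X" using assms openin_imp_subset by blast
  fix E assume E: "E \<in> Pow X"
  show "outer (U \<inter> E) + outer ((X - U) \<inter> E) = outer E"
  proof (rule antisym)
    show "outer (U \<inter> E) + outer ((X - U) \<inter> E) \<le> outer E" unfolding outer_def[of E]
    proof (rule INF_greatest)
      fix W assume "W \<in> {U. openin (top_of_set X) U \<and> E \<subseteq> U}"
      then have W: "openin (top_of_set X) W" "E \<subseteq> W" by auto
      have "outer (U \<inter> E) + outer ((X - U) \<inter> E) \<le> outer (W \<inter> U) + outer (W - U)"
        using W E by (intro add_mono outer_mono) auto
      then show "outer (U \<inter> E) + outer ((X - U) \<inter> E) \<le> inner_content W"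
        using outer_open_split[OF assms W(1)] by simp
    qed
    have "(U \<inter> E) \<union> ((X - U) \<inter> E) = E" using E by auto
    then show "outer E \<le> outer (U \<inter> E) + outer ((X - U) \<inter> E)"
      using outer_Un[of "U \<inter> E" "(X - U) \<inter> E"] E by auto
  qed
qed

lemma sets_restrict_borel_eq:
  "sets (restrict_space borel X) = sigma_sets X {U. openin (top_of_set X) U}"
proof -
  have X: "X \<in> sigma_sets UNIV {S. open S}"
    using borel_closed[OF compact_imp_closed[OF compact]] by (simp add: borel_def)
  have "sets (restrict_space borel X) = (\<inter>) X ` sigma_sets UNIV {S. open S}"
    by (simp add: sets_restrict_space borel_def)
  also have "\<dots> = sigma_sets X ((\<inter>) X ` {S. open S})"
    using X by (rule sigma_sets_Int) simp
  also have "(\<inter>) X ` {S. open S} = {U. openin (top_of_set X) U}"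
    by (auto simp: openin_open)
  finally show ?thesis .
qed

definition representing :: "'a measure" where
  "representing = measure_of X (sets (restrict_space borel X)) outer"

lemma space_restrict [simp]: "space (restrict_space borel X) = X"
  by (simp add: space_restrict_space)

lemma sets_representing [simp]: "sets representing = sets (restrict_space borel X)"
proof -
  have "sets (restrict_space borel X) \<subseteq> Pow X"
    using sets.space_closed[of "restrict_space borel X"] by simp
  then show ?thesis unfolding representing_def
    using sets.sigma_sets_eq[of "restrict_space borel X"] by (simp add: sets_measure_of)
qed

lemma space_representing [simp]: "space representing = X"
  using sets_eq_imp_space_eq[OF sets_representing] by simp

lemma emeasure_representing:
  assumes B: "B \<in> sets (restrict_space borel X)"
  shows "emeasure representing B = outer B"
proof -
  interpret P: sigma_algebra X "Pow X" by (rule sigma_algebra_Pow)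
  have "outer_measure_space (Pow X) outer"
    unfolding outer_measure_space_def positive_def increasing_def countably_subadditive_def
    using outer_empty outer_mono outer_UN by (simp add: image_subset_iff)
  then have m: "measure_space X (lambda_system X (Pow X) outer) outer"
    by (rule P.caratheodory_lemma)
  then interpret L: sigma_algebra X "lambda_system X (Pow X) outer"
    by (simp add: measure_space_def)
  have sub: "sets (restrict_space borel X) \<subseteq> lambda_system X (Pow X) outer"
    unfolding sets_restrict_borel_eq by (rule L.sigma_sets_subset) (use open_caratheodory in auto)
  have ca: "countably_additive (sets representing) outer"
    using m sub unfolding measure_space_def countably_additive_def sets_representing by blast
  show ?thesis
    by (rule emeasure_measure_of[OF representing_def _ _ ca])
      (use B sets.space_closed[of "restrict_space borel X"] in \<open>auto simp: positive_def outer_empty space_restrict_space\<close>)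
qed

lemma openin_sets: "openin (top_of_set X) U \<Longrightarrow> U \<in> sets (restrict_space borel X)"
  unfolding sets_restrict_borel_eq by auto

lemma closedin_sets: "closedin (top_of_set X) K \<Longrightarrow> K \<in> sets (restrict_space borel X)"
  using openin_sets[of "X - K"] sets.compl_sets[of "X - K" "restrict_space borel X"] closedin_subset[of "top_of_set X" K]
  by (simp add: closedin_def double_diff)

lemma prob_space_representing: "prob_space representing"
  by standard (use emeasure_representing[OF openin_sets, of X] outer_open[of X] inner_content_space in auto)

text \<open>Outer regularity is built into \<open>outer\<close>. Applied to \<open>X - B\<close> it
  gives an open set whose complement in \<open>X\<close> is a compact subset of \<open>B\<close>
  with almost the measure of \<open>B\<close>.\<close>

lemma inner_regular:
  assumes B: "B \<in> sets (restrict_space borel X)"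
  shows "emeasure representing B = (SUP K\<in>{K. compact K \<and> K \<subseteq> B}. emeasure representing K)"
proof (rule antisym)
  interpret prob_space representing by (rule prob_space_representing)
  have BX: "B \<subseteq> X" using B sets.sets_into_space[OF B] by (simp add: space_restrict_space)
  have XB: "X - B \<in> sets (restrict_space borel X)"
    using B sets.compl_sets[OF B] by (simp add: space_restrict_space)
  show "emeasure representing B \<le> (SUP K\<in>{K. compact K \<and> K \<subseteq> B}. emeasure representing K)"
  proof (rule ennreal_le_epsilon)
    fix e :: real assume e: "0 < e"
    have "outer (X - B) < top"
      using emeasure_representing[OF XB] emeasure_finite[of "X - B"] by (simp add: less_top)
    then have "outer (X - B) < outer (X - B) + ennreal e"
      using ennreal_add_left_cancel_less[of "outer (X - B)" 0] e by simp
    then obtain U where U: "openin (top_of_set X) U" "X - B \<subseteq> U" "inner_content U < outer (X - B) + ennreal e"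
      unfolding outer_def[of "X - B"] INF_less_iff by auto
    define K where "K = X - U"
    have K: "compact K" "K \<subseteq> B" "K \<in> sets representing"
      using U closedin_compact[OF compact, of K] closedin_sets[of K] by (auto simp: K_def openin_closedin_eq)
    have "measure representing U < measure representing (X - B) + e"
    proof -
      have "emeasure representing U < emeasure representing (X - B) + ennreal e"
        using U outer_open emeasure_representing[OF XB] emeasure_representing[OF openin_sets[OF U(1)]] by simp
      then show ?thesis using e by (simp add: emeasure_eq_measure ennreal_less_iff flip: ennreal_plus)
    qed
    moreover have "measure representing U = 1 - measure representing K"
      using prob_compl[of U] prob_compl[OF K(3)] U(1) openin_sets[OF U(1)] openin_imp_subset[OF U(1)]
      by (simp add: K_def double_diff)
    moreover have "measure representing (X - B) = 1 - measure representing B"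
      using prob_compl[of B] B by simp
    ultimately have "emeasure representing B \<le> emeasure representing K + ennreal e"
      using e by (simp add: emeasure_eq_measure flip: ennreal_plus)
    also have "\<dots> \<le> (SUP K\<in>{K. compact K \<and> K \<subseteq> B}. emeasure representing K) + ennreal e"
      using K by (intro add_right_mono SUP_upper) auto
    finally show "emeasure representing B \<le> (SUP K\<in>{K. compact K \<and> K \<subseteq> B}. emeasure representing K) + ennreal e" .
  qed
  show "(SUP K\<in>{K. compact K \<and> K \<subseteq> B}. emeasure representing K) \<le> emeasure representing B"
    by (rule SUP_least) (use B in \<open>auto intro!: emeasure_mono\<close>)
qed

lemma radon_representing: "radon_prob X representing"
  unfolding radon_prob_def using prob_space_representing inner_regular by simp

text \<open>Slicing \<open>f\<close> at the heights \<open>i/n\<close> compares both sides with the measures of the sets \<open>{f > i/n}\<close>.\<close>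

lemma le_integral_01:
  assumes f: "continuous_on X f" and f01: "\<And>x. x \<in> X \<Longrightarrow> 0 \<le> f x \<and> f x \<le> 1"
  shows "\<psi> f \<le> integral\<^sup>L representing f"
proof (rule field_le_epsilon)
  interpret prob_space representing by (rule prob_space_representing)
  fix e :: real assume "0 < e"
  then obtain n0 where n0: "inverse (real (Suc n0)) < e" using reals_Archimedean by blast
  define n where "n = real (Suc n0)"
  have n: "0 < n" "1/n < e" using n0 by (auto simp: n_def inverse_eq_divide)
  define g where "g i x = min (max (f x - i/n) 0) (1/n)" for i :: nat and x
  define U where "U i = {x\<in>X. f x > i/n}" for i :: nat
  have gc: "continuous_on X (g i)" for i unfolding g_def by (intro continuous_intros f)
  have slice: "(\<Sum>i<m. g i x) = min (f x) (m/n)" if "x \<in> X" for x m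
  proof (induction m)
    case 0 then show ?case using f01[OF that] by simp
  next
    case (Suc m)
    have *: "min (max (F - a) 0) b = min F (a + b) - min F a" if "0 \<le> b" for F a b :: real
      using that by (auto simp: min_def max_def)
    have "real (Suc m) / n = m / n + 1 / n" by (simp add: add_divide_distrib)
    then show ?case using Suc.IH *[of "1/n" "f x" "m/n"] n by (simp add: g_def)
  qed
  have Uo: "openin (top_of_set X) (U i)" for i
  proof -
    have "openin (top_of_set X) (X \<inter> f -` {i/n<..})" using f by (rule continuous_openin_preimage_gen) simp
    then show ?thesis by (simp add: U_def vimage_def Int_def)
  qed
  have ub: "\<psi> (g i) \<le> measure representing (U i) / n" for i
  proof -
    have "(\<lambda>x. n * g i x) \<in> dominated (U i)"
      unfolding dominated_def
    proof (intro CollectI conjI ballI impI)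
      show "continuous_on X (\<lambda>x. n * g i x)" using gc by (rule continuous_on_mult_left)
      fix x assume x: "x \<in> X"
      have "0 \<le> g i x" "g i x \<le> 1/n" "x \<notin> U i \<Longrightarrow> g i x = 0" using n x by (auto simp: g_def U_def)
      then show "0 \<le> n * g i x" "n * g i x \<le> 1" "x \<notin> U i \<Longrightarrow> n * g i x = 0"
        using n by (auto simp: field_simps)
    qed
    then have "ennreal (\<psi> (\<lambda>x. n * g i x)) \<le> emeasure representing (U i)"
      unfolding emeasure_representing[OF openin_sets[OF Uo]] outer_open[OF Uo] inner_content_def by (rule SUP_upper)
    then have "n * \<psi> (g i) \<le> measure representing (U i)"
      using scale[OF gc] by (simp add: emeasure_eq_measure)
    then show ?thesis using n by (simp add: field_simps)
  qed
  have UX: "U i \<inter> X = U i" for i by (auto simp: U_def)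
  have Us: "U i \<in> sets representing" for i using openin_sets[OF Uo] by simp
  have "\<psi> f = \<psi> (\<lambda>x. \<Sum>i<Suc n0. g i x)"
    using slice[of _ "Suc n0"] f01 n f gc
    by (intro antisym mono) (auto simp: n_def intro!: continuous_on_sum)
  also have "\<dots> = (\<Sum>i<Suc n0. \<psi> (g i))" by (rule sum) (use gc in auto)
  also have "\<dots> \<le> (\<Sum>i<Suc n0. measure representing (U i) / n)" by (intro sum_mono ub)
  also have "\<dots> = integral\<^sup>L representing (\<lambda>x. \<Sum>i<Suc n0. indicator (U i) x / n)"
    using Us UX by (subst Bochner_Integration.integral_sum) (simp_all add: emeasure_eq_measure)
  also have "\<dots> \<le> integral\<^sup>L representing (\<lambda>x. f x + 1/n)"
  proof (rule integral_mono)
    show "integrable representing (\<lambda>x. \<Sum>i<Suc n0. indicator (U i) x / n)"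
      using Us by (intro Bochner_Integration.integrable_sum) (simp add: emeasure_eq_measure)
    show "integrable representing (\<lambda>x. f x + 1/n)" using radon_integrable[OF compact radon_representing f] by simp
    fix x assume "x \<in> space representing"
    then have x: "x \<in> X" by simp
    \<comment> \<open>At most \<open>n * f x + 1\<close> indices satisfy \<open>i/n < f x\<close>,
      whence the extra \<open>1/n\<close>; the bound \<open>m/n\<close> is carried along for the
      stages at which \<open>m/n\<close> is still below \<open>f x\<close>.\<close>
    have "(\<Sum>i<m. indicator (U i) x / n) \<le> min (f x + 1/n) (m/n)" for m
    proof (induction m)
      case 0 then show ?case using f01[OF x] n by simp
    next
      case (Suc m)
      have *: "S + (if a < F then b else 0) \<le> min (F + b) (a + b)" if "S \<le> min (F + b) a" "0 \<le> b" for S a F b :: real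
        using that by auto
      have "real (Suc m) / n = m / n + 1 / n" by (simp add: add_divide_distrib)
      moreover have "indicator (U m) x / n = (if m / n < f x then 1 / n else 0)" using x by (simp add: U_def)
      ultimately show ?case using *[OF Suc.IH] n by simp
    qed
    from this[of "Suc n0"] show "(\<Sum>i<Suc n0. indicator (U i) x / n) \<le> f x + 1/n" by linarith
  qed
  also have "\<dots> = integral\<^sup>L representing f + 1/n"
    using radon_integrable[OF compact radon_representing f] prob_space by simp
  finally show "\<psi> f \<le> integral\<^sup>L representing f + e" using n by linarith
qed

lemma le_integral:
  assumes f: "continuous_on X f"
  shows "\<psi> f \<le> integral\<^sup>L representing f"
proof -
  interpret prob_space representing by (rule prob_space_representing)
  obtain C where C: "0 < C" "\<And>x. x \<in> X \<Longrightarrow> \<bar>f x\<bar> \<le> C" using continuous_bound[OF compact f] by blast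
  define g where "g x = (1/(2*C)) * (f x + C)" for x
  have gc: "continuous_on X g" unfolding g_def by (intro continuous_intros f)
  have "\<psi> g \<le> integral\<^sup>L representing g"
  proof (rule le_integral_01[OF gc])
    fix x assume "x \<in> X"
    then have "- C \<le> f x" "f x \<le> C" using C(2)[of x] by auto
    then show "0 \<le> g x \<and> g x \<le> 1" using C(1) by (simp add: g_def)
  qed
  moreover have "\<psi> g = (1/(2*C)) * (\<psi> f + C)"
    unfolding g_def using scale[of "\<lambda>x. f x + C" "1/(2*C)"] add[OF f, of "\<lambda>_. C"] const[of C]
      continuous_on_add[OF f continuous_on_const[of _ C]] by simp
  moreover have "integral\<^sup>L representing g = (1/(2*C)) * (integral\<^sup>L representing f + C)"
    unfolding g_def using radon_integrable[OF compact radon_representing f] prob_space by simp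
  ultimately show ?thesis using C(1) by (simp add: field_simps)
qed

theorem riesz_representation: "continuous_on X f \<Longrightarrow> integral\<^sup>L representing f = \<psi> f"
  using le_integral[of f] le_integral[of "\<lambda>x. - f x"] diff[of "\<lambda>_. 0" f] const[of 0]
  by (simp add: continuous_on_minus)

end

section \<open>Inner regularity, uniqueness and existence of Radon probability measures\<close>

lemma radon_bounded_integrable:
  fixes f :: "'a::t2_space \<Rightarrow> real"
  assumes \<mu>: "radon_prob X \<mu>" and f: "f \<in> borel_measurable \<mu>" and b: "\<And>x. x \<in> X \<Longrightarrow> \<bar>f x\<bar> \<le> C"
  shows "integrable \<mu> f"
proof -
  interpret prob_space \<mu> using \<mu> by (rule radon_prob_space)
  show ?thesis
    by (intro integrable_const_bound[of _ C] f AE_I2) (use b in \<open>auto simp: radon_space[OF \<mu>]\<close>)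
qed

lemma radon_compact_sets:
  assumes \<mu>: "radon_prob X \<mu>" and "compact (K::'a::t2_space set)" "K \<subseteq> X"
  shows "K \<in> sets \<mu>"
  using assms by (auto simp: radon_sets[OF \<mu>] sets_restrict_space borel_closed compact_imp_closed intro!: image_eqI[of _ _ K])

lemma radon_inner:
  assumes \<mu>: "radon_prob X \<mu>" and "B \<in> sets \<mu>" "a < measure \<mu> B"
  obtains K where "compact K" "K \<subseteq> B" "K \<in> sets \<mu>" "a < measure \<mu> (K::'a::t2_space set)"
proof -
  interpret prob_space \<mu> using \<mu> by (rule radon_prob_space)
  have BX: "B \<subseteq> X" using sets.sets_into_space[OF assms(2)] radon_space[OF \<mu>] by simp
  show thesis
  proof (cases "a < 0")
    case True
    \<comment> \<open>For negative \<open>a\<close> the conversion to \<open>ennreal\<close> would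
      collapse \<open>a\<close> to 0 and could lose the strict inequality.\<close>
    show thesis by (rule that[of "{}"]) (use True in auto)
  next
    case False
    have "ennreal a < emeasure \<mu> B" using assms(3) False by (simp add: emeasure_eq_measure ennreal_lessI)
    moreover have "emeasure \<mu> B = (SUP K\<in>{K. compact K \<and> K \<subseteq> B}. emeasure \<mu> K)"
      using \<mu> assms(2) unfolding radon_prob_def by blast
    ultimately obtain K where K: "compact K" "K \<subseteq> B" "ennreal a < emeasure \<mu> K"
      by (auto simp: less_SUP_iff)
    then show thesis
      using False radon_compact_sets[OF \<mu> K(1)] BX
      by (intro that[of K]) (auto simp: emeasure_eq_measure ennreal_less_iff)
  qed
qed

text \<open>If a compact \<open>K\<close> had larger \<open>\<mu>\<close>-measure, inner regularity
  of \<open>\<nu>\<close> would give a compact \<open>L\<close> off \<open>K\<close> whose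
  \<open>\<nu>\<close>-measure exceeds \<open>1 - measure \<mu> K\<close>, and a Urysohn function
  for \<open>K\<close> and \<open>L\<close> would have different integrals. Equality on compact sets
  passes to Borel sets by inner regularity.\<close>

lemma radon_prob_eqI:
  fixes X :: "'a::t2_space set"
  assumes X: "compact X" and \<mu>: "radon_prob X \<mu>" and \<nu>: "radon_prob X \<nu>"
    and eq: "\<And>f. continuous_on X f \<Longrightarrow> integral\<^sup>L \<mu> f = (integral\<^sup>L \<nu> f :: real)"
  shows "\<mu> = \<nu>"
proof (rule measure_eqI)
  have le: "measure \<mu> K \<le> measure \<nu> K" if K: "compact K" "K \<subseteq> X" and \<mu>: "radon_prob X \<mu>" and \<nu>: "radon_prob X \<nu>"
    and eq: "\<And>f. continuous_on X f \<Longrightarrow> integral\<^sup>L \<mu> f = (integral\<^sup>L \<nu> f :: real)" for K and \<mu> \<nu> :: "'a measure"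
  proof (rule ccontr)
    interpret M: prob_space \<mu> using \<mu> by (rule radon_prob_space)
    interpret N: prob_space \<nu> using \<nu> by (rule radon_prob_space)
    assume "\<not> measure \<mu> K \<le> measure \<nu> K"
    moreover have KN: "K \<in> sets \<nu>" and KM: "K \<in> sets \<mu>" using radon_compact_sets K \<mu> \<nu> by blast+
    ultimately have "1 - measure \<mu> K < measure \<nu> (space \<nu> - K)" using N.prob_compl[OF KN] by simp
    then obtain L where L: "compact L" "L \<subseteq> space \<nu> - K" "L \<in> sets \<nu>" "1 - measure \<mu> K < measure \<nu> L"
      using radon_inner[OF \<nu>, of "space \<nu> - K"] KN by blast
    have LX: "L \<subseteq> X" using L(2) radon_space[OF \<nu>] by blast
    obtain f :: "'a \<Rightarrow> real" where f: "continuous_on X f" "\<And>x. x \<in> X \<Longrightarrow> 0 \<le> f x \<and> f x \<le> 1"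
      "\<And>x. x \<in> K \<Longrightarrow> f x = 1" "\<And>x. x \<in> L \<Longrightarrow> f x = 0"
    proof (rule urysohn_on[OF X])
      show "closedin (top_of_set X) K" "closedin (top_of_set X) L" "K \<inter> L = {}"
        using K L LX by (auto simp: closed_subset compact_imp_closed)
    qed blast
    have "measure \<mu> K = integral\<^sup>L \<mu> (indicator K)" using KM by (simp add: Int_absorb2 sets.sets_into_space)
    also have "\<dots> \<le> integral\<^sup>L \<mu> f"
      using KM f by (intro integral_mono radon_integrable[OF X \<mu> f(1)])
        (auto simp: radon_space[OF \<mu>] indicator_def M.emeasure_eq_measure)
    also have "\<dots> = integral\<^sup>L \<nu> f" using eq f(1) .
    also have "\<dots> \<le> integral\<^sup>L \<nu> (indicator (space \<nu> - L))"
      using sets.compl_sets[OF L(3)] f by (intro integral_mono radon_integrable[OF X \<nu> f(1)])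
        (auto simp: radon_space[OF \<nu>] indicator_def N.emeasure_eq_measure)
    also have "\<dots> = 1 - measure \<nu> L" using L(3) N.prob_compl[OF L(3)] by (simp add: Int_absorb2 sets.sets_into_space)
    finally show False using L(4) by simp
  qed
  show "sets \<mu> = sets \<nu>" using radon_sets \<mu> \<nu> by metis
  fix B assume B: "B \<in> sets \<mu>"
  then have B': "B \<in> sets \<nu>" using radon_sets \<mu> \<nu> by metis
  have BX: "B \<subseteq> X" using sets.sets_into_space[OF B] radon_space[OF \<mu>] by simp
  have "emeasure \<mu> B = (SUP K\<in>{K. compact K \<and> K \<subseteq> B}. emeasure \<mu> K)"
    using \<mu> B unfolding radon_prob_def by blast
  also have "\<dots> = (SUP K\<in>{K. compact K \<and> K \<subseteq> B}. emeasure \<nu> K)"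
  proof (rule SUP_cong[OF refl])
    fix K assume "K \<in> {K. compact K \<and> K \<subseteq> B}"
    then have K: "compact K" "K \<subseteq> X" using BX by auto
    have "measure \<mu> K = measure \<nu> K"
      using le[OF K \<mu> \<nu> eq] le[OF K \<nu> \<mu> eq[symmetric]] by simp
    then show "emeasure \<mu> K = emeasure \<nu> K"
      using radon_prob_space[OF \<mu>] radon_prob_space[OF \<nu>]
      by (simp add: finite_measure.emeasure_eq_measure prob_space_def)
  qed
  also have "\<dots> = emeasure \<nu> B" using \<nu> B' unfolding radon_prob_def by metis
  finally show "emeasure \<mu> B = emeasure \<nu> B" .
qed

lemma radon_prob_of_functional:
  fixes X :: "'a::t2_space set"
  assumes "riesz_functional X \<psi>"
  obtains \<mu> where "radon_prob X \<mu>" "\<And>f. continuous_on X f \<Longrightarrow> integral\<^sup>L \<mu> f = \<psi> f"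
  using riesz_functional.radon_representing[OF assms] riesz_functional.riesz_representation[OF assms] by blast

lemma subspace_continuous: "subspace {f. continuous_on X (f :: 'a::topological_space \<Rightarrow> real)}"
  by (auto simp: subspace_def plus_fun_def scaleR_fun_def zero_fun_def intro!: continuous_intros)

text \<open>Each member of \<open>K\<close> prescribes an inequality
  \<open>integral\<^sup>L \<mu> v \<le> t\<close>, and \<open>feas\<close> says that none
  contradicts the lower bound that every probability measure satisfies. Positivity and total mass 1
  are inequalities as well: the cone \<open>C\<close> adds \<open>\<phi> v \<le> r\<close> for all
  \<open>v\<close> that are at most \<open>r\<close> on \<open>X\<close>.\<close>

lemma radon_prob_exists:
  fixes X :: "'a::t2_space set"
  assumes X: "compact X"
    and ne: "(\<lambda>_. 0, 0) \<in> K"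
    and cont: "\<And>v t. (v, t) \<in> K \<Longrightarrow> continuous_on X v"
    and add: "\<And>u v s t. (u, s) \<in> K \<Longrightarrow> (v, t) \<in> K \<Longrightarrow> (\<lambda>x. u x + v x, s + t) \<in> K"
    and scale: "\<And>r v t. 0 \<le> r \<Longrightarrow> (v, t) \<in> K \<Longrightarrow> (\<lambda>x. r * v x, r * t) \<in> K"
    and feas: "\<And>v t c. (v, t) \<in> K \<Longrightarrow> (\<And>x. x \<in> X \<Longrightarrow> c \<le> v x) \<Longrightarrow> c \<le> (t::real)"
  obtains \<mu> where "radon_prob X \<mu>" "\<And>v t. (v, t) \<in> K \<Longrightarrow> integral\<^sup>L \<mu> v \<le> t"
proof -
  define C where "C = {(v, t). \<exists>k s r. (k, s) \<in> K \<and> (\<forall>x\<in>X. v x \<le> k x + r) \<and> s + r \<le> (t::real)}"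
  have CI: "(v, t) \<in> C" if "(k, s) \<in> K" "\<And>x. x \<in> X \<Longrightarrow> v x \<le> k x + r" "s + r \<le> t" for v t k s r
    unfolding C_def using that by blast
  obtain \<phi> where \<phi>: "\<And>u v. u \<in> {f. continuous_on X f} \<Longrightarrow> v \<in> {f. continuous_on X f} \<Longrightarrow> \<phi> (u + v) = \<phi> u + \<phi> v"
    "\<And>r v. v \<in> {f. continuous_on X f} \<Longrightarrow> \<phi> (r *\<^sub>R v) = r * \<phi> v"
    "\<And>v t. v \<in> {f. continuous_on X f} \<Longrightarrow> (v, t) \<in> C \<Longrightarrow> \<phi> v \<le> (t::real)"
  proof (rule hahn_banach_cone[OF subspace_continuous[of X], of C])
    fix u v s t assume "(u, s) \<in> C" "(v, t) \<in> C"
    then obtain k s' r k' t' r' where *: "(k, s') \<in> K" "\<forall>x\<in>X. u x \<le> k x + r" "s' + r \<le> s"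
      "(k', t') \<in> K" "\<forall>x\<in>X. v x \<le> k' x + r'" "t' + r' \<le> t" unfolding C_def by blast
    show "(u + v, s + t) \<in> C"
      by (rule CI[OF add[OF *(1) *(4)], of _ "r + r'"]) (use * in \<open>force+\<close>)
  next
    fix q v t assume q: "(0::real) \<le> q" and "(v, t) \<in> C"
    then obtain k s r where *: "(k, s) \<in> K" "\<forall>x\<in>X. v x \<le> k x + r" "s + r \<le> t" unfolding C_def by blast
    show "(q *\<^sub>R v, q * t) \<in> C"
    proof (rule CI[OF scale[OF q *(1)], of _ "q * r"])
      show "(q *\<^sub>R v) x \<le> q * k x + q * r" if "x \<in> X" for x
        using mult_left_mono[OF bspec[OF *(2) that] q] by (simp add: scaleR_fun_def algebra_simps)
      show "q * s + q * r \<le> q * t" using mult_left_mono[OF *(3) q] by (simp add: algebra_simps)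
    qed
  next
    fix v assume "v \<in> {f. continuous_on X (f :: 'a \<Rightarrow> real)}"
    then obtain C' where "\<And>x. x \<in> X \<Longrightarrow> \<bar>v x\<bar> \<le> C'"
      using continuous_bound[OF X, of v] by blast
    then show "\<exists>t. (v, t) \<in> C"
      by (intro exI[of _ C'] CI[OF ne, of _ C']) (auto simp: abs_le_iff)
  next
    fix t assume "(0, t) \<in> C"
    then obtain k s r where *: "(k, s) \<in> K" "\<forall>x\<in>X. 0 \<le> k x + r" "s + r \<le> t" unfolding C_def by auto
    then have "- r \<le> s" by (intro feas[OF *(1)]) (auto simp: algebra_simps minus_le_iff)
    then show "0 \<le> t" using *(3) by linarith
  qed blast
  have le: "\<phi> v \<le> r" if "continuous_on X v" "\<And>x. x \<in> X \<Longrightarrow> v x \<le> r" for v r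
    by (rule \<phi>(3)[OF _ CI[OF ne, of _ r]]) (use that in auto)
  have sc: "\<phi> (\<lambda>x. c * v x) = c * \<phi> v" if "continuous_on X v" for c v
    using \<phi>(2)[of v c] that by (simp add: scaleR_fun_def)
  have "riesz_functional X \<phi>"
  proof
    show "compact X" by fact
    show "\<phi> (\<lambda>x. f x + g x) = \<phi> f + \<phi> g" if "continuous_on X f" "continuous_on X g" for f g
      using \<phi>(1)[of f g] that by (simp add: plus_fun_def)
    show "\<phi> (\<lambda>x. c * f x) = c * \<phi> f" if "continuous_on X f" for c f using sc that .
    show "0 \<le> \<phi> f" if "continuous_on X f" "\<And>x. x \<in> X \<Longrightarrow> 0 \<le> f x" for f
      using le[of "\<lambda>x. -1 * f x" 0] sc[OF that(1), of "-1"] that by (auto intro!: continuous_intros simp: continuous_on_minus)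
    show "\<phi> (\<lambda>_. 1) = 1"
      using le[of "\<lambda>_. 1" 1] le[of "\<lambda>_. - 1" "-1"] sc[of "\<lambda>_. 1" "-1"] by simp
  qed
  then obtain \<mu> where \<mu>: "radon_prob X \<mu>" "\<And>f. continuous_on X f \<Longrightarrow> integral\<^sup>L \<mu> f = \<phi> f"
    by (rule radon_prob_of_functional) blast
  show thesis
  proof (rule that[OF \<mu>(1)])
    fix v t assume vt: "(v, t) \<in> K"
    have "\<phi> v \<le> t" by (rule \<phi>(3)[OF _ CI[OF vt, of _ 0]]) (use cont[OF vt] in auto)
    then show "integral\<^sup>L \<mu> v \<le> t" using \<mu>(2)[OF cont[OF vt]] by simp
  qed
qed

section \<open>Continuous affine functions\<close>

lemma tvs_tendsto_scaleR:
  fixes g :: "'b \<Rightarrow> 'a::topological_vector_space"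
  assumes "(f \<longlongrightarrow> r) F" "(g \<longlongrightarrow> x) F"
  shows "((\<lambda>z. f z *\<^sub>R g z) \<longlongrightarrow> r *\<^sub>R x) F"
  using filterlim_compose[OF tendsto_scaleR_Pair filterlim_Pair[OF assms]] by simp

lemma tvs_continuous_on_scaleR:
  fixes g :: "'b::topological_space \<Rightarrow> 'a::topological_vector_space"
  shows "continuous_on S f \<Longrightarrow> continuous_on S g \<Longrightarrow> continuous_on S (\<lambda>z. f z *\<^sub>R g z)"
  unfolding continuous_on_def by (blast intro: tvs_tendsto_scaleR)

lemma absorbing_nhd:
  fixes V :: "'a::topological_vector_space set"
  assumes "open V" "0 \<in> V"
  obtains r where "0 < r" "(1/r) *\<^sub>R v \<in> V"
proof -
  have "((\<lambda>n. (1 / real (Suc n)) *\<^sub>R v) \<longlongrightarrow> 0 *\<^sub>R v) sequentially"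
    by (intro tvs_tendsto_scaleR tendsto_const) (use LIMSEQ_inverse_real_of_nat in \<open>simp add: inverse_eq_divide\<close>)
  then have "\<forall>\<^sub>F n in sequentially. (1 / real (Suc n)) *\<^sub>R v \<in> V"
    using assms by (intro topological_tendstoD) auto
  then obtain n where "(1 / real (Suc n)) *\<^sub>R v \<in> V" by (auto simp: eventually_sequentially)
  then show thesis using that[of "real (Suc n)"] by simp
qed

text \<open>The system to solve is \<open>\<phi> \<le> 1\<close> on \<open>V\<close> and
  \<open>\<phi> z \<ge> 1\<close>, with \<open>V\<close> a symmetric convex neighbourhood of 0 that
  misses \<open>z = y - x\<close>. An inconsistency would read \<open>m w = l z\<close> with
  \<open>w\<close> in \<open>V\<close> and \<open>m < l\<close>, which puts \<open>z\<close> into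
  \<open>V\<close>. Boundedness on \<open>V\<close> gives continuity.\<close>

lemma separating_functional:
  fixes x y :: "'a::locally_convex_space"
  assumes "x \<noteq> y"
  obtains \<phi> :: "'a \<Rightarrow> real" where "linear \<phi>" "continuous_on UNIV \<phi>" "\<phi> x \<noteq> \<phi> y"
proof -
  define z where "z = y - x"
  have z: "z \<noteq> 0" using assms by (simp add: z_def)
  obtain V0 where V0: "open V0" "0 \<in> V0" "V0 \<subseteq> - {z}"
    "\<forall>a\<in>V0. \<forall>b\<in>V0. \<forall>t\<in>{0..1}. (1 - t) *\<^sub>R a + t *\<^sub>R b \<in> V0"
    using convex_nhds_base[of "- {z}" 0] z by auto
  define V where "V = V0 \<inter> uminus -` V0"
  have "open (uminus -` V0)"
    by (intro open_vimage V0(1) continuous_intros)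
  then have V: "open V" "0 \<in> V" "z \<notin> V" using V0 by (auto simp: V_def)
  have Vm: "- a \<in> V" if "a \<in> V" for a using that by (simp add: V_def)
  have Vc: "(1 - t) *\<^sub>R a + t *\<^sub>R b \<in> V" if "a \<in> V" "b \<in> V" "t \<in> {0..1}" for a b t
  proof -
    have "- ((1 - t) *\<^sub>R a + t *\<^sub>R b) = (1 - t) *\<^sub>R (- a) + t *\<^sub>R (- b)" by simp
    then show ?thesis using that V0(4) unfolding V_def by (metis IntD1 IntD2 IntI vimageD vimageI2)
  qed
  define C where "C = {(m *\<^sub>R w - l *\<^sub>R z, t) | m l w t. 0 \<le> m \<and> 0 \<le> l \<and> w \<in> V \<and> m - l \<le> (t::real)}"
  have CI: "(v, t) \<in> C" if "v = m *\<^sub>R w - l *\<^sub>R z" "0 \<le> m" "0 \<le> l" "w \<in> V" "m - l \<le> t" for v m l w t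
    unfolding C_def using that by blast
  have sub: "subspace (UNIV :: 'a set)" by simp
  have C1: "(u + v, s + t) \<in> C" if u: "(u, s) \<in> C" and v: "(v, t) \<in> C" for u v s t
  proof -
    obtain m l w where 1: "u = m *\<^sub>R w - l *\<^sub>R z" "0 \<le> m" "0 \<le> l" "w \<in> V" "m - l \<le> s"
      using u unfolding C_def by blast
    obtain m' l' w' where 2: "v = m' *\<^sub>R w' - l' *\<^sub>R z" "0 \<le> m'" "0 \<le> l'" "w' \<in> V" "m' - l' \<le> t"
      using v unfolding C_def by blast
    show ?thesis
    proof (cases "m + m' = 0")
      case True
      then have "m = 0" "m' = 0" using 1 2 by auto
      then show ?thesis using 1 2 by (intro CI[of _ 0 w "l + l'"]) (auto simp: algebra_simps)
    next
      case False
      then have mm: "0 < m + m'" using 1 2 by auto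
      define w2 where "w2 = (1 - m'/(m+m')) *\<^sub>R w + (m'/(m+m')) *\<^sub>R w'"
      have "w2 \<in> V" unfolding w2_def by (rule Vc) (use 1 2 mm in auto)
      moreover have "(m + m') *\<^sub>R w2 = m *\<^sub>R w + m' *\<^sub>R w'"
      proof -
        have "1 - m'/(m+m') = m/(m+m')" using mm by (simp add: field_simps)
        then show ?thesis using mm by (simp add: w2_def scaleR_add_right)
      qed
      then have "u + v = (m + m') *\<^sub>R w2 - (l + l') *\<^sub>R z"
        unfolding 1(1) 2(1) by (simp add: scaleR_left_distrib)
      ultimately show ?thesis using 1 2 by (intro CI[of _ "m + m'" w2 "l + l'"]) auto
    qed
  qed
  have C2: "(r *\<^sub>R v, r * t) \<in> C" if r: "0 \<le> r" and v: "(v, t) \<in> C" for r v t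
  proof -
    obtain m l w where 1: "v = m *\<^sub>R w - l *\<^sub>R z" "0 \<le> m" "0 \<le> l" "w \<in> V" "m - l \<le> t"
      using v unfolding C_def by blast
    have "r *\<^sub>R v = (r * m) *\<^sub>R w - (r * l) *\<^sub>R z"
      unfolding 1(1) by (simp add: scaleR_right_diff_distrib)
    then show ?thesis using 1(2-4) r mult_left_mono[OF 1(5) r]
      by (intro CI[of _ "r * m" w "r * l"]) (auto simp: right_diff_distrib)
  qed
  have C3: "\<exists>t. (v, t) \<in> C" for v
  proof -
    obtain r where "0 < r" "(1/r) *\<^sub>R v \<in> V" using absorbing_nhd V by blast
    then show ?thesis by (intro exI[of _ r] CI[of _ r "(1/r) *\<^sub>R v" 0]) auto
  qed
  have C4: "0 \<le> t" if t: "(0, t) \<in> C" for t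
  proof (rule ccontr)
    assume n: "\<not> 0 \<le> t"
    obtain m l w where 1: "0 = m *\<^sub>R w - l *\<^sub>R z" "0 \<le> m" "0 \<le> l" "w \<in> V" "m - l \<le> t"
      using t unfolding C_def by blast
    then have l: "m < l" "0 < l" using n by linarith+
    have "l *\<^sub>R z = m *\<^sub>R w" using 1(1) by simp
    then have "(1/l) *\<^sub>R (l *\<^sub>R z) = (1/l) *\<^sub>R (m *\<^sub>R w)" by simp
    then have "z = (1 - (m/l)) *\<^sub>R 0 + (m/l) *\<^sub>R w" using l by simp
    then show False using Vc[OF V(2) 1(4), of "m/l"] l 1(2) V(3) by simp
  qed
  obtain \<phi> where \<phi>: "\<And>u v. u \<in> UNIV \<Longrightarrow> v \<in> UNIV \<Longrightarrow> \<phi> (u + v) = \<phi> u + \<phi> v"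
    "\<And>r v. v \<in> UNIV \<Longrightarrow> \<phi> (r *\<^sub>R v) = r * \<phi> v" "\<And>v t. v \<in> UNIV \<Longrightarrow> (v, t) \<in> C \<Longrightarrow> \<phi> v \<le> (t::real)"
    by (rule hahn_banach_cone[OF sub, of C]) (use C1 C2 C3 C4 in blast)+
  have lin: "linear \<phi>" using \<phi> by (auto intro: linearI)
  have "\<phi> (- z) \<le> - 1" by (rule \<phi>(3)[OF _ CI[of _ 0 0 1]]) (use V in auto)
  moreover have "\<phi> (- z) = - \<phi> z" "\<phi> z = \<phi> y - \<phi> x"
    unfolding z_def using lin by (rule linear_neg, intro linear_diff lin)
  ultimately have "\<phi> x \<noteq> \<phi> y" by linarith
  moreover have b: "\<bar>\<phi> w\<bar> \<le> 1" if "w \<in> V" for w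
  proof -
    have "\<phi> w \<le> 1" if "w \<in> V" for w by (rule \<phi>(3)[OF _ CI[of _ 1 w 0]]) (use that in auto)
    from this[OF that] this[OF Vm[OF that]] show ?thesis using linear_neg[OF lin] by auto
  qed
  have "continuous_on UNIV \<phi>" unfolding continuous_on_def
  proof
    fix a
    show "(\<phi> \<longlongrightarrow> \<phi> a) (at a within UNIV)"
    proof (rule tendstoI)
      fix e :: real assume e: "0 < e"
      define O' where "O' = (\<lambda>b. (2/e) *\<^sub>R (b - a)) -` V"
      have "open O'" unfolding O'_def
        by (intro open_vimage V(1) tvs_continuous_on_scaleR continuous_intros)
      moreover have "a \<in> O'" using V by (simp add: O'_def)
      moreover have "dist (\<phi> b) (\<phi> a) < e" if "b \<in> O'" for b
      proof -
        define k where "k = 2 / e"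
        have k: "0 < k" using e by (simp add: k_def)
        have "\<bar>\<phi> (k *\<^sub>R (b - a))\<bar> \<le> 1" using that b by (simp add: O'_def k_def)
        moreover have "\<phi> (k *\<^sub>R (b - a)) = k * (\<phi> b - \<phi> a)"
          using \<phi>(2)[of "b - a" k] linear_diff[OF lin, of b a] by simp
        ultimately have "k * \<bar>\<phi> b - \<phi> a\<bar> \<le> 1" using k by (simp add: abs_mult)
        then show ?thesis using e by (simp add: dist_real_def k_def field_simps)
      qed
      ultimately show "\<forall>\<^sub>F b in at a within UNIV. dist (\<phi> b) (\<phi> a) < e"
        unfolding eventually_at_topological by blast
    qed
  qed
  ultimately show thesis using that lin by blast
qed

lemma sum_fun_apply: "(\<Sum>i\<in>I. f i) x = (\<Sum>i\<in>I. f i x)"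
  by (induction I rule: infinite_finite_induct) auto

definition linear_functional_on :: "('a \<Rightarrow> real) set \<Rightarrow> (('a \<Rightarrow> real) \<Rightarrow> real) \<Rightarrow> bool" where
  "linear_functional_on E s \<longleftrightarrow>
    (\<forall>u\<in>E. \<forall>v\<in>E. s (u + v) = s u + s v) \<and> (\<forall>r. \<forall>u\<in>E. s (r *\<^sub>R u) = r * s u)"

lemma linear_functional_sum:
  assumes s: "linear_functional_on E s" and E: "subspace E" and I: "finite I" "\<And>i. i \<in> I \<Longrightarrow> f i \<in> E"
  shows "s (\<Sum>i\<in>I. c i *\<^sub>R f i) = (\<Sum>i\<in>I. c i * s (f i))"
  using I
proof (induction I rule: finite_induct)
  case empty
  have "s (0 *\<^sub>R 0) = 0 * s 0" using s E subspace_0 unfolding linear_functional_on_def by blast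
  then show ?case by (simp add: zero_fun_def)
next
  case (insert i I)
  have "s (c i *\<^sub>R f i + (\<Sum>i\<in>I. c i *\<^sub>R f i)) = s (c i *\<^sub>R f i) + s (\<Sum>i\<in>I. c i *\<^sub>R f i)"
    using s insert.prems E unfolding linear_functional_on_def
    by (simp add: subspace_scale subspace_sum)
  moreover have "s (c i *\<^sub>R f i) = c i * s (f i)"
    using s insert.prems unfolding linear_functional_on_def by simp
  moreover have "s (\<Sum>i\<in>I. c i *\<^sub>R f i) = (\<Sum>i\<in>I. c i * s (f i))" using insert by blast
  ultimately show ?case unfolding sum.insert[OF insert.hyps(1,2)] by linarith
qed

section \<open>Continuous affine functions, evaluations and extreme points\<close>

locale compact_convex =
  fixes X :: "'a::locally_convex_space set"
  assumes compact: "compact X" and convex: "convex X" and nonempty: "X \<noteq> {}"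
begin

lemma mix: "x \<in> X \<Longrightarrow> y \<in> X \<Longrightarrow> 0 \<le> t \<Longrightarrow> t \<le> 1 \<Longrightarrow> (1 - t) *\<^sub>R x + t *\<^sub>R y \<in> X"
  using convex by (simp add: convex_alt)

lemma affine_restrict:
  assumes "\<And>x y t. x \<in> X \<Longrightarrow> y \<in> X \<Longrightarrow> t \<in> {0..1} \<Longrightarrow> f ((1 - t) *\<^sub>R x + t *\<^sub>R y) = (1 - t) * f x + t * f y"
  shows "(\<lambda>x. if x \<in> X then f x else 0) \<in> affine_functions X"
  using assms mix by (auto simp: affine_functions_def functions_on_def)

lemma Ac_iff: "f \<in> A\<^sub>c X \<longleftrightarrow> (\<forall>x. x \<notin> X \<longrightarrow> f x = 0) \<and> continuous_on X f \<and>
    (\<forall>x\<in>X. \<forall>y\<in>X. \<forall>t\<in>{0..1}. f ((1 - t) *\<^sub>R x + t *\<^sub>R y) = (1 - t) * f x + t * f y)"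
  by (auto simp: A\<^sub>c_def affine_functions_def functions_on_def)

lemma Ac_continuous: "f \<in> A\<^sub>c X \<Longrightarrow> continuous_on X f"
  by (simp add: Ac_iff)

lemma Ac_mix: "f \<in> A\<^sub>c X \<Longrightarrow> x \<in> X \<Longrightarrow> y \<in> X \<Longrightarrow> 0 \<le> t \<Longrightarrow> t \<le> 1 \<Longrightarrow>
    f ((1 - t) *\<^sub>R x + t *\<^sub>R y) = (1 - t) * f x + t * f y"
  by (auto simp: Ac_iff)

lemma Ac_one: "indicat_real X \<in> A\<^sub>c X"
proof -
  have "continuous_on X (indicat_real X)"
    by (rule continuous_on_eq[OF continuous_on_const[of X 1]]) auto
  then show ?thesis using mix by (auto simp: Ac_iff)
qed

lemma Ac_lincomb: "f \<in> A\<^sub>c X \<Longrightarrow> g \<in> A\<^sub>c X \<Longrightarrow> (\<lambda>x. c * f x + d * g x) \<in> A\<^sub>c X"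
  unfolding Ac_iff by (auto intro!: continuous_intros simp: ring_distribs mult.left_commute)

lemma subspace_Ac: "subspace (A\<^sub>c X)"
proof (rule subspaceI)
  show "0 \<in> A\<^sub>c X" using Ac_lincomb[OF Ac_one Ac_one, of 0 0] by (simp add: zero_fun_def)
  show "f + g \<in> A\<^sub>c X" if "f \<in> A\<^sub>c X" "g \<in> A\<^sub>c X" for f g
    using Ac_lincomb[OF that, of 1 1] by (simp add: plus_fun_def)
  show "c *\<^sub>R f \<in> A\<^sub>c X" if "f \<in> A\<^sub>c X" for c f
    using Ac_lincomb[OF that that, of c 0] by (simp add: scaleR_fun_def)
qed

lemma Ac_bound: "f \<in> A\<^sub>c X \<Longrightarrow> \<exists>C>0. \<forall>x\<in>X. \<bar>f x\<bar> \<le> C"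
  using continuous_bound[OF compact Ac_continuous] by metis

text \<open>Local convexity enters here. From now on a point of \<open>X\<close> is identified by
  its values under \<open>A\<^sub>c X\<close>, which turns identities between barycenters into
  identities between integrals.\<close>

lemma Ac_separates:
  assumes "x \<in> X" "y \<in> X" "\<And>a. a \<in> A\<^sub>c X \<Longrightarrow> a x = a y"
  shows "x = y"
proof (rule ccontr)
  assume "x \<noteq> y"
  then obtain \<phi> :: "'a \<Rightarrow> real" where \<phi>: "linear \<phi>" "continuous_on UNIV \<phi>" "\<phi> x \<noteq> \<phi> y"
    by (rule separating_functional)
  define a where "a = (\<lambda>x. if x \<in> X then \<phi> x else 0)"
  have "a \<in> affine_functions X" unfolding a_def
    by (rule affine_restrict) (simp add: linear_add[OF \<phi>(1)] linear_cmul[OF \<phi>(1)])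
  moreover have "continuous_on X a"
    by (rule continuous_on_eq[OF continuous_on_subset[OF \<phi>(2)]]) (auto simp: a_def)
  ultimately have "a \<in> A\<^sub>c X" by (simp add: A\<^sub>c_def)
  then show False using assms(3)[of a] assms(1,2) \<phi>(3) by (simp add: a_def)
qed

text \<open>A point of \<open>Q\<close> minimizing \<open>\<Sum>(a - s a)\<^sup>2\<close> solves finitely many of the equations \<open>a = s a\<close>;
  compactness gives them all.\<close>

lemma functional_is_evaluation:
  assumes Q: "compact Q" "convex Q" "Q \<noteq> {}" "Q \<subseteq> X"
    and E: "subspace E" "E \<subseteq> A\<^sub>c X" and s: "linear_functional_on E s"
    and le: "\<And>a c. a \<in> E \<Longrightarrow> (\<And>x. x \<in> Q \<Longrightarrow> a x \<le> c) \<Longrightarrow> s a \<le> c"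
  obtains q where "q \<in> Q" "\<And>a. a \<in> E \<Longrightarrow> s a = a q"
proof -
  have fin: "\<exists>q\<in>Q. \<forall>a\<in>F. a q = s a" if F: "finite F" "F \<subseteq> E" for F
  proof -
    have Ec: "continuous_on Q a" if "a \<in> E" for a
      using that E Q Ac_continuous continuous_on_subset by blast
    define g where "g y = (\<Sum>a\<in>F. (a y - s a)^2)" for y
    have "continuous_on Q g" unfolding g_def
      by (intro continuous_intros Ec) (use F in auto)
    then obtain p where p: "p \<in> Q" "\<And>y. y \<in> Q \<Longrightarrow> g p \<le> g y"
      using continuous_attains_inf[OF Q(1,3)] by blast
    define \<alpha> where "\<alpha> a = a p - s a" for a
    \<comment> \<open>First-order condition for the minimum of the convex quadratic \<open>g\<close>
      on \<open>Q\<close>: the sum is half the derivative of \<open>g\<close> at \<open>p\<close> in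
      the direction of \<open>y\<close>.\<close>
    have *: "0 \<le> (\<Sum>a\<in>F. \<alpha> a * (a y - a p))" (is "0 \<le> ?P") if y: "y \<in> Q" for y
    proof (rule ccontr)
      assume P: "\<not> 0 \<le> ?P"
      define R where "R = (\<Sum>a\<in>F. (a y - a p)^2)"
      have R: "0 \<le> R" unfolding R_def by (simp add: sum_nonneg)
      \<comment> \<open>Small enough for \<open>t * R\<close> not to exceed \<open>- ?P\<close>; the
        \<open>+ 1\<close> avoids division by zero.\<close>
      define t where "t = min 1 (- ?P / (R + 1))"
      have "0 < - ?P / (R + 1)" by (rule divide_pos_pos) (use P R in linarith)+
      then have t: "0 < t" "t \<le> 1" by (auto simp: t_def)
      have my: "(1 - t) *\<^sub>R p + t *\<^sub>R y \<in> Q" using Q(2) p(1) y t by (simp add: convex_alt)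
      have eq: "a ((1 - t) *\<^sub>R p + t *\<^sub>R y) = (1 - t) * a p + t * a y" if "a \<in> F" for a
        using that F E Q p y t by (intro Ac_mix) auto
      have "g ((1 - t) *\<^sub>R p + t *\<^sub>R y) = (\<Sum>a\<in>F. (\<alpha> a)^2 + 2 * t * (\<alpha> a * (a y - a p)) + t^2 * (a y - a p)^2)"
        unfolding g_def
      proof (intro sum.cong refl)
        fix a assume "a \<in> F"
        show "(a ((1 - t) *\<^sub>R p + t *\<^sub>R y) - s a)^2 = (\<alpha> a)^2 + 2 * t * (\<alpha> a * (a y - a p)) + t^2 * (a y - a p)^2"
          unfolding eq[OF \<open>a \<in> F\<close>] by (simp add: \<alpha>_def power2_eq_square algebra_simps)
      qed
      also have "\<dots> = g p + 2 * t * ?P + t^2 * R"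
        by (simp add: g_def R_def \<alpha>_def sum.distrib sum_distrib_left)
      finally have "0 \<le> t * (2 * ?P + t * R)"
        using p(2)[OF my] by (simp add: power2_eq_square algebra_simps)
      then have "0 \<le> 2 * ?P + t * R" using t by (simp add: zero_le_mult_iff)
      moreover have "t * R \<le> - ?P"
      proof -
        have "t * R \<le> t * (R + 1)" using t by (simp add: algebra_simps)
        also have "\<dots> \<le> (- ?P / (R + 1)) * (R + 1)" using R by (intro mult_right_mono) (auto simp: t_def)
        finally show ?thesis using R by simp
      qed
      ultimately show False using P by linarith
    qed
    \<comment> \<open>By \<open>*\<close> the function \<open>h\<close> attains its maximum over
      \<open>Q\<close> at \<open>p\<close>. Testing \<open>le\<close> on \<open>h\<close> bounds the
      sum of the squares of the \<open>\<alpha> a\<close> by 0.\<close>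
    define h where "h = (\<Sum>a\<in>F. (- \<alpha> a) *\<^sub>R a)"
    have hE: "h \<in> E" unfolding h_def using F E(1) by (intro subspace_sum subspace_scale) auto
    have hx: "h x = - (\<Sum>a\<in>F. \<alpha> a * a x)" for x
      by (simp add: h_def sum_fun_apply scaleR_fun_def sum_negf)
    have "h y \<le> h p" if "y \<in> Q" for y
      using *[OF that] by (simp add: hx right_diff_distrib sum_subtractf)
    then have "s h \<le> h p" using le hE by blast
    moreover have "s h = - (\<Sum>a\<in>F. \<alpha> a * s a)"
      unfolding h_def using linear_functional_sum[OF s E(1) F(1), of "\<lambda>a. a" "\<lambda>a. - \<alpha> a"] F
      by (auto simp: sum_negf)
    ultimately have "(\<Sum>a\<in>F. \<alpha> a * a p) \<le> (\<Sum>a\<in>F. \<alpha> a * s a)" by (simp add: hx)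
    moreover have "(\<Sum>a\<in>F. (\<alpha> a)^2) = (\<Sum>a\<in>F. \<alpha> a * a p) - (\<Sum>a\<in>F. \<alpha> a * s a)"
      unfolding sum_subtractf[symmetric]
      by (intro sum.cong refl) (simp add: \<alpha>_def power2_eq_square right_diff_distrib)
    ultimately have "(\<Sum>a\<in>F. (\<alpha> a)^2) \<le> 0" by linarith
    then have "(\<Sum>a\<in>F. (\<alpha> a)^2) = 0" by (intro antisym sum_nonneg) auto
    then have "\<forall>a\<in>F. \<alpha> a = 0" using F(1) by (simp add: sum_nonneg_eq_0_iff)
    then show ?thesis using p(1) by (auto simp: \<alpha>_def)
  qed
  have "Q \<inter> (\<Inter>a\<in>E. {q\<in>Q. a q = s a}) \<noteq> {}"
  proof (rule compact_imp_fip_image[OF Q(1)])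
    fix a assume "a \<in> E"
    then have c: "continuous_on Q a" using E Q Ac_continuous continuous_on_subset by blast
    have "closedin (top_of_set Q) (Q \<inter> a -` {s a})" using c by (rule continuous_closedin_preimage) simp
    then have "closed (Q \<inter> a -` {s a})" using Q(1) compact_imp_closed closedin_closed_trans by blast
    then show "closed {q\<in>Q. a q = s a}" by (simp add: vimage_def Int_def)
  next
    fix F assume "finite F" "F \<subseteq> E"
    then obtain q where "q \<in> Q" "\<forall>a\<in>F. a q = s a" using fin by metis
    then have "q \<in> Q \<inter> (\<Inter>a\<in>F. {q\<in>Q. a q = s a})" by simp
    then show "Q \<inter> (\<Inter>a\<in>F. {q\<in>Q. a q = s a}) \<noteq> {}" by (rule ex_in_conv[THEN iffD1, OF exI])
  qed
  then have "\<exists>q. q \<in> Q \<inter> (\<Inter>a\<in>E. {q\<in>Q. a q = s a})" by (rule ex_in_conv[THEN iffD2])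
  then obtain q where q: "q \<in> Q \<inter> (\<Inter>a\<in>E. {q\<in>Q. a q = s a})" by (rule exE)
  have *: "s a = a q" if "a \<in> E" for a
    using INT_D[OF IntD2[OF q] that] unfolding mem_Collect_eq by (elim conjE) (rule sym)
  have "q \<in> Q" using q by (rule IntD1)
  then show thesis by (rule that) (rule *)
qed

lemma ext_not_mix:
  assumes "x \<in> extreme_points X" "p \<in> X" "q \<in> X" "0 < t" "t < 1" "x = (1 - t) *\<^sub>R p + t *\<^sub>R q"
  shows "p = x" "q = x"
proof -
  have "x \<notin> open_segment p q" using assms by (auto simp: extreme_points_def extreme_point_of_def)
  then have pq: "p = q" using assms unfolding in_segment by blast
  then show "p = x" "q = x" using assms(6) by (simp_all flip: scaleR_left_distrib)
qed

lemma ext_in: "x \<in> extreme_points X \<Longrightarrow> x \<in> X"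
  by (simp add: extreme_points_def extreme_point_of_def)

lemma positive_functional_mono:
  assumes E: "subspace E" "indicat_real X \<in> E" and s: "linear_functional_on E s"
    and pos: "\<And>a. a \<in> E \<Longrightarrow> (\<And>y. y \<in> X \<Longrightarrow> 0 \<le> a y) \<Longrightarrow> 0 \<le> s a"
    and a: "a \<in> E" "\<And>y. y \<in> X \<Longrightarrow> a y \<le> c"
  shows "s a \<le> c * s (indicat_real X)"
proof -
  have "c *\<^sub>R indicat_real X \<in> E" "(-1) *\<^sub>R a \<in> E" using E a subspace_scale by blast+
  moreover have "c *\<^sub>R indicat_real X + (-1) *\<^sub>R a \<in> E" using E(1) calculation by (rule subspace_add)
  ultimately have "0 \<le> s (c *\<^sub>R indicat_real X + (-1) *\<^sub>R a)"
    using a(2) by (intro pos) (auto simp: scaleR_fun_def)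
  also have "\<dots> = c * s (indicat_real X) + (-1) * s a"
    using s E a subspace_scale unfolding linear_functional_on_def by (metis \<open>(-1) *\<^sub>R a \<in> E\<close> \<open>c *\<^sub>R indicat_real X \<in> E\<close>)
  finally show ?thesis by simp
qed

text \<open>Normalized, \<open>s\<close> and the remainder \<open>M * a x - s a\<close> are positive
  functionals with value 1 at the constant, hence evaluations at points \<open>p\<close> and
  \<open>q\<close> of \<open>X\<close>. Then \<open>x\<close> is a mixture of \<open>p\<close> and
  \<open>q\<close> with weight \<open>k / M\<close> at \<open>p\<close>, so extremality gives
  \<open>p = x\<close>. If \<open>k = 0\<close>, positivity kills \<open>s\<close>.\<close>

lemma dominated_by_extreme_point:
  assumes x: "x \<in> extreme_points X" and s: "linear_functional_on (A\<^sub>c X) s"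
    and pos: "\<And>a. a \<in> A\<^sub>c X \<Longrightarrow> (\<And>y. y \<in> X \<Longrightarrow> 0 \<le> a y) \<Longrightarrow> 0 \<le> s a \<and> s a \<le> L * a x"
    and a: "a \<in> A\<^sub>c X"
  shows "s a = s (indicat_real X) * a x"
proof -
  have xX: "x \<in> X" using x by (rule ext_in)
  define k where "k = s (indicat_real X)"
  have k: "0 \<le> k" "k \<le> L" using pos[OF Ac_one] xX by (auto simp: k_def)
  have up: "s a \<le> c * k" if "a \<in> A\<^sub>c X" "\<And>y. y \<in> X \<Longrightarrow> a y \<le> c" for a c
    unfolding k_def by (rule positive_functional_mono[OF subspace_Ac Ac_one s _ that]) (use pos in blast)
  have mem: "(-1) *\<^sub>R a \<in> A\<^sub>c X" if "a \<in> A\<^sub>c X" for a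
    using subspace_Ac that by (rule subspace_scale)
  have sm: "s ((-1) *\<^sub>R a) = - s a" if "a \<in> A\<^sub>c X" for a
  proof -
    have "s ((-1) *\<^sub>R a) = (-1) * s a" using that s unfolding linear_functional_on_def by blast
    then show ?thesis by simp
  qed
  show ?thesis
  proof (cases "k = 0")
    case True
    obtain C where C: "\<And>y. y \<in> X \<Longrightarrow> \<bar>a y\<bar> \<le> C" using Ac_bound[OF a] by blast
    have "s a \<le> C * k" using up[OF a, of C] C by (simp add: abs_le_iff)
    moreover have "s ((-1) *\<^sub>R a) \<le> C * k"
      using up[OF mem[OF a], of C] C by (simp add: scaleR_fun_def abs_le_iff)
    ultimately show ?thesis using sm[OF a] True by (simp add: k_def)
  next
    case False
    then have k0: "0 < k" using k by simp
    \<comment> \<open>Taking \<open>L + 1\<close> instead of \<open>L\<close> guarantees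
      \<open>k < M\<close>, so the remainder has positive mass \<open>M - k\<close> to divide
      by.\<close>
    define M where "M = L + 1"
    have M: "k < M" using k by (simp add: M_def)
    have "linear_functional_on (A\<^sub>c X) (\<lambda>a. s a / k)"
      using s unfolding linear_functional_on_def by (simp add: add_divide_distrib)
    then obtain p where p: "p \<in> X" "\<And>a. a \<in> A\<^sub>c X \<Longrightarrow> s a / k = a p"
    proof (rule functional_is_evaluation[OF compact convex nonempty order_refl subspace_Ac order_refl])
      show "s a / k \<le> c" if "a \<in> A\<^sub>c X" "\<And>x. x \<in> X \<Longrightarrow> a x \<le> c" for a c
        using up[OF that] k0 by (simp add: field_simps)
    qed blast
    have "linear_functional_on (A\<^sub>c X) (\<lambda>a. (M * a x - s a) / (M - k))"
      using s unfolding linear_functional_on_def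
      by (simp add: scaleR_fun_def add_divide_distrib diff_divide_distrib algebra_simps)
    then obtain q where q: "q \<in> X" "\<And>a. a \<in> A\<^sub>c X \<Longrightarrow> (M * a x - s a) / (M - k) = a q"
    proof (rule functional_is_evaluation[OF compact convex nonempty order_refl subspace_Ac order_refl])
      fix a c assume a: "a \<in> A\<^sub>c X" and le: "\<And>x. x \<in> X \<Longrightarrow> a x \<le> c"
      define b where "b = (\<lambda>y. c * indicat_real X y + (-1) * a y)"
      have b: "b \<in> A\<^sub>c X" unfolding b_def using Ac_one a by (rule Ac_lincomb)
      have b0: "0 \<le> b y" if "y \<in> X" for y using le[OF that] that by (simp add: b_def)
      have "b = c *\<^sub>R indicat_real X + (-1) *\<^sub>R a" by (simp add: b_def fun_eq_iff scaleR_fun_def)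
      moreover have "s (c *\<^sub>R indicat_real X) = c * k"
        using s Ac_one unfolding linear_functional_on_def k_def by blast
      moreover have "s (c *\<^sub>R indicat_real X + (-1) *\<^sub>R a) = s (c *\<^sub>R indicat_real X) + s ((-1) *\<^sub>R a)"
        using s mem[OF a] subspace_scale[OF subspace_Ac Ac_one, of c] unfolding linear_functional_on_def by blast
      moreover have "s b = s (c *\<^sub>R indicat_real X + (-1) *\<^sub>R a)"
        by (rule arg_cong[of _ _ s]) fact
      ultimately have sb: "s b = c * k - s a" using sm[OF a] by linarith
      have "s b \<le> L * b x" using pos[OF b] b0 by blast
      also have "\<dots> \<le> M * b x" using b0[OF xX] by (simp add: M_def algebra_simps)
      finally show "(M * a x - s a) / (M - k) \<le> c"
        using sb xX M by (simp add: b_def field_simps)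
    qed blast
    define t where "t = 1 - k / M"
    have t: "0 < t" "t < 1" using M k0 by (auto simp: t_def)
    have "x = (1 - t) *\<^sub>R p + t *\<^sub>R q"
    proof (rule Ac_separates[OF xX mix[OF p(1) q(1)]])
      fix a assume a: "a \<in> A\<^sub>c X"
      have "a ((1 - t) *\<^sub>R p + t *\<^sub>R q) = (1 - t) * (s a / k) + t * ((M * a x - s a) / (M - k))"
        using Ac_mix[OF a p(1) q(1), of t] t p(2)[OF a] q(2)[OF a] by simp
      also have "(1 - t) * (s a / k) = s a / M" using k0 by (simp add: t_def)
      also have "t * ((M * a x - s a) / (M - k)) = (M * a x - s a) / M"
      proof -
        have "t = (M - k) / M" using M k0 by (simp add: t_def diff_divide_distrib)
        then show ?thesis using M by simp
      qed
      finally show "a x = a ((1 - t) *\<^sub>R p + t *\<^sub>R q)" using M k0 by (simp add: diff_divide_distrib)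
    qed (use t in auto)
    then have "p = x" using ext_not_mix(1)[OF x p(1) q(1) t] by blast
    then show ?thesis using p(2)[OF a] k0 by (simp add: k_def field_simps)
  qed
qed

text \<open>Krein--Milman through minimal closed faces: the points of a closed face at which a
  continuous affine function is maximal form again a closed face, so on a minimal face every such
  function is constant, and \<open>A\<^sub>c X\<close> separates points.\<close>

lemma closed_face_has_extreme_point:
  assumes Q: "compact Q" "Q \<noteq> {}" "Q \<subseteq> X"
    and face: "\<And>p q t. p \<in> X \<Longrightarrow> q \<in> X \<Longrightarrow> 0 < t \<Longrightarrow> t < 1 \<Longrightarrow> (1 - t) *\<^sub>R p + t *\<^sub>R q \<in> Q \<Longrightarrow> p \<in> Q \<and> q \<in> Q"
  obtains e where "e \<in> extreme_points X" "e \<in> Q"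
proof -
  define face where "face F \<longleftrightarrow> compact F \<and> F \<noteq> {} \<and> F \<subseteq> Q \<and>
    (\<forall>p\<in>X. \<forall>q\<in>X. \<forall>t. 0 < t \<longrightarrow> t < 1 \<longrightarrow> (1 - t) *\<^sub>R p + t *\<^sub>R q \<in> F \<longrightarrow> p \<in> F \<and> q \<in> F)" for F
  have fQ: "face Q" using Q face unfolding face_def by blast
  \<comment> \<open>Complements turn the search for a minimal face into the maximality statement of
    Zorn; compactness keeps the intersection of a chain nonempty.\<close>
  have "\<exists>M\<in>{- F | F. face F}. \<forall>Y\<in>{- F | F. face F}. M \<subseteq> Y \<longrightarrow> Y = M"
  proof (rule subset_Zorn_nonempty)
    show "{- F | F. face F} \<noteq> {}" using fQ by blast
  next
    fix \<C> assume ne: "\<C> \<noteq> {}" and ch: "subset.chain {- F | F. face F} \<C>"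
    define \<F> where "\<F> = uminus ` \<C>"
    have f: "face F" if "F \<in> \<F>" for F using ch that unfolding \<F>_def subset_chain_def by auto
    have tot: "F \<subseteq> G \<or> G \<subseteq> F" if "F \<in> \<F>" "G \<in> \<F>" for F G
      using ch that unfolding \<F>_def subset_chain_def by (metis (no_types, lifting) Compl_subset_Compl_iff imageE)
    have ne': "\<F> \<noteq> {}" using ne by (simp add: \<F>_def)
    have least: "\<exists>G\<in>\<G>. \<forall>F\<in>\<G>. G \<subseteq> F" if "finite \<G>" "\<G> \<noteq> {}" "\<G> \<subseteq> \<F>" for \<G>
      using finite_has_minimal[OF that(1,2)] tot that(3) by (metis subset_iff)
    obtain F0 where F0: "F0 \<in> \<F>" using ne' by blast
    have "F0 \<inter> \<Inter>\<F> \<noteq> {}"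
    proof (rule compact_imp_fip)
      show "compact F0" using f[OF F0] by (simp add: face_def)
      show "closed F" if "F \<in> \<F>" for F using f[OF that] by (simp add: face_def compact_imp_closed)
      fix \<G> assume "finite \<G>" "\<G> \<subseteq> \<F>"
      then obtain G where G: "G \<in> insert F0 \<G>" "\<forall>F\<in>insert F0 \<G>. G \<subseteq> F"
        using least[of "insert F0 \<G>"] F0 by auto
      then have "G \<noteq> {}" using f F0 \<open>\<G> \<subseteq> \<F>\<close> by (auto simp: face_def)
      then show "F0 \<inter> \<Inter>\<G> \<noteq> {}" using G by blast
    qed
    moreover have "compact (\<Inter>\<F>)"
    proof -
      have "closed (\<Inter>\<F>)" using f by (intro closed_Inter) (auto simp: face_def compact_imp_closed)
      then have "compact (F0 \<inter> \<Inter>\<F>)" using f[OF F0] by (intro compact_Int_closed) (auto simp: face_def)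
      moreover have "F0 \<inter> \<Inter>\<F> = \<Inter>\<F>" using F0 by blast
      ultimately show ?thesis by simp
    qed
    moreover have "\<Inter>\<F> \<subseteq> Q" using f[OF F0] F0 unfolding face_def by blast
    moreover have "p \<in> F \<and> q \<in> F" if "F \<in> \<F>" "p \<in> X" "q \<in> X" "0 < t" "t < 1"
      "(1 - t) *\<^sub>R p + t *\<^sub>R q \<in> \<Inter>\<F>" for F p q t
      using f[OF that(1)] that unfolding face_def by blast
    ultimately have "face (\<Inter>\<F>)" unfolding face_def by blast
    moreover have "\<Union>\<C> = - \<Inter>\<F>" by (auto simp: \<F>_def)
    ultimately show "\<Union>\<C> \<in> {- F | F. face F}" by blast
  qed
  then obtain M where M: "M \<in> {- F | F. face F}" "\<forall>Y\<in>{- F | F. face F}. M \<subseteq> Y \<longrightarrow> Y = M" by (rule bexE)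
  then obtain F where F: "face F" and MF: "M = - F" by blast
  have min: "G = F" if "face G" "G \<subseteq> F" for G
  proof -
    have "- G \<in> {- F | F. face F}" "M \<subseteq> - G" using that MF by blast+
    then have "- G = M" using M(2) by blast
    then show ?thesis using MF by simp
  qed
  have FX: "F \<subseteq> X" using F Q unfolding face_def by blast
  have const: "a x = a y" if a: "a \<in> A\<^sub>c X" and xy: "x \<in> F" "y \<in> F" for a x y
  proof -
    have ac: "continuous_on F a" using Ac_continuous[OF a] FX continuous_on_subset by blast
    obtain m where m: "m \<in> F" "\<And>y. y \<in> F \<Longrightarrow> a y \<le> a m"
      using continuous_attains_sup[OF _ _ ac] F unfolding face_def by blast
    define G where "G = {y\<in>F. a y = a m}"
    have "closedin (top_of_set F) (F \<inter> a -` {a m})" using ac by (rule continuous_closedin_preimage) simp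
    then have "compact G" using F closedin_compact[of F] by (simp add: face_def G_def vimage_def Int_def)
    moreover have "p \<in> G \<and> q \<in> G" if "p \<in> X" "q \<in> X" "0 < t" "t < 1" and G: "(1 - t) *\<^sub>R p + t *\<^sub>R q \<in> G" for p q t
    proof -
      have pq: "p \<in> F" "q \<in> F" using F that unfolding face_def G_def by blast+
      have "(1 - t) * a p + t * a q = a m"
        using Ac_mix[OF a that(1,2), of t] that by (simp add: G_def)
      then have "(1 - t) * (a m - a p) + t * (a m - a q) = 0" by (simp add: algebra_simps)
      moreover have "0 \<le> (1 - t) * (a m - a p)" "0 \<le> t * (a m - a q)" using m(2) pq that by auto
      ultimately have "(1 - t) * (a m - a p) = 0" "t * (a m - a q) = 0" by linarith+
      then show ?thesis using pq that by (simp add: G_def)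
    qed
    ultimately have "face G" using F m unfolding face_def by (auto simp: G_def)
    then have "G = F" by (rule min) (auto simp: G_def)
    then have "x \<in> G" "y \<in> G" using xy by simp_all
    then show ?thesis by (simp add: G_def)
  qed
  obtain e where e: "e \<in> F" using F by (auto simp: face_def)
  have single: "y = e" if "y \<in> F" for y using Ac_separates const e that FX by blast
  have "e \<in> extreme_points X" unfolding extreme_points_def extreme_point_of_def
  proof (intro CollectI conjI ballI)
    show "e \<in> X" using e FX by blast
    fix p q assume pq: "p \<in> X" "q \<in> X"
    show "e \<notin> open_segment p q"
    proof
      assume "e \<in> open_segment p q"
      then obtain t where t: "p \<noteq> q" "0 < t" "t < 1" "e = (1 - t) *\<^sub>R p + t *\<^sub>R q" unfolding in_segment by blast
      then have "p \<in> F" "q \<in> F" using F e pq unfolding face_def by blast+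
      then show False using single t by metis
    qed
  qed
  then show thesis using that e F unfolding face_def by blast
qed

end

section \<open>Countable determination, and a Choquet theorem modulo countably many
  functions\<close>

lemma sigma_closure_mono: "f \<in> sigma_closure F \<Longrightarrow> F \<subseteq> G \<Longrightarrow> f \<in> sigma_closure G"
proof (induction rule: sigma_closure.induct)
  case (base f) then show ?case by (auto intro: sigma_closure.base)
next
  case (limit g f)
  show ?case by (rule sigma_closure.limit[of g]) (use limit in blast)+
qed

text \<open>This replaces metrizability: only the behaviour of \<open>f\<close> modulo countably
  many continuous affine functions matters, and the quotient of \<open>X\<close> by these is
  metrizable.\<close>

lemma sigma_closure_countable:
  "f \<in> sigma_closure F \<Longrightarrow> \<exists>D. countable D \<and> D \<subseteq> F \<and> f \<in> sigma_closure D"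
proof (induction rule: sigma_closure.induct)
  case (base f)
  then show ?case by (intro exI[of _ "{f}"]) (auto intro: sigma_closure.base)
next
  case (limit g f)
  then obtain D where D: "\<And>n. countable (D n) \<and> D n \<subseteq> F \<and> g n \<in> sigma_closure (D n)" by metis
  have "f \<in> sigma_closure (\<Union>n. D n)"
    by (rule sigma_closure.limit[of g]) (use limit D sigma_closure_mono in blast)+
  then show ?case using D by (intro exI[of _ "\<Union>n. D n"]) auto
qed

lemma sigma_closure_determined:
  "f \<in> sigma_closure D \<Longrightarrow> (\<And>h. h \<in> D \<Longrightarrow> h y = h z) \<Longrightarrow> f y = f z"
proof (induction rule: sigma_closure.induct)
  case (limit g f)
  have "(\<lambda>n. g n y) = (\<lambda>n. g n z)" using limit.IH[OF limit.prems] by (rule ext)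
  then have "(\<lambda>n. g n z) \<longlonglongrightarrow> f y" using limit.hyps(3)[of y] by (simp only:)
  then show ?case using limit.hyps(3)[of z] by (rule LIMSEQ_unique)
qed

context compact_convex
begin

text \<open>The measure represents \<open>x\<close> on \<open>D\<close> only, which is what
  \<open>countable_choquet\<close> provides; for \<open>D = A\<^sub>c X\<close> this is the
  barycentric formula for the sigma-closure.\<close>

lemma sigma_closure_integral:
  assumes "f \<in> sigma_closure D" and D: "D \<subseteq> A\<^sub>c X" and \<mu>: "radon_prob X \<mu>"
    and x: "\<And>h. h \<in> D \<Longrightarrow> integral\<^sup>L \<mu> h = h x"
  shows "f \<in> borel_measurable \<mu> \<and> (\<exists>C. \<forall>y\<in>X. \<bar>f y\<bar> \<le> C) \<and> integral\<^sup>L \<mu> f = f x"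
  using assms(1)
proof (induction rule: sigma_closure.induct)
  case (base f)
  then have "f \<in> A\<^sub>c X" using D by blast
  then show ?case using Ac_bound radon_measurable[OF \<mu> Ac_continuous] x[OF base] by blast
next
  case (limit g f)
  interpret prob_space \<mu> using \<mu> by (rule radon_prob_space)
  obtain C where C: "\<And>n y. \<bar>g n y\<bar> \<le> C" using limit by blast
  have m: "f \<in> borel_measurable \<mu>"
    by (rule borel_measurable_LIMSEQ_real[of _ g]) (use limit.IH limit.hyps(3) in blast)+
  have "\<bar>f y\<bar> \<le> C" for y
    by (rule LIMSEQ_le_const2[OF tendsto_rabs[OF limit.hyps(3)]]) (use C in blast)
  moreover have "(\<lambda>n. integral\<^sup>L \<mu> (g n)) \<longlonglongrightarrow> integral\<^sup>L \<mu> f"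
    by (rule integral_dominated_convergence[where w = "\<lambda>_. C"]) (use limit.IH limit.hyps(3) m C in simp_all)
  then have "integral\<^sup>L \<mu> f = f x" using limit.IH limit.hyps(3)[of x] LIMSEQ_unique[of "\<lambda>n. g n x"] by simp
  ultimately show ?case using m by blast
qed

lemma weighted_square_sum:
  fixes h :: "nat \<Rightarrow> 'a \<Rightarrow> real"
  assumes h: "\<And>n. h n \<in> A\<^sub>c X"
  obtains c where "\<And>n. 0 < c n" "\<And>y. y \<in> X \<Longrightarrow> summable (\<lambda>n. c n * (h n y)^2)"
    "continuous_on X (\<lambda>y. \<Sum>n. c n * (h n y)^2)"
proof -
  have "\<forall>n. \<exists>C>0. \<forall>y\<in>X. \<bar>h n y\<bar> \<le> C" using Ac_bound[OF h] by blast
  then obtain C where C: "\<And>n. 0 < C n" "\<And>n y. y \<in> X \<Longrightarrow> \<bar>h n y\<bar> \<le> C n" by metis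
  define c where "c n = (1/2)^n / (C n)^2" for n
  have c: "0 < c n" for n using C(1)[of n] by (simp add: c_def)
  have b: "norm (c n * (h n y)^2) \<le> (1/2)^n" if "y \<in> X" for n y
  proof -
    have "(h n y)^2 \<le> (C n)^2" using C(2)[OF that, of n] by (metis abs_ge_zero power2_abs power_mono)
    then have "c n * (h n y)^2 \<le> c n * (C n)^2" using c by (intro mult_left_mono) (auto simp: less_imp_le)
    also have "\<dots> = (1/2)^n" using C(1)[of n] by (simp add: c_def)
    finally show ?thesis using c[of n] by (simp add: abs_mult)
  qed
  have sm: "summable (\<lambda>n. (1/2)^n :: real)" by (rule summable_geometric) simp
  show thesis
  proof (rule that[of c])
    show "summable (\<lambda>n. c n * (h n y)^2)" if "y \<in> X" for y
      by (rule summable_comparison_test'[OF sm, of 0]) (use b that in auto)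
    have "uniform_limit X (\<lambda>n y. \<Sum>i<n. c i * (h i y)^2) (\<lambda>y. \<Sum>n. c n * (h n y)^2) sequentially"
      by (rule Weierstrass_m_test[OF b sm])
    moreover have "continuous_on X (\<lambda>y. \<Sum>i<n. c i * (h i y)^2)" for n
      by (intro continuous_on_sum continuous_on_mult continuous_on_power continuous_on_const Ac_continuous h)
    ultimately show "continuous_on X (\<lambda>y. \<Sum>n. c n * (h n y)^2)"
      by (intro uniform_limit_theorem[rotated]) auto
  qed (rule c)
qed

lemma span_determined:
  assumes "a \<in> span D" "\<And>h. h \<in> D \<Longrightarrow> h y = h z"
  shows "(a :: 'a \<Rightarrow> real) y = a z"
  using assms(1)
proof (induction rule: span_induct_alt)
  case (step c h a) then show ?case using assms(2)[OF step(1)] by (simp add: scaleR_fun_def)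
qed simp

lemma span_Ac: "D \<subseteq> A\<^sub>c X \<Longrightarrow> span D \<subseteq> A\<^sub>c X"
  using span_minimal subspace_Ac by blast

text \<open>A measure maximizing the integral of the strictly convex function \<open>\<Sum>c\<^sub>n h\<^sub>n\<^sup>2\<close> lives on the points whose
  \<open>D\<close>-fibre is a face.\<close>

lemma countable_choquet:
  assumes D: "countable D" "D \<subseteq> A\<^sub>c X" and x: "x \<in> X"
  obtains \<mu> where "radon_prob X \<mu>" "\<And>h. h \<in> D \<Longrightarrow> integral\<^sup>L \<mu> h = h x"
    "AE y in \<mu>. \<exists>e\<in>extreme_points X. \<forall>h\<in>D. h e = h y"
proof -
  \<comment> \<open>The constant function puts constant bounds such as \<open>C\<close> into the
    span \<open>E\<close> and makes the enumerated set nonempty.\<close>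
  define D' where "D' = insert (indicat_real X) D"
  have D': "countable D'" "D' \<subseteq> A\<^sub>c X" "D' \<noteq> {}" using D Ac_one by (auto simp: D'_def)
  define h where "h = from_nat_into D'"
  have hD: "range h = D'" using D' by (simp add: h_def range_from_nat_into)
  have hA: "h n \<in> A\<^sub>c X" for n using hD D'(2) by blast
  obtain c where c: "\<And>n. 0 < c n" "\<And>y. y \<in> X \<Longrightarrow> summable (\<lambda>n. c n * (h n y)^2)"
    "continuous_on X (\<lambda>y. \<Sum>n. c n * (h n y)^2)"
    using weighted_square_sum[of h] hA by blast
  define f where "f y = (\<Sum>n. c n * (h n y)^2)" for y
  have fc: "continuous_on X f" using c(3) unfolding f_def .
  have f0: "0 \<le> f y" if "y \<in> X" for y
    unfolding f_def using c that by (intro suminf_nonneg) (auto simp: less_imp_le)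
  define E where "E = span D'"
  have E: "subspace E" "E \<subseteq> A\<^sub>c X" "indicat_real X \<in> E"
    using span_Ac[OF D'(2)] span_base[of "indicat_real X" D'] by (auto simp: E_def D'_def)
  have Ec: "continuous_on X e" if "e \<in> E" for e using that E Ac_continuous by blast
  have Elc: "(\<lambda>y. p * u y + q * v y) \<in> E" if "u \<in> E" "v \<in> E" for u v p q
  proof -
    have "p *\<^sub>R u + q *\<^sub>R v \<in> E" using that E(1) by (intro subspace_add subspace_scale)
    then show ?thesis by (simp add: plus_fun_def scaleR_fun_def)
  qed
  define U where "U = {e \<in> E. \<forall>y\<in>X. f y \<le> e y}"
  obtain C where C: "\<And>y. y \<in> X \<Longrightarrow> \<bar>f y\<bar> \<le> C" using continuous_bound[OF compact fc] by blast
  have "(\<lambda>y. C * indicat_real X y + 0 * indicat_real X y) \<in> U"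
    unfolding U_def using Elc[OF E(3) E(3), of C 0] C by (auto simp: abs_le_iff)
  then have Une: "U \<noteq> {}" by blast
  \<comment> \<open>The upper envelope of \<open>f\<close> at \<open>x\<close> relative to
    \<open>E\<close>. It bounds the integral of \<open>f\<close> under any measure that represents
    \<open>x\<close> on \<open>E\<close>, and duality makes it attained.\<close>
  define \<kappa> where "\<kappa> = (INF e\<in>U. e x)"
  have bdd: "bdd_below ((\<lambda>e. e x) ` U)" using x by (intro bdd_belowI[of _ "f x"]) (auto simp: U_def)
  have \<kappa>le: "\<kappa> \<le> e x" if "e \<in> U" for e unfolding \<kappa>_def using bdd that by (rule cINF_lower)
  have "\<exists>e\<in>U. e x < \<kappa> + 1 / real (Suc j)" for j
    unfolding \<kappa>_def using cINF_less_iff[OF Une bdd, of "(INF e\<in>U. e x) + 1 / real (Suc j)"] by simp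
  then obtain e where e: "\<And>j. e j \<in> U" "\<And>j. e j x < \<kappa> + 1 / real (Suc j)" by metis
  \<comment> \<open>The inequalities for \<open>\<mu>\<close>: integral \<open>v x\<close> for
    \<open>v\<close> in \<open>E\<close>, as an equality because \<open>E\<close> is symmetric, and
    an integral of \<open>f\<close> of at least \<open>\<kappa>\<close>.\<close>
  define K where "K = {(\<lambda>y. v y - l * f y, v x - l * \<kappa>) | v l. v \<in> E \<and> 0 \<le> l}"
  have KI: "(w, t) \<in> K" if "v \<in> E" "0 \<le> l" "w = (\<lambda>y. v y - l * f y)" "t = v x - l * \<kappa>" for w t v l
    unfolding K_def using that by blast
  obtain \<mu> where \<mu>: "radon_prob X \<mu>" "\<And>v t. (v, t) \<in> K \<Longrightarrow> integral\<^sup>L \<mu> v \<le> t"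
  proof (rule radon_prob_exists[OF compact, of K])
    show "(\<lambda>_. 0, 0) \<in> K" by (rule KI[OF Elc[OF E(3) E(3), of 0 0], of 0]) auto
  next
    fix v t assume "(v, t) \<in> K"
    then obtain w l where *: "w \<in> E" "v = (\<lambda>y. w y - l * f y)" unfolding K_def by blast
    show "continuous_on X v" unfolding *(2) by (intro continuous_on_diff continuous_on_mult continuous_on_const Ec *(1) fc)
  next
    fix u v s t assume "(u, s) \<in> K" "(v, t) \<in> K"
    then obtain u' l v' l' where *: "u' \<in> E" "0 \<le> l" "u = (\<lambda>y. u' y - l * f y)" "s = u' x - l * \<kappa>"
      "v' \<in> E" "0 \<le> l'" "v = (\<lambda>y. v' y - l' * f y)" "t = v' x - l' * \<kappa>" unfolding K_def by blast
    show "(\<lambda>x. u x + v x, s + t) \<in> K"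
      by (rule KI[OF Elc[OF *(1) *(5), of 1 1], of "l + l'"]) (use * in \<open>auto simp: algebra_simps\<close>)
  next
    fix r v t assume r: "(0::real) \<le> r" and "(v, t) \<in> K"
    then obtain u l where *: "u \<in> E" "0 \<le> l" "v = (\<lambda>y. u y - l * f y)" "t = u x - l * \<kappa>"
      unfolding K_def by blast
    show "(\<lambda>x. r * v x, r * t) \<in> K"
      by (rule KI[OF Elc[OF *(1) *(1), of r 0], of "r * l"]) (use *(2) r in \<open>simp_all add: *(3,4) right_diff_distrib mult.assoc\<close>)
  next
    fix v t k assume "(v, t) \<in> K" and k: "\<And>y. y \<in> X \<Longrightarrow> k \<le> v y"
    then obtain u l where *: "u \<in> E" "0 \<le> l" "v = (\<lambda>y. u y - l * f y)" "t = u x - l * \<kappa>"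
      unfolding K_def by blast
    show "k \<le> t"
    proof (cases "l = 0")
      case True then show ?thesis using * k[OF x] by simp
    next
      case False
      then have l: "0 < l" using * by simp
      define w where "w = (\<lambda>y. (1/l) * u y + (- k/l) * indicat_real X y)"
      have "w \<in> E" unfolding w_def using *(1) E(3) by (rule Elc)
      moreover have "f y \<le> w y" if "y \<in> X" for y
        using k[OF that] l that * by (simp add: w_def field_simps)
      ultimately have "\<kappa> \<le> w x" using \<kappa>le by (simp add: U_def)
      then show ?thesis using l x * by (simp add: w_def field_simps)
    qed
  qed blast
  interpret prob_space \<mu> using \<mu>(1) by (rule radon_prob_space)
  have int: "integrable \<mu> v" if "continuous_on X v" for v :: "'a \<Rightarrow> real"
    using compact \<mu>(1) that by (rule radon_integrable)
  have Eint: "integral\<^sup>L \<mu> v = v x" if "v \<in> E" for v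
  proof (rule antisym)
    show "integral\<^sup>L \<mu> v \<le> v x" by (rule \<mu>(2), rule KI[OF that, of 0]) auto
    have "integral\<^sup>L \<mu> (\<lambda>y. - v y) \<le> - v x"
      by (rule \<mu>(2), rule KI[OF Elc[OF that that, of "-1" 0], of 0]) auto
    then show "v x \<le> integral\<^sup>L \<mu> v" by simp
  qed
  have "integral\<^sup>L \<mu> (\<lambda>y. - f y) \<le> - \<kappa>"
    by (rule \<mu>(2), rule KI[OF Elc[OF E(3) E(3), of 0 0], of 1]) auto
  then have fint: "\<kappa> \<le> integral\<^sup>L \<mu> f" by simp
  have sp: "space \<mu> = X" using radon_space[OF \<mu>(1)] .
  \<comment> \<open>The nonnegative functions \<open>e j - f\<close> have integrals of at most
    \<open>1 / real (Suc j)\<close>, so by the Markov inequality their infimum is 0 almost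
    everywhere: there the envelope touches \<open>f\<close>.\<close>
  have AEm: "AE y in \<mu>. \<exists>j. e j y - f y < 1 / real (Suc m)" for m
  proof -
    define B where "B = {y\<in>space \<mu>. \<forall>j. 1 / real (Suc m) \<le> e j y - f y}"
    have ec: "continuous_on X (e j)" for j using e(1)[of j] Ec by (auto simp: U_def)
    have meas: "(\<lambda>y. e j y - f y) \<in> borel_measurable \<mu>" for j
      by (intro radon_measurable[OF \<mu>(1)] continuous_intros ec fc)
    have Bs: "B \<in> sets \<mu>" unfolding B_def using meas by measurable
    have le: "measure \<mu> B \<le> (1 / real (Suc j)) * real (Suc m)" for j
    proof -
      have "measure \<mu> B \<le> measure \<mu> {y\<in>space \<mu>. 1 / real (Suc m) \<le> e j y - f y}"
        using Bs meas[of j] by (intro finite_measure_mono) (auto simp: B_def)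
      also have "\<dots> \<le> integral\<^sup>L \<mu> (\<lambda>y. e j y - f y) / (1 / real (Suc m))"
        by (rule integral_Markov_inequality_measure[OF _ sets.top])
          (use e(1)[of j] in \<open>auto intro!: int continuous_intros ec fc AE_I2 simp: sp U_def\<close>)
      also have "integral\<^sup>L \<mu> (\<lambda>y. e j y - f y) = e j x - integral\<^sup>L \<mu> f"
        using Eint[of "e j"] e(1)[of j] int[OF ec] int[OF fc] by (simp add: U_def)
      also have "(e j x - integral\<^sup>L \<mu> f) / (1 / real (Suc m)) \<le> (1 / real (Suc j)) / (1 / real (Suc m))"
        using e(2)[of j] fint by (intro divide_right_mono) auto
      finally show ?thesis by simp
    qed
    have "measure \<mu> B \<le> 0"
    proof (rule LIMSEQ_le_const)
      have "(\<lambda>j. (1 / real (Suc j)) * real (Suc m)) \<longlonglongrightarrow> 0 * real (Suc m)"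
        by (intro tendsto_mult tendsto_const) (use LIMSEQ_inverse_real_of_nat in \<open>simp add: inverse_eq_divide\<close>)
      then show "(\<lambda>j. (1 / real (Suc j)) * real (Suc m)) \<longlonglongrightarrow> 0" by simp
    qed (use le in blast)
    then have "emeasure \<mu> B = 0" by (simp add: emeasure_eq_measure measure_le_0_iff)
    then show ?thesis using Bs
      by (intro AE_I[of _ _ B]) (auto simp: B_def not_less)
  qed
  have "AE y in \<mu>. \<forall>m. \<exists>j. e j y - f y < 1 / real (Suc m)" using AEm by (simp add: AE_all_countable)
  then have "AE y in \<mu>. \<exists>e\<in>extreme_points X. \<forall>h\<in>D. h e = h y"
  proof (rule AE_mp, intro AE_I2 impI)
    fix y assume "y \<in> space \<mu>" and peak: "\<forall>m. \<exists>j. e j y - f y < 1 / real (Suc m)"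
    then have y: "y \<in> X" by (simp add: sp)
    define Q where "Q = {z\<in>X. \<forall>v\<in>D'. v z = v y}"
    have "Q = X \<inter> (\<Inter>v\<in>D'. X \<inter> v -` {v y})" by (auto simp: Q_def)
    moreover have "closedin (top_of_set X) (X \<inter> (\<Inter>v\<in>D'. X \<inter> v -` {v y}))"
      using D' Ac_continuous
      by (intro closedin_Int closedin_INT continuous_closedin_preimage closedin_subtopology_refl[THEN iffD2]) auto
    ultimately have Qc: "compact Q" using closedin_compact[OF compact] by simp
    obtain z where z: "z \<in> extreme_points X" "z \<in> Q"
    proof (rule closed_face_has_extreme_point[OF Qc])
      show "Q \<noteq> {}" using y by (auto simp: Q_def)
      show "Q \<subseteq> X" by (auto simp: Q_def)
      fix p q t assume pq: "p \<in> X" "q \<in> X" and t: "0 < t" "t < 1" and zQ: "(1 - t) *\<^sub>R p + t *\<^sub>R q \<in> Q"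
      define z where "z = (1 - t) *\<^sub>R p + t *\<^sub>R q"
      have zX: "z \<in> X" and zy: "\<And>v. v \<in> D' \<Longrightarrow> v z = v y" using zQ by (auto simp: Q_def z_def)
      have hz: "h n z = h n y" for n using zy hD by blast
      have fz: "f z = f y" by (simp add: f_def hz)
      \<comment> \<open>Each \<open>e j\<close> is affine, dominates \<open>f\<close> and takes the
        same value at \<open>z\<close> as at \<open>y\<close>, where the \<open>e j\<close> come
        arbitrarily close to \<open>f\<close>.\<close>
      have mixle: "(1 - t) * f p + t * f q \<le> f z"
      proof (rule field_le_epsilon)
        fix k :: real assume "0 < k"
        then obtain m where m: "1 / real (Suc m) < k" using reals_Archimedean by (auto simp: inverse_eq_divide)
        obtain j where j: "e j y - f y < 1 / real (Suc m)" using peak by blast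
        have eE: "e j \<in> E" and ef: "\<And>y. y \<in> X \<Longrightarrow> f y \<le> e j y" using e(1)[of j] by (auto simp: U_def)
        have "(1 - t) * f p + t * f q \<le> (1 - t) * e j p + t * e j q"
          using ef pq t by (intro add_mono mult_left_mono) auto
        also have "\<dots> = e j z" unfolding z_def using eE E pq t by (intro Ac_mix[symmetric]) auto
        also have "e j z = e j y" using eE unfolding E_def by (rule span_determined) (rule zy)
        finally show "(1 - t) * f p + t * f q \<le> f z + k" using j m fz by linarith
      qed
      have hmix: "h n z = (1 - t) * h n p + t * h n q" for n
        unfolding z_def using hA pq t by (intro Ac_mix) auto
      \<comment> \<open>The sum of the \<open>g n\<close> is the convexity defect of
        \<open>f\<close> between \<open>p\<close> and \<open>q\<close>. It is at most 0 by
        \<open>mixle\<close>, so each of the nonnegative summands vanishes and every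
        \<open>h n\<close> agrees at \<open>p\<close> and \<open>q\<close>.\<close>
      define g where "g n = c n * (t * (1 - t) * (h n p - h n q)^2)" for n
      have g0: "0 \<le> g n" for n using c(1)[of n] t by (simp add: g_def)
      have geq: "g n = (1 - t) * (c n * (h n p)^2) + t * (c n * (h n q)^2) - c n * (h n z)^2" for n
        unfolding hmix g_def by (simp add: power2_eq_square algebra_simps)
      have "(\<lambda>n. (1 - t) * (c n * (h n p)^2) + t * (c n * (h n q)^2) - c n * (h n z)^2) sums ((1 - t) * f p + t * f q - f z)"
        unfolding f_def using c(2) pq zX by (intro sums_diff sums_add sums_mult summable_sums)
      then have gs: "g sums ((1 - t) * f p + t * f q - f z)" unfolding geq[symmetric] .
      then have "suminf g \<le> 0" using mixle by (simp add: sums_iff)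
      moreover have "0 \<le> suminf g" using gs g0 by (intro suminf_nonneg) (auto simp: sums_iff)
      ultimately have "suminf g = 0" by linarith
      then have "g n = 0" for n using suminf_eq_zero_iff[of g] gs g0 by (simp add: sums_iff)
      moreover have "c n \<noteq> 0" for n using c(1)[of n] by simp
      ultimately have "h n p = h n q" for n using t by (simp add: g_def)
      then have "h n p = h n y \<and> h n q = h n y" for n using hmix[of n] hz[of n] by (simp add: algebra_simps)
      then have "v p = v y \<and> v q = v y" if "v \<in> D'" for v using that hD by blast
      then show "p \<in> Q \<and> q \<in> Q" using pq by (simp add: Q_def)
    qed blast
    then show "\<exists>e\<in>extreme_points X. \<forall>h\<in>D. h e = h y" by (auto simp: Q_def D'_def)
  qed
  then show thesis using that \<mu>(1) Eint span_base unfolding E_def D'_def by blast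
qed

text \<open>Transfers the sign from \<open>ext X\<close> to \<open>x\<close> through a measure under
  which almost every point has a \<open>D\<close>-twin in \<open>ext X\<close>; the set
  \<open>ext X\<close> itself is never measured.\<close>

lemma minimum_principle:
  assumes f: "f \<in> sigma_closure (A\<^sub>c X)" and nn: "\<And>e. e \<in> extreme_points X \<Longrightarrow> 0 \<le> f e" and x: "x \<in> X"
  shows "0 \<le> f x"
proof -
  obtain D where D: "countable D" "D \<subseteq> A\<^sub>c X" "f \<in> sigma_closure D"
    using sigma_closure_countable[OF f] by blast
  obtain \<mu> where \<mu>: "radon_prob X \<mu>" "\<And>h. h \<in> D \<Longrightarrow> integral\<^sup>L \<mu> h = h x"
    "AE y in \<mu>. \<exists>e\<in>extreme_points X. \<forall>h\<in>D. h e = h y" using countable_choquet[OF D(1,2) x] by blast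
  have "AE y in \<mu>. 0 \<le> f y"
    using \<mu>(3) by (rule AE_mp) (intro AE_I2, metis nn sigma_closure_determined[OF D(3)])
  then have "0 \<le> integral\<^sup>L \<mu> f" by (rule integral_nonneg_AE)
  then show ?thesis using sigma_closure_integral[OF D(3,2) \<mu>(1,2)] by simp
qed

text \<open>The continuous functions determined by countable subsets of \<open>A\<^sub>c X\<close>
  form an algebra that contains the constants and separates points. By Stone--Weierstrass
  \<open>f\<close> is the uniform limit of a sequence of them, and countably many countable sets
  have a countable union.\<close>

lemma continuous_determined_by_countable:
  assumes f: "continuous_on X (f :: 'a \<Rightarrow> real)"
  shows "\<exists>D. countable D \<and> D \<subseteq> A\<^sub>c X \<and> (\<forall>y\<in>X. \<forall>z\<in>X. (\<forall>h\<in>D. h y = h z) \<longrightarrow> f y = f z)"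
proof -
  define det where "det D f \<longleftrightarrow> (\<forall>y\<in>X. \<forall>z\<in>X. (\<forall>h\<in>D. h y = h z) \<longrightarrow> f y = f z)" for D :: "('a \<Rightarrow> real) set" and f :: "'a \<Rightarrow> real"
  define R where "R = {f. continuous_on X f \<and> (\<exists>D. countable D \<and> D \<subseteq> A\<^sub>c X \<and> det D f)}"
  have RI: "f \<in> R" if "continuous_on X f" "countable D" "D \<subseteq> A\<^sub>c X" "det D f" for f D
    unfolding R_def using that by blast
  interpret function_ring_on R X
  proof
    show "compact X" by (rule compact)
    show "continuous_on X f" if "f \<in> R" for f using that by (simp add: R_def)
    show "(\<lambda>x. f x + g x) \<in> R" "(\<lambda>x. f x * g x) \<in> R" if fg: "f \<in> R" "g \<in> R" for f g
    proof -
      obtain D D' where *: "continuous_on X f" "countable D" "D \<subseteq> A\<^sub>c X" "det D f"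
        "continuous_on X g" "countable D'" "D' \<subseteq> A\<^sub>c X" "det D' g" using fg unfolding R_def by blast
      have eq: "f y = f z" "g y = g z" if "y \<in> X" "z \<in> X" "\<forall>h\<in>D \<union> D'. h y = h z" for y z
        using *(4,8) that unfolding det_def by blast+
      have d1: "det (D \<union> D') (\<lambda>x. f x + g x)" unfolding det_def
      proof (intro ballI impI)
        fix y z assume a: "y \<in> X" "z \<in> X" "\<forall>h\<in>D \<union> D'. h y = h z"
        show "f y + g y = f z + g z" unfolding eq[OF a] by (rule refl)
      qed
      have d2: "det (D \<union> D') (\<lambda>x. f x * g x)" unfolding det_def
      proof (intro ballI impI)
        fix y z assume a: "y \<in> X" "z \<in> X" "\<forall>h\<in>D \<union> D'. h y = h z"
        show "f y * g y = f z * g z" unfolding eq[OF a] by (rule refl)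
      qed
      have D: "countable (D \<union> D')" "D \<union> D' \<subseteq> A\<^sub>c X" using * by auto
      show "(\<lambda>x. f x + g x) \<in> R" by (rule RI[OF continuous_on_add[OF *(1,5)] D d1])
      show "(\<lambda>x. f x * g x) \<in> R" by (rule RI[OF continuous_on_mult[OF *(1,5)] D d2])
    qed
    show "(\<lambda>_. c) \<in> R" for c by (rule RI[of _ "{}"]) (auto simp: det_def)
    show "\<exists>f\<in>R. f x \<noteq> f y" if xy: "x \<in> X" "y \<in> X" "x \<noteq> y" for x y
    proof -
      obtain a where a: "a \<in> A\<^sub>c X" "a x \<noteq> a y" using Ac_separates xy by blast
      then have "a \<in> R" by (intro RI[of _ "{a}"] Ac_continuous) (auto simp: det_def)
      then show ?thesis using a by blast
    qed
  qed
  have "\<exists>g D. countable D \<and> D \<subseteq> A\<^sub>c X \<and> det D g \<and> (\<forall>x\<in>X. \<bar>f x - g x\<bar> < 1 / real (Suc n))" for n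
    using Stone_Weierstrass_basic[OF f, of "1 / real (Suc n)"] unfolding R_def by auto
  then obtain g D where gD: "\<And>n. countable (D n)" "\<And>n. D n \<subseteq> A\<^sub>c X" "\<And>n. det (D n) (g n)"
    "\<And>n x. x \<in> X \<Longrightarrow> \<bar>f x - g n x\<bar> < 1 / real (Suc n)" by metis
  show ?thesis
  proof (intro exI[of _ "\<Union>n. D n"] conjI ballI impI)
    fix y z assume yz: "y \<in> X" "z \<in> X" and eq: "\<forall>h\<in>(\<Union>n. D n). h y = h z"
    have "\<bar>f y - f z\<bar> \<le> k" if k: "0 < k" for k
    proof -
      have "0 < k / 2" using k by simp
      then obtain n where "inverse (real (Suc n)) < k / 2" using reals_Archimedean by blast
      then have n: "1 / real (Suc n) < k / 2" by (simp add: inverse_eq_divide)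
      have "g n y = g n z" using gD(3)[of n] yz eq unfolding det_def by blast
      then show ?thesis using gD(4)[OF yz(1), of n] gD(4)[OF yz(2), of n] n by linarith
    qed
    then have "\<bar>f y - f z\<bar> \<le> 0" by (rule dense_ge)
    then show "f y = f z" by simp
  qed (use gD in auto)
qed

text \<open>Hahn--Banach in \<open>C(X) \<times> C(X)\<close>: the separating functional vanishes on the pairs \<open>(a, a)\<close> with \<open>a\<close> affine, so its two
  components are measures with the same barycenter.\<close>

lemma sandwich_duality:
  assumes ne: "G \<noteq> {}"
    and cont: "\<And>f g. (f, g) \<in> G \<Longrightarrow> continuous_on X f \<and> continuous_on X g"
    and conv: "\<And>f g f' g' t. (f, g) \<in> G \<Longrightarrow> (f', g') \<in> G \<Longrightarrow> 0 \<le> t \<Longrightarrow> t \<le> 1 \<Longrightarrow>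
      (\<lambda>x. (1 - t) * f x + t * f' x, \<lambda>x. (1 - t) * g x + t * g' x) \<in> G"
    and no: "\<And>f g a. (f, g) \<in> G \<Longrightarrow> a \<in> A\<^sub>c X \<Longrightarrow> (\<And>x. x \<in> X \<Longrightarrow> f x \<le> a x + \<delta> \<and> a x \<le> g x + \<delta>) \<Longrightarrow> False"
  obtains \<sigma> \<tau> where "radon_prob X \<sigma>" "radon_prob X \<tau>" "\<And>a. a \<in> A\<^sub>c X \<Longrightarrow> integral\<^sup>L \<sigma> a = integral\<^sup>L \<tau> a"
    "\<And>f g. (f, g) \<in> G \<Longrightarrow> 2 * \<delta> \<le> integral\<^sup>L \<sigma> f - integral\<^sup>L \<tau> g"
proof -
  define W where "W = {f. continuous_on X (f :: 'a \<Rightarrow> real)} \<times> {f. continuous_on X (f :: 'a \<Rightarrow> real)}"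
  have W: "subspace W" unfolding W_def by (intro subspace_Times subspace_continuous)
  \<comment> \<open>Derivable inequalities \<open>\<phi> (p, q) \<le> t\<close> for a functional
    that increases in \<open>p\<close>, decreases in \<open>q\<close>, vanishes on the pairs
    \<open>(a, a)\<close>, is at most 1 on \<open>(1, - 1)\<close> and at least
    \<open>\<delta>\<close> on \<open>G\<close>: compare \<open>(p, q) + l (f, g)\<close> with
    \<open>(a + r, a - r)\<close>.\<close>
  define ok where "ok p q t l f g a r \<longleftrightarrow> 0 \<le> l \<and> (f, g) \<in> G \<and> a \<in> A\<^sub>c X \<and>
    (\<forall>x\<in>X. p x + l * f x \<le> a x + r) \<and> (\<forall>x\<in>X. a x - r \<le> q x + l * g x) \<and> r - l * \<delta> \<le> t"
    for p q :: "'a \<Rightarrow> real" and t l f g a r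
  define C where "C = {((p, q), t) | p q t. \<exists>l f g a r. ok p q t l f g a r}"
  have CI: "((p, q), t) \<in> C" if "ok p q t l f g a r" for p q t l f g a r
    unfolding C_def using that by blast
  have CE: "\<exists>l f g a r. ok p q t l f g a r" if "((p, q), t) \<in> C" for p q t
    using that unfolding C_def by blast
  obtain f0 g0 where fg0: "(f0, g0) \<in> G" using ne by auto
  have A0: "(\<lambda>_. 0) \<in> A\<^sub>c X" using subspace_0[OF subspace_Ac] by (simp add: zero_fun_def)
  have triv: "((p, q), t) \<in> C" if "a \<in> A\<^sub>c X" "\<And>x. x \<in> X \<Longrightarrow> p x \<le> a x + r" "\<And>x. x \<in> X \<Longrightarrow> a x - r \<le> q x" "r \<le> t" for p q t a r
    by (rule CI[of _ _ _ 0 f0 g0 a r]) (use that fg0 in \<open>auto simp: ok_def\<close>)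
  obtain \<phi> where \<phi>: "\<And>u v. u \<in> W \<Longrightarrow> v \<in> W \<Longrightarrow> \<phi> (u + v) = \<phi> u + \<phi> v"
    "\<And>r v. v \<in> W \<Longrightarrow> \<phi> (r *\<^sub>R v) = r * \<phi> v" "\<And>v t. v \<in> W \<Longrightarrow> (v, t) \<in> C \<Longrightarrow> \<phi> v \<le> (t::real)"
  proof (rule hahn_banach_cone[OF W, of C])
    fix u v s t assume "(u, s) \<in> C" "(v, t) \<in> C"
    moreover obtain p q p' q' where uv: "u = (p, q)" "v = (p', q')" by (metis surj_pair)
    ultimately obtain l f g a r l' f' g' a' r' where 1: "ok p q s l f g a r" and 2: "ok p' q' t l' f' g' a' r'"
      using CE by meson
    have aa: "(\<lambda>x. 1 * a x + 1 * a' x) \<in> A\<^sub>c X" using 1 2 by (intro Ac_lincomb) (auto simp: ok_def)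
    have L: "0 \<le> l" "0 \<le> l'" using 1 2 by (auto simp: ok_def)
    \<comment> \<open>The weight that merges the two members of \<open>G\<close> into one. If both
      multipliers vanish, any value in the unit interval serves.\<close>
    define m where "m = (if l + l' = 0 then 0 else l' / (l + l'))"
    have m1: "0 \<le> m" "m \<le> 1" "(l + l') * m = l'" using L by (auto simp: m_def)
    then have m: "0 \<le> m" "m \<le> 1" "(l + l') * (1 - m) = l" "(l + l') * m = l'"
      by (simp_all add: right_diff_distrib)
    define F where "F = (\<lambda>x. (1 - m) * f x + m * f' x)"
    define H where "H = (\<lambda>x. (1 - m) * g x + m * g' x)"
    have FH: "(F, H) \<in> G" unfolding F_def H_def using 1 2 m by (intro conv) (auto simp: ok_def)
    have eq: "(l + l') * F x = l * f x + l' * f' x" "(l + l') * H x = l * g x + l' * g' x" for x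
      unfolding F_def H_def distrib_left mult.assoc[symmetric] m by simp_all
    have "ok (p + p') (q + q') (s + t) (l + l') F H (\<lambda>x. 1 * a x + 1 * a' x) (r + r')"
      unfolding ok_def eq using L FH aa 1 2 unfolding ok_def
      by (auto simp: distrib_right) (force+)?
    then show "(u + v, s + t) \<in> C" unfolding uv plus_prod_def by (auto intro: CI)
  next
    fix k v t assume k: "(0::real) \<le> k" and "(v, t) \<in> C"
    moreover obtain p q where v: "v = (p, q)" by (metis surj_pair)
    ultimately obtain l f g a r where 1: "ok p q t l f g a r" using CE by meson
    have "ok (k *\<^sub>R p) (k *\<^sub>R q) (k * t) (k * l) f g (\<lambda>x. k * a x + 0 * a x) (k * r)"
      unfolding ok_def
    proof (intro conjI ballI)
      show "0 \<le> k * l" "(f, g) \<in> G" using 1 k by (auto simp: ok_def)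
      show "(\<lambda>x. k * a x + 0 * a x) \<in> A\<^sub>c X" using 1 by (intro Ac_lincomb) (auto simp: ok_def)
      have "k * (r - l * \<delta>) \<le> k * t" using 1 k by (intro mult_left_mono) (auto simp: ok_def)
      then show "k * r - k * l * \<delta> \<le> k * t" by (simp add: right_diff_distrib)
      fix x assume x: "x \<in> X"
      have "k * (p x + l * f x) \<le> k * (a x + r)" "k * (a x - r) \<le> k * (q x + l * g x)"
        using 1 k x by (intro mult_left_mono; auto simp: ok_def)+
      then show "(k *\<^sub>R p) x + k * l * f x \<le> k * a x + 0 * a x + k * r"
        "k * a x + 0 * a x - k * r \<le> (k *\<^sub>R q) x + k * l * g x"
        by (simp_all add: scaleR_fun_def distrib_left right_diff_distrib mult.assoc)
    qed
    then show "(k *\<^sub>R v, k * t) \<in> C" unfolding v by (auto intro: CI)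
  next
    fix v assume "v \<in> W"
    then obtain p q where v: "v = (p, q)" "continuous_on X p" "continuous_on X q" by (auto simp: W_def)
    obtain c d where "\<And>x. x \<in> X \<Longrightarrow> \<bar>p x\<bar> \<le> c" "\<And>x. x \<in> X \<Longrightarrow> \<bar>q x\<bar> \<le> d"
      using continuous_bound[OF compact v(2)] continuous_bound[OF compact v(3)] by metis
    then show "\<exists>t. (v, t) \<in> C" unfolding v
      by (intro exI[of _ "max c d"] triv[OF A0, of _ "max c d"]) (fastforce simp: abs_le_iff)+
  next
    fix t assume "(0, t) \<in> C"
    then obtain l f g a r where 1: "ok 0 0 t l f g a r" using CE[of 0 0 t] by (auto simp: zero_prod_def)
    show "0 \<le> t"
    proof (cases "l = 0")
      case True
      obtain x where "x \<in> X" using nonempty by blast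
      then have "0 \<le> a x + r" "a x - r \<le> 0" "r \<le> t" using 1 True by (auto simp: ok_def)
      then show ?thesis by linarith
    next
      case False
      then have l: "0 < l" using 1 by (auto simp: ok_def)
      show ?thesis
      proof (rule ccontr)
        assume "\<not> 0 \<le> t"
        then have r: "r < l * \<delta>" using 1 by (auto simp: ok_def)
        have "(\<lambda>x. (1/l) * a x + 0 * a x) \<in> A\<^sub>c X" using 1 by (intro Ac_lincomb) (auto simp: ok_def)
        moreover have "f x \<le> (1/l) * a x + 0 * a x + \<delta> \<and> (1/l) * a x + 0 * a x \<le> g x + \<delta>" if "x \<in> X" for x
        proof -
          have "l * f x \<le> a x + r" "a x - r \<le> l * g x" using 1 that by (auto simp: ok_def)
          then have "l * f x \<le> a x + l * \<delta>" "a x \<le> l * g x + l * \<delta>" using r by linarith+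
          then show ?thesis using l by (simp add: field_simps)
        qed
        ultimately show False using no[of f g] 1 unfolding ok_def by blast
      qed
    qed
  qed blast
  have Wm: "(p, q) \<in> W" if "continuous_on X p" "continuous_on X q" for p q using that by (simp add: W_def)
  have split: "\<phi> (p, q) = \<phi> (p, \<lambda>_. 0) + \<phi> (\<lambda>_. 0, q)" if "continuous_on X p" "continuous_on X q" for p q
    using \<phi>(1)[OF Wm[OF that(1) continuous_on_const[of X 0]] Wm[OF continuous_on_const[of X 0] that(2)]] by (simp add: plus_fun_def)
  have le: "\<phi> (p, q) \<le> t" if "continuous_on X p" "continuous_on X q" "((p, q), t) \<in> C" for p q t
    using \<phi>(3) Wm that by blast
  \<comment> \<open>The two components agree on constants and \<open>\<phi> (1, - 1)\<close> is 1,
    so each has mass 1/2. Doubling turns them into probability measures and puts the 2 into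
    \<open>2 * \<delta>\<close>.\<close>
  define s where "s p = 2 * \<phi> (p, \<lambda>_. 0)" for p
  define u where "u q = - 2 * \<phi> (\<lambda>_. 0, q)" for q
  have s_add: "s (\<lambda>x. p x + q x) = s p + s q" and u_add: "u (\<lambda>x. p x + q x) = u p + u q"
    if "continuous_on X p" "continuous_on X q" for p q
    using \<phi>(1)[OF Wm[OF that(1) continuous_on_const[of X 0]] Wm[OF that(2) continuous_on_const[of X 0]]]
      \<phi>(1)[OF Wm[OF continuous_on_const[of X 0] that(1)] Wm[OF continuous_on_const[of X 0] that(2)]]
    by (simp_all add: s_def u_def plus_fun_def)
  have s_scale: "s (\<lambda>x. c * p x) = c * s p" and u_scale: "u (\<lambda>x. c * p x) = c * u p"
    if "continuous_on X p" for c p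
    using \<phi>(2)[OF Wm[OF that continuous_on_const[of X 0]], of c] \<phi>(2)[OF Wm[OF continuous_on_const[of X 0] that], of c]
    by (simp_all add: s_def u_def scaleR_fun_def)
  have Aeq: "s a = u a" if a: "a \<in> A\<^sub>c X" for a
  proof -
    have ac: "continuous_on X a" using a by (rule Ac_continuous)
    have 1: "s b \<le> u b" if "b \<in> A\<^sub>c X" for b
      using le[of b b 0] triv[OF that, of b 0 b 0] split[of b b] Ac_continuous[OF that]
      by (simp add: s_def u_def)
    have "(\<lambda>x. (-1) * a x + 0 * a x) \<in> A\<^sub>c X" using a a by (rule Ac_lincomb)
    then have "s (\<lambda>x. (-1) * a x) \<le> u (\<lambda>x. (-1) * a x)" using 1 by simp
    then show ?thesis using 1[OF a] s_scale[OF ac, of "-1"] u_scale[OF ac, of "-1"] by linarith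
  qed
  \<comment> \<open>Members of \<open>A\<^sub>c X\<close> vanish off \<open>X\<close> and constants
    do not, so the values of \<open>s\<close> and \<open>u\<close> at \<open>indicat_real X\<close>
    and at the constant 1 have to be identified.\<close>
  have cong: "s p = s q" "u p = u q" if "continuous_on X p" "continuous_on X q" "\<And>x. x \<in> X \<Longrightarrow> p x = q x" for p q
  proof -
    have d: "continuous_on X (\<lambda>x. -1 * q x)" "continuous_on X (\<lambda>x. p x + (-1) * q x)"
      "continuous_on X (\<lambda>x. (-1) * (p x + (-1) * q x))" using that by (auto intro!: continuous_intros)
    have "s (\<lambda>x. p x + (-1) * q x) \<le> 0" "s (\<lambda>x. (-1) * (p x + (-1) * q x)) \<le> 0"
      unfolding s_def using le[OF d(2) continuous_on_const triv[OF A0, of _ 0 "\<lambda>_. 0" 0]]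
        le[OF d(3) continuous_on_const triv[OF A0, of _ 0 "\<lambda>_. 0" 0]] that(3) by auto
    then show "s p = s q" using s_scale[OF d(2), of "-1"] s_add[OF that(1) d(1)] s_scale[OF that(2), of "-1"] by simp
    have "- u (\<lambda>x. p x + (-1) * q x) \<le> 0" "- u (\<lambda>x. (-1) * (p x + (-1) * q x)) \<le> 0"
      unfolding u_def using le[OF continuous_on_const d(2) triv[OF A0, of "\<lambda>_. 0" 0 _ 0]]
        le[OF continuous_on_const d(3) triv[OF A0, of "\<lambda>_. 0" 0 _ 0]] that(3) by auto
    then show "u p = u q" using u_scale[OF d(2), of "-1"] u_add[OF that(1) d(1)] u_scale[OF that(2), of "-1"] by simp
  qed
  have s1: "s (\<lambda>_. 1) = 1" and u1: "u (\<lambda>_. 1) = 1"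
  proof -
    have "\<phi> (\<lambda>_. 1, \<lambda>_. -1) \<le> 1" "\<phi> (\<lambda>_. -1, \<lambda>_. 1) \<le> -1"
      by (rule le[OF continuous_on_const continuous_on_const triv[OF A0, of _ 1]]; simp)
        (rule le[OF continuous_on_const continuous_on_const triv[OF A0, of _ "-1"]]; simp)
    then have "s (\<lambda>_. 1) - u (\<lambda>_. - 1) \<le> 2" "s (\<lambda>_. -1) - u (\<lambda>_. 1) \<le> - 2"
      using split[of "\<lambda>_. 1" "\<lambda>_. -1"] split[of "\<lambda>_. -1" "\<lambda>_. 1"] by (auto simp: s_def u_def)
    moreover have "s (\<lambda>_. 1) = u (\<lambda>_. 1)"
      using Aeq[OF Ac_one] cong[of "indicat_real X" "\<lambda>_. 1"] Ac_continuous[OF Ac_one] by simp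
    moreover have "s (\<lambda>_. -1) = - s (\<lambda>_. 1)" "u (\<lambda>_. -1) = - u (\<lambda>_. 1)"
      using s_scale[of "\<lambda>_. 1" "-1"] u_scale[of "\<lambda>_. 1" "-1"] by simp_all
    ultimately show "s (\<lambda>_. 1) = 1" "u (\<lambda>_. 1) = 1" by linarith+
  qed
  have "riesz_functional X s"
  proof
    show "0 \<le> s f" if f: "continuous_on X f" "\<And>x. x \<in> X \<Longrightarrow> 0 \<le> f x" for f
    proof -
      have fm: "continuous_on X (\<lambda>x. (-1) * f x)" using f by (intro continuous_intros)
      have "s (\<lambda>x. (-1) * f x) \<le> 0"
        unfolding s_def using le[OF fm continuous_on_const triv[OF A0, of _ 0 "\<lambda>_. 0" 0]] f(2) by auto
      then show ?thesis using s_scale[OF f(1), of "-1"] by simp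
    qed
  qed (use compact s_add s_scale s1 in auto)
  then obtain \<sigma> where \<sigma>: "radon_prob X \<sigma>" "\<And>f. continuous_on X f \<Longrightarrow> integral\<^sup>L \<sigma> f = s f"
    by (rule radon_prob_of_functional) blast
  have "riesz_functional X u"
  proof
    show "0 \<le> u f" if f: "continuous_on X f" "\<And>x. x \<in> X \<Longrightarrow> 0 \<le> f x" for f
      unfolding u_def using le[OF continuous_on_const f(1) triv[OF A0, of "\<lambda>_. 0" 0 _ 0]] f(2) by auto
  qed (use compact u_add u_scale u1 in auto)
  then obtain \<tau> where \<tau>: "radon_prob X \<tau>" "\<And>f. continuous_on X f \<Longrightarrow> integral\<^sup>L \<tau> f = u f"
    by (rule radon_prob_of_functional) blast
  show thesis
  proof (rule that[OF \<sigma>(1) \<tau>(1)])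
    show "integral\<^sup>L \<sigma> a = integral\<^sup>L \<tau> a" if "a \<in> A\<^sub>c X" for a
      using \<sigma>(2) \<tau>(2) Aeq Ac_continuous that by simp
    fix f g assume fg: "(f, g) \<in> G"
    then have c: "continuous_on X f" "continuous_on X g" using cont by auto
    have cm: "continuous_on X (\<lambda>x. (-1) * f x)" "continuous_on X (\<lambda>x. (-1) * g x)" using c by (auto intro!: continuous_intros)
    have "\<phi> (\<lambda>x. (-1) * f x, \<lambda>x. (-1) * g x) \<le> - \<delta>"
      by (rule le[OF cm CI[of _ _ _ 1 f g "\<lambda>_. 0" 0]]) (use fg A0 in \<open>auto simp: ok_def\<close>)
    then have "s (\<lambda>x. (-1) * f x) - u (\<lambda>x. (-1) * g x) \<le> - 2 * \<delta>"
      using split[OF cm] by (simp add: s_def u_def)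
    then show "2 * \<delta> \<le> integral\<^sup>L \<sigma> f - integral\<^sup>L \<tau> g"
      using \<sigma>(2) \<tau>(2) c s_scale[OF c(1), of "-1"] u_scale[OF c(2), of "-1"] by simp
  qed
qed

end

section \<open>Simplices\<close>

context compact_convex
begin

section \<open>Convex continuous functions and maximal measures\<close>

definition convex_continuous :: "('a \<Rightarrow> real) set" where
  "convex_continuous = {f. convex_on X f \<and> continuous_on X f}"

lemma convex_continuousI:
  assumes "continuous_on X f"
    and "\<And>x y t. x \<in> X \<Longrightarrow> y \<in> X \<Longrightarrow> 0 < t \<Longrightarrow> t < 1 \<Longrightarrow> f ((1 - t) *\<^sub>R x + t *\<^sub>R y) \<le> (1 - t) * f x + t * f y"
  shows "f \<in> convex_continuous"
  unfolding convex_continuous_def using assms convex by (blast intro: convex_onI)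

lemma convex_continuous_add:
  "f \<in> convex_continuous \<Longrightarrow> g \<in> convex_continuous \<Longrightarrow> (\<lambda>x. f x + g x) \<in> convex_continuous"
  unfolding convex_continuous_def by (simp add: convex_on_add continuous_on_add)

lemma convex_continuous_cmul:
  "0 \<le> c \<Longrightarrow> f \<in> convex_continuous \<Longrightarrow> (\<lambda>x. c * f x) \<in> convex_continuous"
  unfolding convex_continuous_def by (simp add: convex_on_cmul continuous_on_mult_left)

lemma convex_continuous_affine:
  assumes a: "a \<in> A\<^sub>c X"
  shows "(\<lambda>x. c * a x + d) \<in> convex_continuous"
proof (rule convex_continuousI)
  show "continuous_on X (\<lambda>x. c * a x + d)" by (intro continuous_intros Ac_continuous a)
  fix x y t assume "x \<in> X" "y \<in> X" "0 < t" "t < (1::real)"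
  then have "a ((1 - t) *\<^sub>R x + t *\<^sub>R y) = (1 - t) * a x + t * a y" by (intro Ac_mix a) auto
  then show "c * a ((1 - t) *\<^sub>R x + t *\<^sub>R y) + d \<le> (1 - t) * (c * a x + d) + t * (c * a y + d)"
    by (simp only:) (simp add: algebra_simps)
qed

lemma convex_continuous_max:
  assumes f: "f \<in> convex_continuous" and g: "g \<in> convex_continuous"
  shows "(\<lambda>x. max (f x) (g x)) \<in> convex_continuous"
proof (rule convex_continuousI)
  show "continuous_on X (\<lambda>x. max (f x) (g x))"
    using f g by (intro continuous_intros) (auto simp: convex_continuous_def)
  fix x y t assume xy: "x \<in> X" "y \<in> X" "0 < t" "t < (1::real)"
  have "f ((1 - t) *\<^sub>R x + t *\<^sub>R y) \<le> (1 - t) * f x + t * f y" "g ((1 - t) *\<^sub>R x + t *\<^sub>R y) \<le> (1 - t) * g x + t * g y"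
    using f g xy by (auto simp: convex_continuous_def intro!: convex_onD)
  moreover have "(1 - t) * f x \<le> (1 - t) * max (f x) (g x)" "t * f y \<le> t * max (f y) (g y)"
    "(1 - t) * g x \<le> (1 - t) * max (f x) (g x)" "t * g y \<le> t * max (f y) (g y)"
    using xy by (auto intro!: mult_left_mono)
  ultimately show "max (f ((1 - t) *\<^sub>R x + t *\<^sub>R y)) (g ((1 - t) *\<^sub>R x + t *\<^sub>R y))
      \<le> (1 - t) * max (f x) (g x) + t * max (f y) (g y)" by linarith
qed

lemma convex_continuous_square:
  assumes f: "f \<in> convex_continuous" and nn: "\<And>x. x \<in> X \<Longrightarrow> 0 \<le> f x"
  shows "(\<lambda>x. (f x)^2) \<in> convex_continuous"
proof (rule convex_continuousI)
  show "continuous_on X (\<lambda>x. (f x)^2)"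
    using f by (intro continuous_intros) (auto simp: convex_continuous_def)
  fix x y t assume xy: "x \<in> X" "y \<in> X" "0 < t" "t < (1::real)"
  have "f ((1 - t) *\<^sub>R x + t *\<^sub>R y) \<le> (1 - t) * f x + t * f y"
    using f xy by (auto simp: convex_continuous_def intro!: convex_onD)
  then have "(f ((1 - t) *\<^sub>R x + t *\<^sub>R y))^2 \<le> ((1 - t) * f x + t * f y)^2"
    using xy by (intro power_mono nn mix) auto
  also have "((1 - t) * f x + t * f y)^2 = (1 - t) * (f x)^2 + t * (f y)^2 - t * (1 - t) * (f x - f y)^2"
    by (simp add: power2_eq_square algebra_simps)
  also have "\<dots> \<le> (1 - t) * (f x)^2 + t * (f y)^2" using xy by simp
  finally show "(f ((1 - t) *\<^sub>R x + t *\<^sub>R y))^2 \<le> (1 - t) * (f x)^2 + t * (f y)^2" .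
qed

text \<open>Differences of nonnegative convex functions form an algebra, because
  \<open>pq = ((p + q)\<^sup>2 - p\<^sup>2 - q\<^sup>2)/2\<close>.\<close>

lemma radon_prob_eq_if_convex:
  assumes \<mu>: "radon_prob X \<mu>" and \<nu>: "radon_prob X \<nu>"
    and eq: "\<And>f. f \<in> convex_continuous \<Longrightarrow> integral\<^sup>L \<mu> f = integral\<^sup>L \<nu> f"
  shows "\<mu> = \<nu>"
proof (rule radon_prob_eqI[OF compact \<mu> \<nu>])
  fix f :: "'a \<Rightarrow> real" assume f: "continuous_on X f"
  define P where "P = {p \<in> convex_continuous. \<forall>x\<in>X. 0 \<le> p x}"
  have Pc: "continuous_on X p" if "p \<in> P" for p using that by (simp add: P_def convex_continuous_def)
  have Padd: "(\<lambda>x. p x + q x) \<in> P" if "p \<in> P" "q \<in> P" for p q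
    using that by (simp add: P_def convex_continuous_add)
  have Psq: "(\<lambda>x. (1/2) * (p x)^2) \<in> P" if "p \<in> P" for p
  proof -
    have "(\<lambda>x. (1/2) * (p x)^2) \<in> convex_continuous"
      using that by (intro convex_continuous_cmul convex_continuous_square) (auto simp: P_def)
    then show ?thesis by (simp add: P_def)
  qed
  have Paff: "(\<lambda>x. c * a x + d) \<in> P" if "a \<in> A\<^sub>c X" "\<And>x. x \<in> X \<Longrightarrow> 0 \<le> c * a x + d" for a c d
    using that by (simp add: P_def convex_continuous_affine)
  have Pconst: "(\<lambda>_. c) \<in> P" if "0 \<le> c" for c using Paff[OF Ac_one, of 0 c] that by simp
  define R where "R = {\<lambda>x. p x - q x | p q. p \<in> P \<and> q \<in> P}"
  have RI: "h \<in> R" if "p \<in> P" "q \<in> P" "h = (\<lambda>x. p x - q x)" for h p q using that unfolding R_def by blast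
  interpret function_ring_on R X
  proof
    show "compact X" by (rule compact)
    show "continuous_on X f" if "f \<in> R" for f
      using that Pc unfolding R_def by (auto intro!: continuous_on_diff)
    show "(\<lambda>x. f x + g x) \<in> R" "(\<lambda>x. f x * g x) \<in> R" if fg: "f \<in> R" "g \<in> R" for f g
    proof -
      obtain p q p' q' where *: "p \<in> P" "q \<in> P" "f = (\<lambda>x. p x - q x)" "p' \<in> P" "q' \<in> P" "g = (\<lambda>x. p' x - q' x)"
        using fg unfolding R_def by blast
      show "(\<lambda>x. f x + g x) \<in> R"
        by (rule RI[OF Padd[OF *(1,4)] Padd[OF *(2,5)]]) (simp add: *(3,6) fun_eq_iff)
      \<comment> \<open>(p - q)(p' - q') is half of (p + p')^2 + (q + q')^2 - (p + q')^2 - (q +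
        p')^2.\<close>
      show "(\<lambda>x. f x * g x) \<in> R"
        by (rule RI[OF Padd[OF Psq[OF Padd[OF *(1,4)]] Psq[OF Padd[OF *(2,5)]]]
              Padd[OF Psq[OF Padd[OF *(1,5)]] Psq[OF Padd[OF *(2,4)]]]])
          (simp add: *(3,6) fun_eq_iff power2_eq_square field_simps)
    qed
    show "(\<lambda>_. c) \<in> R" for c
      by (rule RI[OF Pconst[of "max c 0"] Pconst[of "max (- c) 0"]]) (auto simp: fun_eq_iff)
    show "\<exists>f\<in>R. f x \<noteq> f y" if xy: "x \<in> X" "y \<in> X" "x \<noteq> y" for x y
    proof -
      obtain a where a: "a \<in> A\<^sub>c X" "a x \<noteq> a y" using Ac_separates xy by blast
      obtain C where C: "0 < C" "\<And>x. x \<in> X \<Longrightarrow> \<bar>a x\<bar> \<le> C" using Ac_bound[OF a(1)] by blast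
      have aC: "(\<lambda>x. 1 * a x + C) \<in> P" by (rule Paff[OF a(1)]) (use C(2) in \<open>force simp: abs_le_iff\<close>)
      then have "(\<lambda>x. (1 * a x + C) - C) \<in> R" using C(1) by (intro RI[OF aC Pconst[of C]]) auto
      then show ?thesis using a(2) by (intro bexI[of _ "\<lambda>x. (1 * a x + C) - C"]) auto
    qed
  qed
  have Req: "integral\<^sup>L \<mu> g = integral\<^sup>L \<nu> g" if "g \<in> R" for g
    using that radon_integrable[OF compact \<mu> Pc] radon_integrable[OF compact \<nu> Pc] eq
    unfolding R_def by (force simp: P_def)
  interpret M: prob_space \<mu> using \<mu> by (rule radon_prob_space)
  interpret N: prob_space \<nu> using \<nu> by (rule radon_prob_space)
  have bound: "\<bar>integral\<^sup>L \<mu> f - integral\<^sup>L \<nu> f\<bar> \<le> 2 * e" if e: "0 < e" for e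
  proof -
    obtain g where g: "g \<in> R" "\<And>x. x \<in> X \<Longrightarrow> \<bar>f x - g x\<bar> < e" using Stone_Weierstrass_basic[OF f e] by blast
    have *: "\<bar>integral\<^sup>L \<rho> f - integral\<^sup>L \<rho> g\<bar> \<le> e" if \<rho>: "radon_prob X \<rho>" for \<rho>
    proof -
      interpret prob_space \<rho> using \<rho> by (rule radon_prob_space)
      have i: "integrable \<rho> f" "integrable \<rho> g" using radon_integrable[OF compact \<rho>] f continuous[OF g(1)] by auto
      have "integral\<^sup>L \<rho> f - integral\<^sup>L \<rho> g = integral\<^sup>L \<rho> (\<lambda>x. f x - g x)" using i by simp
      moreover have "\<bar>integral\<^sup>L \<rho> (\<lambda>x. f x - g x)\<bar> \<le> integral\<^sup>L \<rho> (\<lambda>x. \<bar>f x - g x\<bar>)" by (rule integral_abs_bound)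
      moreover have "integral\<^sup>L \<rho> (\<lambda>x. \<bar>f x - g x\<bar>) \<le> integral\<^sup>L \<rho> (\<lambda>_. e)"
        using i g(2) radon_space[OF \<rho>] by (intro integral_mono) (auto simp: less_imp_le)
      moreover have "integral\<^sup>L \<rho> (\<lambda>_. e) = e" using prob_space by simp
      ultimately show ?thesis by linarith
    qed
    show ?thesis using *[OF \<mu>] *[OF \<nu>] Req[OF g(1)] by linarith
  qed
  have "\<bar>integral\<^sup>L \<mu> f - integral\<^sup>L \<nu> f\<bar> \<le> 0"
  proof (rule field_le_epsilon)
    fix e :: real assume "0 < e"
    then show "\<bar>integral\<^sup>L \<mu> f - integral\<^sup>L \<nu> f\<bar> \<le> 0 + e" using bound[of "e / 2"] by simp
  qed
  then show "integral\<^sup>L \<mu> f = integral\<^sup>L \<nu> f" by simp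
qed

lemma dilation_le_iff: "dilation_le X \<mu> \<nu> \<longleftrightarrow> (\<forall>f\<in>convex_continuous. integral\<^sup>L \<mu> f \<le> integral\<^sup>L \<nu> f)"
  by (auto simp: dilation_le_def convex_continuous_def)

text \<open>Zorn is applied to hypographs because inclusion of \<open>hyp \<mu>\<close> in
  \<open>hyp \<nu>\<close> is the dilation order. A bound for a chain is a measure that meets all
  inequalities \<open>t \<le> integral\<^sup>L \<mu> f\<close> of the union; any two of them are met
  by one member of the chain, which makes the system consistent. A maximal hypograph gives a maximal
  measure, since convex continuous functions determine a Radon measure.\<close>

lemma maximal_above:
  assumes \<sigma>: "radon_prob X \<sigma>"
  obtains \<nu> where "maximal_prob X \<nu>" "dilation_le X \<sigma> \<nu>"
proof -
  define hyp where "hyp \<mu> = {(f, t). f \<in> convex_continuous \<and> t \<le> integral\<^sup>L \<mu> f}" for \<mu> :: "'a measure"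
  define \<A> where "\<A> = {hyp \<mu> | \<mu>. radon_prob X \<mu> \<and> dilation_le X \<sigma> \<mu>}"
  have cc: "continuous_on X f" if "f \<in> convex_continuous" for f using that by (simp add: convex_continuous_def)
  have zero: "(\<lambda>_. 0) \<in> convex_continuous" using convex_continuous_affine[OF Ac_one, of 0 0] by simp
  have "\<exists>M\<in>\<A>. \<forall>Y\<in>\<A>. M \<subseteq> Y \<longrightarrow> Y = M"
  proof (rule subset_Zorn)
    fix \<C> assume ch: "subset.chain \<A> \<C>"
    show "\<exists>U\<in>\<A>. \<forall>Y\<in>\<C>. Y \<subseteq> U"
    proof (cases "\<C> = {}")
      case True
      have "hyp \<sigma> \<in> \<A>" unfolding \<A>_def dilation_le_iff using \<sigma> by blast
      then show ?thesis using True by blast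
    next
      case False
      have el: "\<exists>\<mu>. Y = hyp \<mu> \<and> radon_prob X \<mu> \<and> dilation_le X \<sigma> \<mu>" if "Y \<in> \<C>" for Y
        using ch that unfolding subset_chain_def \<A>_def by blast
      have tot: "Y \<subseteq> Z \<or> Z \<subseteq> Y" if "Y \<in> \<C>" "Z \<in> \<C>" for Y Z
        using ch that unfolding subset_chain_def by blast
      define K where "K = {(\<lambda>x. - f x, - t) | f t. (f, t) \<in> \<Union>\<C>}"
      have KI: "(v, t) \<in> K" if "(f, - t) \<in> \<Union>\<C>" "v = (\<lambda>x. - f x)" for v t f
        unfolding K_def using that by (intro CollectI exI[of _ f] exI[of _ "- t"]) auto
      have KE: "\<exists>f \<mu>. v = (\<lambda>x. - f x) \<and> f \<in> convex_continuous \<and> - t \<le> integral\<^sup>L \<mu> f \<and> hyp \<mu> \<in> \<C> \<and> radon_prob X \<mu>"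
        if vt: "(v, t) \<in> K" for v t
      proof -
        obtain f Y where f: "v = (\<lambda>x. - f x)" "(f, - t) \<in> Y" "Y \<in> \<C>" using vt unfolding K_def by auto
        obtain \<mu> where "Y = hyp \<mu>" "radon_prob X \<mu>" using el[OF f(3)] by blast
        then show ?thesis using f by (auto simp: hyp_def)
      qed
      obtain \<mu> where \<mu>: "radon_prob X \<mu>" "\<And>v t. (v, t) \<in> K \<Longrightarrow> integral\<^sup>L \<mu> v \<le> t"
      proof (rule radon_prob_exists[OF compact, of K])
        obtain Y where Y: "Y \<in> \<C>" using False by blast
        then have "((\<lambda>_. 0), - 0) \<in> Y" using el[of Y] zero by (auto simp: hyp_def)
        then have "((\<lambda>_. 0), - 0) \<in> \<Union>\<C>" using Y by blast
        then show "(\<lambda>_. 0, 0) \<in> K" by (rule KI) simp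
      next
        fix v t assume "(v, t) \<in> K"
        then show "continuous_on X v" using KE cc by (metis continuous_on_minus)
      next
        fix u v s t assume "(u, s) \<in> K" "(v, t) \<in> K"
        then obtain f \<mu> g \<nu> where *: "u = (\<lambda>x. - f x)" "f \<in> convex_continuous" "- s \<le> integral\<^sup>L \<mu> f" "hyp \<mu> \<in> \<C>" "radon_prob X \<mu>"
          "v = (\<lambda>x. - g x)" "g \<in> convex_continuous" "- t \<le> integral\<^sup>L \<nu> g" "hyp \<nu> \<in> \<C>" "radon_prob X \<nu>"
          using KE by metis
        have fh: "(f, - s) \<in> hyp \<mu>" "(g, - t) \<in> hyp \<nu>" using * by (auto simp: hyp_def)
        obtain \<rho> where \<rho>: "hyp \<rho> \<in> \<C>" "radon_prob X \<rho>" "(f, - s) \<in> hyp \<rho>" "(g, - t) \<in> hyp \<rho>"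
          using tot[OF *(4,9)] fh *(4,5,9,10) by blast
        have "(\<lambda>x. f x + g x, - (s + t)) \<in> hyp \<rho>"
          using \<rho> radon_integrable[OF compact \<rho>(2) cc] by (simp add: hyp_def convex_continuous_add)
        then show "(\<lambda>x. u x + v x, s + t) \<in> K"
          by (intro KI[of "\<lambda>x. f x + g x"]) (use \<rho>(1) * in \<open>auto simp: fun_eq_iff\<close>)
      next
        fix r v t assume r: "(0::real) \<le> r" and "(v, t) \<in> K"
        then obtain f \<mu> where *: "v = (\<lambda>x. - f x)" "f \<in> convex_continuous" "- t \<le> integral\<^sup>L \<mu> f" "hyp \<mu> \<in> \<C>" "radon_prob X \<mu>"
          using KE by metis
        have "(\<lambda>x. r * f x, - (r * t)) \<in> hyp \<mu>"
          using * r mult_left_mono[OF *(3) r] by (simp add: hyp_def convex_continuous_cmul)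
        then show "(\<lambda>x. r * v x, r * t) \<in> K"
          by (intro KI[of "\<lambda>x. r * f x"]) (use * in \<open>auto simp: fun_eq_iff\<close>)
      next
        fix v t c assume "(v, t) \<in> K" and c: "\<And>x. x \<in> X \<Longrightarrow> c \<le> v x"
        then obtain f \<mu> where *: "v = (\<lambda>x. - f x)" "f \<in> convex_continuous" "- t \<le> integral\<^sup>L \<mu> f" "hyp \<mu> \<in> \<C>" "radon_prob X \<mu>"
          using KE by metis
        interpret prob_space \<mu> using *(5) by (rule radon_prob_space)
        have "integral\<^sup>L \<mu> f \<le> integral\<^sup>L \<mu> (\<lambda>_. - c)"
          using c *(1) radon_integrable[OF compact *(5) cc[OF *(2)]] radon_space[OF *(5)]
          by (intro integral_mono) (auto simp: le_minus_iff)
        then show "c \<le> t" using *(3) prob_space by simp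
      qed blast
      have le: "t \<le> integral\<^sup>L \<mu> f" if "(f, t) \<in> \<Union>\<C>" for f t
        using \<mu>(2)[OF KI[of f "- t"]] that by simp
      have sub: "Y \<subseteq> hyp \<mu>" if "Y \<in> \<C>" for Y
      proof
        fix z assume z: "z \<in> Y"
        obtain f t where ft: "z = (f, t)" by (metis surj_pair)
        have "f \<in> convex_continuous" using el[OF that] z ft by (auto simp: hyp_def)
        then show "z \<in> hyp \<mu>" using le[of f t] z that ft by (auto simp: hyp_def)
      qed
      obtain Y where Y: "Y \<in> \<C>" using False by blast
      then obtain \<rho> where \<rho>: "Y = hyp \<rho>" "dilation_le X \<sigma> \<rho>" using el by blast
      have "dilation_le X \<sigma> \<mu>" unfolding dilation_le_iff
      proof
        fix f assume f: "f \<in> convex_continuous"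
        then have "(f, integral\<^sup>L \<rho> f) \<in> Y" by (simp add: \<rho>(1) hyp_def)
        then have "integral\<^sup>L \<rho> f \<le> integral\<^sup>L \<mu> f" using sub[OF Y] by (auto simp: hyp_def)
        then show "integral\<^sup>L \<sigma> f \<le> integral\<^sup>L \<mu> f" using \<rho>(2) f unfolding dilation_le_iff by force
      qed
      then have "hyp \<mu> \<in> \<A>" unfolding \<A>_def using \<mu>(1) by blast
      then show ?thesis using sub by blast
    qed
  qed
  then obtain M where M: "M \<in> \<A>" "\<forall>Y\<in>\<A>. M \<subseteq> Y \<longrightarrow> Y = M" by (rule bexE)
  then obtain \<nu> where \<nu>: "M = hyp \<nu>" "radon_prob X \<nu>" "dilation_le X \<sigma> \<nu>" unfolding \<A>_def by blast
  have "maximal_prob X \<nu>" unfolding maximal_prob_def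
  proof (intro conjI allI impI)
    show "radon_prob X \<nu>" by fact
    fix \<rho> assume \<rho>: "radon_prob X \<rho> \<and> dilation_le X \<nu> \<rho>"
    have "dilation_le X \<sigma> \<rho>" using \<rho> \<nu>(3) unfolding dilation_le_iff by (meson order_trans)
    then have "hyp \<rho> \<in> \<A>" unfolding \<A>_def using \<rho> by blast
    moreover have "hyp \<nu> \<subseteq> hyp \<rho>" using \<rho> unfolding dilation_le_iff hyp_def by force
    ultimately have eq: "hyp \<rho> = hyp \<nu>" using M(2) \<nu>(1) by blast
    show "\<rho> = \<nu>"
    proof (rule radon_prob_eq_if_convex)
      fix f assume f: "f \<in> convex_continuous"
      then have "(f, integral\<^sup>L \<rho> f) \<in> hyp \<nu>" unfolding eq[symmetric] by (simp add: hyp_def)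
      then show "integral\<^sup>L \<rho> f = integral\<^sup>L \<nu> f"
        using \<rho> f unfolding dilation_le_iff by (auto simp: hyp_def intro!: antisym)
    qed (use \<rho> \<nu> in auto)
  qed
  then show thesis using that \<nu>(3) by blast
qed

section \<open>Barycenters, affine interpolation and peak functions on a simplex\<close>

lemma barycenter_exists:
  assumes \<mu>: "radon_prob X \<mu>"
  obtains y where "is_barycenter X \<mu> y"
proof -
  interpret prob_space \<mu> using \<mu> by (rule radon_prob_space)
  have int: "integrable \<mu> a" if "a \<in> A\<^sub>c X" for a using compact \<mu> Ac_continuous[OF that] by (rule radon_integrable)
  have "linear_functional_on (A\<^sub>c X) (integral\<^sup>L \<mu>)"
    unfolding linear_functional_on_def using int by (simp add: plus_fun_def scaleR_fun_def)
  then obtain y where "y \<in> X" "\<And>a. a \<in> A\<^sub>c X \<Longrightarrow> integral\<^sup>L \<mu> a = a y"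
  proof (rule functional_is_evaluation[OF compact convex nonempty order_refl subspace_Ac order_refl])
    fix a c assume "a \<in> A\<^sub>c X" "\<And>x. x \<in> X \<Longrightarrow> a x \<le> c"
    then have "integral\<^sup>L \<mu> a \<le> integral\<^sup>L \<mu> (\<lambda>_. c)"
      using int radon_space[OF \<mu>] by (intro integral_mono) auto
    then show "integral\<^sup>L \<mu> a \<le> c" using prob_space by simp
  qed blast
  then show thesis using that[of y] by (simp add: is_barycenter_def)
qed

text \<open>Continuous affine functions are convex together with their negatives.\<close>

lemma dilation_barycenter:
  assumes "is_barycenter X \<mu> y" "dilation_le X \<mu> \<nu>"
  shows "is_barycenter X \<nu> y"
  unfolding is_barycenter_def
proof (intro conjI ballI)
  show "y \<in> X" using assms by (simp add: is_barycenter_def)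
  fix a assume a: "a \<in> A\<^sub>c X"
  have "integral\<^sup>L \<mu> (\<lambda>x. 1 * a x + 0) \<le> integral\<^sup>L \<nu> (\<lambda>x. 1 * a x + 0)"
    "integral\<^sup>L \<mu> (\<lambda>x. -1 * a x + 0) \<le> integral\<^sup>L \<nu> (\<lambda>x. -1 * a x + 0)"
    using assms(2) convex_continuous_affine[OF a] unfolding dilation_le_iff by blast+
  then have "integral\<^sup>L \<nu> a = integral\<^sup>L \<mu> a" by simp
  then show "integral\<^sup>L \<nu> a = a y" using assms(1) a by (simp add: is_barycenter_def)
qed

text \<open>Maximal measures above \<open>\<sigma>\<close> and \<open>\<tau>\<close> have the same
  barycenter and therefore coincide. Passing to this common \<open>\<nu>\<close> does not decrease
  integrals of convex functions nor increase those of concave ones, so the inequality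
  \<open>f \<le> g\<close> is integrated under \<open>\<nu>\<close> and carried back to
  \<open>\<sigma>\<close> and \<open>\<tau>\<close>.\<close>

lemma simplex_sandwich:
  assumes simplex: "choquet_simplex X" and \<sigma>: "radon_prob X \<sigma>" and \<tau>: "radon_prob X \<tau>"
    and eq: "\<And>a. a \<in> A\<^sub>c X \<Longrightarrow> integral\<^sup>L \<sigma> a = integral\<^sup>L \<tau> a"
    and f: "f \<in> convex_continuous" and g: "(\<lambda>x. - g x) \<in> convex_continuous"
    and fg: "\<And>x. x \<in> X \<Longrightarrow> f x \<le> g x"
  shows "integral\<^sup>L \<sigma> f \<le> integral\<^sup>L \<tau> g"
proof -
  obtain y where y: "is_barycenter X \<sigma> y" using barycenter_exists[OF \<sigma>] by blast
  then have y': "is_barycenter X \<tau> y" using eq by (simp add: is_barycenter_def)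
  obtain \<nu> \<nu>' where \<nu>: "maximal_prob X \<nu>" "dilation_le X \<sigma> \<nu>" "maximal_prob X \<nu>'" "dilation_le X \<tau> \<nu>'"
    using maximal_above[OF \<sigma>] maximal_above[OF \<tau>] by metis
  have yX: "y \<in> X" using y by (simp add: is_barycenter_def)
  then have "\<nu>' = \<nu>"
    using simplex \<nu> dilation_barycenter[OF y \<nu>(2)] dilation_barycenter[OF y' \<nu>(4)]
    unfolding choquet_simplex_def by blast
  then have t: "integral\<^sup>L \<nu> g \<le> integral\<^sup>L \<tau> g" using \<nu>(4) g unfolding dilation_le_iff by force
  have r: "radon_prob X \<nu>" using \<nu>(1) by (simp add: maximal_prob_def)
  have "continuous_on X f" "continuous_on X g"
    using f g continuous_on_minus[of X "\<lambda>x. - g x"] by (auto simp: convex_continuous_def)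
  then have "integral\<^sup>L \<nu> f \<le> integral\<^sup>L \<nu> g"
    using fg radon_space[OF r] radon_integrable[OF compact r] by (intro integral_mono) auto
  moreover have "integral\<^sup>L \<sigma> f \<le> integral\<^sup>L \<nu> f" using \<nu>(2) f unfolding dilation_le_iff by blast
  ultimately show ?thesis using t by linarith
qed

text \<open>If every common affine minorant stayed below \<open>1 - e\<close> at \<open>x\<close>,
  Hahn--Banach would give a positive functional \<open>s\<close>, dominated by evaluation at
  \<open>x\<close>, with \<open>s (a - b) \<le> 1 - e - b x\<close>. Extremality makes
  \<open>s\<close> equal to \<open>k\<close> times the evaluation, and
  \<open>k * a x + (1 - k) * b x \<le> 1 - e\<close> contradicts \<open>ab\<close>.\<close>

lemma affine_minorant_at_extreme_point:
  assumes x: "x \<in> extreme_points X" and a: "a \<in> A\<^sub>c X" and b: "b \<in> A\<^sub>c X"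
    and ab: "1 \<le> a x" "1 \<le> b x" and e: "0 < e"
  shows "\<exists>d\<in>A\<^sub>c X. (\<forall>y\<in>X. d y \<le> a y \<and> d y \<le> b y) \<and> 1 - e \<le> d x"
proof (rule ccontr)
  assume no: "\<not> ?thesis"
  have xX: "x \<in> X" using x by (rule ext_in)
  have nod: "d x < 1 - e" if "d \<in> A\<^sub>c X" "\<And>y. y \<in> X \<Longrightarrow> d y \<le> a y \<and> d y \<le> b y" for d
  proof (rule ccontr)
    assume "\<not> d x < 1 - e"
    then have "1 - e \<le> d x" by simp
    then show False using no that by blast
  qed
  define m where "m = 1 - e - b x"
  \<comment> \<open>The inequalities for \<open>s\<close>: \<open>s v \<le> p x\<close> whenever
    \<open>v \<le> p\<close> and \<open>0 \<le> p\<close>, which contains positivity, and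
    \<open>s (a - b) \<le> m\<close>.\<close>
  define C where "C = {(v, t) | v t. \<exists>p\<in>A\<^sub>c X. \<exists>l\<ge>0. (\<forall>y\<in>X. 0 \<le> p y) \<and>
    (\<forall>y\<in>X. v y \<le> p y + l * (a y - b y)) \<and> p x + l * m \<le> (t::real)}"
  have CI: "(v, t) \<in> C" if "p \<in> A\<^sub>c X" "0 \<le> l" "\<And>y. y \<in> X \<Longrightarrow> 0 \<le> p y"
    "\<And>y. y \<in> X \<Longrightarrow> v y \<le> p y + l * (a y - b y)" "p x + l * m \<le> t" for v t p l
    unfolding C_def using that by blast
  have A0: "(\<lambda>y. 0) \<in> A\<^sub>c X" using Ac_lincomb[OF a a, of 0 0] by simp
  obtain s where s: "\<And>u v. u \<in> A\<^sub>c X \<Longrightarrow> v \<in> A\<^sub>c X \<Longrightarrow> s (u + v) = s u + s v"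
    "\<And>r v. v \<in> A\<^sub>c X \<Longrightarrow> s (r *\<^sub>R v) = r * s v" "\<And>v t. v \<in> A\<^sub>c X \<Longrightarrow> (v, t) \<in> C \<Longrightarrow> s v \<le> (t::real)"
  proof (rule hahn_banach_cone[OF subspace_Ac, of C])
    fix u v s t assume "(u, s) \<in> C" "(v, t) \<in> C"
    then obtain p l p' l' where *: "p \<in> A\<^sub>c X" "0 \<le> l" "\<forall>y\<in>X. 0 \<le> p y" "\<forall>y\<in>X. u y \<le> p y + l * (a y - b y)" "p x + l * m \<le> s"
      "p' \<in> A\<^sub>c X" "0 \<le> l'" "\<forall>y\<in>X. 0 \<le> p' y" "\<forall>y\<in>X. v y \<le> p' y + l' * (a y - b y)" "p' x + l' * m \<le> t"
      unfolding C_def by blast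
    show "(u + v, s + t) \<in> C"
    proof (rule CI[OF Ac_lincomb[OF *(1,6), of 1 1], of "l + l'"])
      show "(u + v) y \<le> 1 * p y + 1 * p' y + (l + l') * (a y - b y)" if "y \<in> X" for y
        using bspec[OF *(4) that] bspec[OF *(9) that] by (simp add: distrib_right)
      show "1 * p x + 1 * p' x + (l + l') * m \<le> s + t" using *(5,10) by (simp add: distrib_right)
    qed (use * in auto)
  next
    fix r v t assume r: "(0::real) \<le> r" and "(v, t) \<in> C"
    then obtain p l where *: "p \<in> A\<^sub>c X" "0 \<le> l" "\<forall>y\<in>X. 0 \<le> p y" "\<forall>y\<in>X. v y \<le> p y + l * (a y - b y)" "p x + l * m \<le> t"
      unfolding C_def by blast
    show "(r *\<^sub>R v, r * t) \<in> C"
    proof (rule CI[OF Ac_lincomb[OF *(1,1), of r 0], of "r * l"])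
      show "(r *\<^sub>R v) y \<le> r * p y + 0 * p y + r * l * (a y - b y)" if "y \<in> X" for y
        using mult_left_mono[OF bspec[OF *(4) that] r] by (simp add: scaleR_fun_def distrib_left mult.assoc)
      show "r * p x + 0 * p x + r * l * m \<le> r * t"
        using mult_left_mono[OF *(5) r] by (simp add: distrib_left mult.assoc)
    qed (use * r in auto)
  next
    fix v assume v: "v \<in> A\<^sub>c X"
    obtain c where c: "0 < c" "\<And>y. y \<in> X \<Longrightarrow> \<bar>v y\<bar> \<le> c" using Ac_bound[OF v] by blast
    show "\<exists>t. (v, t) \<in> C"
      by (intro exI[of _ c] CI[OF Ac_lincomb[OF Ac_one Ac_one, of c 0], of 0])
        (use c xX in \<open>auto simp: abs_le_iff\<close>)
  next
    fix t assume "(0, t) \<in> C"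
    then obtain p l where *: "p \<in> A\<^sub>c X" "0 \<le> l" "\<forall>y\<in>X. 0 \<le> p y" "\<forall>y\<in>X. 0 \<le> p y + l * (a y - b y)" "p x + l * m \<le> t"
      unfolding C_def by auto
    show "0 \<le> t"
    proof (cases "l = 0")
      case True then show ?thesis using *(3,5) xX by force
    next
      case False
      then have l: "0 < l" using *(2) by simp
      \<comment> \<open>The inequality \<open>0 \<le> p + l (a - b)\<close> says that
        \<open>b - p / l\<close> lies below \<open>a\<close>; it also lies below \<open>b\<close>,
        so \<open>nod\<close> applies to it.\<close>
      define d where "d = (\<lambda>y. 1 * b y + (- 1 / l) * p y)"
      have "d x < 1 - e"
      proof (rule nod)
        show "d \<in> A\<^sub>c X" unfolding d_def using b *(1) by (rule Ac_lincomb)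
        show "d y \<le> a y \<and> d y \<le> b y" if "y \<in> X" for y
          using bspec[OF *(3) that] bspec[OF *(4) that] l by (simp add: d_def field_simps)
      qed
      then have "b x - p x / l < 1 - e" by (simp add: d_def)
      then have "0 < p x / l + m" by (simp add: m_def)
      then have "0 < l * (p x / l + m)" using l by (rule mult_pos_pos[rotated])
      then have "0 < p x + l * m" using l by (simp add: distrib_left)
      then show ?thesis using *(5) by linarith
    qed
  qed blast
  have sl: "linear_functional_on (A\<^sub>c X) s" using s(1,2) by (simp add: linear_functional_on_def)
  have pos: "0 \<le> s v \<and> s v \<le> 1 * v x" if v: "v \<in> A\<^sub>c X" "\<And>y. y \<in> X \<Longrightarrow> 0 \<le> v y" for v
  proof
    have "(-1) *\<^sub>R v \<in> A\<^sub>c X" using subspace_Ac v(1) by (rule subspace_scale)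
    moreover have "((-1) *\<^sub>R v, 0) \<in> C"
      by (rule CI[OF A0, of 0]) (use v(2) in \<open>auto simp: scaleR_fun_def\<close>)
    ultimately have "s ((-1) *\<^sub>R v) \<le> 0" by (rule s(3))
    then show "0 \<le> s v" unfolding s(2)[OF v(1)] by simp
    have "(v, v x) \<in> C" by (rule CI[OF v(1), of 0]) (use v(2) in auto)
    then show "s v \<le> 1 * v x" using s(3)[OF v(1)] by simp
  qed
  define k where "k = s (indicat_real X)"
  have k: "0 \<le> k" "k \<le> 1" using pos[OF Ac_one] xX by (auto simp: k_def)
  have ev: "s v = k * v x" if "v \<in> A\<^sub>c X" for v
    unfolding k_def by (rule dominated_by_extreme_point[OF x sl pos that])
  have abA: "(\<lambda>y. 1 * a y + (-1) * b y) \<in> A\<^sub>c X" using a b by (rule Ac_lincomb)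
  moreover have "(\<lambda>y. 1 * a y + (-1) * b y, m) \<in> C"
    by (rule CI[OF A0, of 1]) auto
  ultimately have "s (\<lambda>y. 1 * a y + (-1) * b y) \<le> m" by (rule s(3))
  then have "k * (a x - b x) \<le> m" using ev[OF abA] by simp
  moreover have "k * 1 + (1 - k) * 1 \<le> k * a x + (1 - k) * b x"
    using k ab by (intro add_mono mult_left_mono) auto
  ultimately show False using e by (simp add: m_def algebra_simps)
qed

text \<open>A common minorant \<open>d\<close> that is nearly 1 at \<open>x\<close> exists by
  extremality, but it may be negative elsewhere. The simplex property inserts an affine function
  between the convex \<open>max d 0\<close> and the concave \<open>min a b\<close>, up to
  \<open>e/4\<close>: failure would produce, by duality, two measures that violate
  \<open>simplex_sandwich\<close>.\<close>

lemma simplex_meet: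
  assumes simplex: "choquet_simplex X" and x: "x \<in> extreme_points X" and a: "a \<in> A\<^sub>c X" and b: "b \<in> A\<^sub>c X"
    and nn: "\<And>y. y \<in> X \<Longrightarrow> 0 \<le> a y \<and> 0 \<le> b y" and ab: "1 \<le> a x" "1 \<le> b x" and e: "0 < e"
  shows "\<exists>c\<in>A\<^sub>c X. 1 \<le> c x \<and> (\<forall>y\<in>X. 0 \<le> c y \<and> c y \<le> a y + e \<and> c y \<le> b y + e)"
proof -
  have xX: "x \<in> X" using x by (rule ext_in)
  obtain d where d: "d \<in> A\<^sub>c X" "\<And>y. y \<in> X \<Longrightarrow> d y \<le> a y \<and> d y \<le> b y" "1 - e/2 \<le> d x"
    using affine_minorant_at_extreme_point[OF x a b ab, of "e/2"] e by auto
  define f where "f = (\<lambda>y. max (1 * d y + 0) (0 * d y + 0))"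
  define g where "g = (\<lambda>y. - max (-1 * a y + 0) (-1 * b y + 0))"
  have f: "f \<in> convex_continuous"
    unfolding f_def by (intro convex_continuous_max convex_continuous_affine d(1))
  have g: "(\<lambda>y. - g y) \<in> convex_continuous"
    unfolding g_def minus_minus by (intro convex_continuous_max convex_continuous_affine a b)
  have fg: "f y \<le> g y" if "y \<in> X" for y using d(2)[OF that] nn[OF that] by (auto simp: f_def g_def)
  have fc: "continuous_on X f" and gc: "continuous_on X g"
    using f g continuous_on_minus[of X "\<lambda>y. - g y"] by (auto simp: convex_continuous_def)
  have "\<exists>c\<in>A\<^sub>c X. \<forall>y\<in>X. f y \<le> c y + e/4 \<and> c y \<le> g y + e/4"
  proof (rule ccontr)
    assume no: "\<not> ?thesis"
    obtain \<sigma> \<tau> where st: "radon_prob X \<sigma>" "radon_prob X \<tau>" "\<And>a. a \<in> A\<^sub>c X \<Longrightarrow> integral\<^sup>L \<sigma> a = integral\<^sup>L \<tau> a"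
      "\<And>f' g'. (f', g') \<in> {(f, g)} \<Longrightarrow> 2 * (e/4) \<le> integral\<^sup>L \<sigma> f' - integral\<^sup>L \<tau> g'"
    proof (rule sandwich_duality[of "{(f, g)}" "e/4"])
      show "(\<lambda>x. (1 - t) * f1 x + t * f2 x, \<lambda>x. (1 - t) * g1 x + t * g2 x) \<in> {(f, g)}"
        if "(f1, g1) \<in> {(f, g)}" "(f2, g2) \<in> {(f, g)}" for f1 g1 f2 g2 t
        using that by (auto simp: algebra_simps)
      show False if "(f', g') \<in> {(f, g)}" "c \<in> A\<^sub>c X" "\<And>x. x \<in> X \<Longrightarrow> f' x \<le> c x + e/4 \<and> c x \<le> g' x + e/4" for f' g' c
        using no that by blast
    qed (use fc gc in auto)
    have "integral\<^sup>L \<sigma> f \<le> integral\<^sup>L \<tau> g"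
      by (rule simplex_sandwich[OF simplex st(1-3) f g fg])
    then show False using st(4)[of f g] e by simp
  qed
  then obtain c where c: "c \<in> A\<^sub>c X" "\<And>y. y \<in> X \<Longrightarrow> f y \<le> c y + e/4 \<and> c y \<le> g y + e/4" by blast
  show ?thesis
  proof (rule bexI)
    \<comment> \<open>The shift repays the loss at \<open>x\<close>, \<open>e/2\<close> from
      \<open>d\<close> and \<open>e/4\<close> from the insertion, and leaves an upper error of
      \<open>e/4 + 3/4 * e = e\<close>.\<close>
    show "(\<lambda>y. 1 * c y + (3/4 * e) * indicat_real X y) \<in> A\<^sub>c X" using c(1) Ac_one by (rule Ac_lincomb)
    show "1 \<le> 1 * c x + (3/4 * e) * indicat_real X x \<and>
      (\<forall>y\<in>X. 0 \<le> 1 * c y + (3/4 * e) * indicat_real X y \<and> 1 * c y + (3/4 * e) * indicat_real X y \<le> a y + e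
        \<and> 1 * c y + (3/4 * e) * indicat_real X y \<le> b y + e)"
    proof (intro conjI ballI)
      show "1 \<le> 1 * c x + (3/4 * e) * indicat_real X x"
        using c(2)[OF xX] d(3) xX by (simp add: f_def)
      fix y assume y: "y \<in> X"
      show "0 \<le> 1 * c y + (3/4 * e) * indicat_real X y" "1 * c y + (3/4 * e) * indicat_real X y \<le> a y + e"
        "1 * c y + (3/4 * e) * indicat_real X y \<le> b y + e"
        using c(2)[OF y] y e by (auto simp: f_def g_def)
    qed
  qed
qed

text \<open>On a simplex \<open>w\<close> plays the role of the (possibly non-Baire) function \<open>y \<mapsto> \<mu>\<^sub>y{x}\<close>: it is the limit of a
  sequence that descends below every function of \<open>V\<close>.\<close>

lemma simplex_peak:
  assumes simplex: "choquet_simplex X" and x: "x \<in> extreme_points X"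
    and V: "countable V" "V \<subseteq> A\<^sub>c X" "\<And>v y. v \<in> V \<Longrightarrow> y \<in> X \<Longrightarrow> 0 \<le> v y" "\<And>v. v \<in> V \<Longrightarrow> 0 < v x"
  obtains w where "w \<in> A\<^sub>1 X" "w x = 1" "\<And>y. y \<in> X \<Longrightarrow> 0 \<le> w y \<and> w y \<le> 1"
    "\<And>v y. v \<in> V \<Longrightarrow> y \<in> X \<Longrightarrow> w y * v x \<le> v y"
proof -
  have xX: "x \<in> X" using x by (rule ext_in)
  define V' where "V' = insert (indicat_real X) V"
  have V': "countable V'" "V' \<noteq> {}" "\<And>v. v \<in> V' \<Longrightarrow> v \<in> A\<^sub>c X" "\<And>v y. v \<in> V' \<Longrightarrow> y \<in> X \<Longrightarrow> 0 \<le> v y"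
    "\<And>v. v \<in> V' \<Longrightarrow> 0 < v x"
    using V xX Ac_one by (auto simp: V'_def)
  \<comment> \<open>Pairing makes every member of \<open>V'\<close> recur infinitely often, so each
    of them bounds the sequence at stages with arbitrarily small error.\<close>
  define v where "v n = from_nat_into V' (fst (prod_decode n))" for n
  have vV: "v n \<in> V'" for n unfolding v_def using V'(2) by (rule from_nat_into)
  have vinf: "\<exists>n\<ge>m. v n = u" if u: "u \<in> V'" for u m
  proof -
    obtain k where k: "from_nat_into V' k = u" using from_nat_into_surj[OF V'(1) u] by blast
    show ?thesis
      by (rule exI[of _ "prod_encode (k, m)"]) (use k in \<open>auto simp: v_def le_prod_encode_2\<close>)
  qed
  define a where "a n = (\<lambda>y. (1 / v n x) * v n y + 0 * v n y)" for n
  have aA: "a n \<in> A\<^sub>c X" for n unfolding a_def using V'(3)[OF vV] by (intro Ac_lincomb)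
  have a0: "0 \<le> a n y" if "y \<in> X" for n y
    using V'(4)[OF vV that] V'(5)[OF vV] by (auto simp: a_def intro!: divide_nonneg_pos)
  have a1: "a n x = 1" for n using V'(5)[OF vV, of n] by (simp add: a_def)
  have "\<exists>w. \<forall>n. (w n \<in> A\<^sub>c X \<and> 1 \<le> w n x \<and> (\<forall>y\<in>X. 0 \<le> w n y)) \<and>
    (\<forall>y\<in>X. w (Suc n) y \<le> w n y + (1/2)^n \<and> w (Suc n) y \<le> a n y + (1/2)^n)"
  proof (rule dependent_nat_choice)
    show "\<exists>w. w \<in> A\<^sub>c X \<and> 1 \<le> w x \<and> (\<forall>y\<in>X. 0 \<le> w y)"
      by (rule exI[of _ "indicat_real X"]) (use Ac_one xX in auto)
    fix w n assume w: "w \<in> A\<^sub>c X \<and> 1 \<le> w x \<and> (\<forall>y\<in>X. 0 \<le> w y)"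
    have "\<exists>c\<in>A\<^sub>c X. 1 \<le> c x \<and> (\<forall>y\<in>X. 0 \<le> c y \<and> c y \<le> w y + (1/2)^n \<and> c y \<le> a n y + (1/2)^n)"
      by (rule simplex_meet[OF simplex x]) (use w aA a0 a1 in auto)
    then show "\<exists>w'. (w' \<in> A\<^sub>c X \<and> 1 \<le> w' x \<and> (\<forall>y\<in>X. 0 \<le> w' y)) \<and>
      (\<forall>y\<in>X. w' y \<le> w y + (1/2)^n \<and> w' y \<le> a n y + (1/2)^n)" by blast
  qed
  then obtain w where w: "\<And>n. w n \<in> A\<^sub>c X" "\<And>n. 1 \<le> w n x" "\<And>n y. y \<in> X \<Longrightarrow> 0 \<le> w n y"
    "\<And>n y. y \<in> X \<Longrightarrow> w (Suc n) y \<le> w n y + (1/2)^n" "\<And>n y. y \<in> X \<Longrightarrow> w (Suc n) y \<le> a n y + (1/2)^n" by metis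
  \<comment> \<open>The added term is the sum of the remaining errors \<open>(1/2)^k\<close> for
    \<open>k \<ge> n\<close>; it makes an almost decreasing sequence decreasing.\<close>
  define W where "W n y = w n y + 2 * (1/2)^n" for n y
  have dec: "decseq (\<lambda>n. W n y)" if "y \<in> X" for y
  proof (rule decseq_SucI)
    show "W (Suc n) y \<le> W n y" for n using w(4)[OF that, of n] by (simp add: W_def)
  qed
  have half: "(\<lambda>n. (1/2::real)^n) \<longlonglongrightarrow> 0" by (rule LIMSEQ_realpow_zero) auto
  have "\<exists>L. (\<lambda>n. w n y) \<longlonglongrightarrow> L \<and> (\<forall>n. L \<le> W n y)" if y: "y \<in> X" for y
  proof -
    have W0: "0 \<le> W n y" for n using w(3)[OF y, of n] by (simp add: W_def)
    obtain L where L: "(\<lambda>n. W n y) \<longlonglongrightarrow> L" "\<And>n. L \<le> W n y"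
      using decseq_convergent[OF dec[OF y], of 0] W0 by blast
    have "(\<lambda>n. W n y - 2 * (1/2)^n) \<longlonglongrightarrow> L - 2 * 0" by (intro tendsto_intros L(1) half)
    then show ?thesis using L(2) by (auto simp: W_def)
  qed
  then obtain l where l: "\<And>y. y \<in> X \<Longrightarrow> (\<lambda>n. w n y) \<longlonglongrightarrow> l y" "\<And>n y. y \<in> X \<Longrightarrow> l y \<le> W n y" by metis
  define u where "u y = (if y \<in> X then l y else 0)" for y
  have ul: "(\<lambda>n. w n y) \<longlonglongrightarrow> u y" if "y \<in> X" for y using l(1)[OF that] that by (simp add: u_def)
  have "u \<in> affine_functions X" unfolding u_def
  proof (rule affine_restrict)
    fix y z t assume yz: "y \<in> X" "z \<in> X" and t: "t \<in> {0..(1::real)}"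
    have "(\<lambda>n. (1 - t) * w n y + t * w n z) \<longlonglongrightarrow> (1 - t) * l y + t * l z"
      by (intro tendsto_intros l yz)
    moreover have "(1 - t) * w n y + t * w n z = w n ((1 - t) *\<^sub>R y + t *\<^sub>R z)" for n
      using Ac_mix[OF w(1) yz] t by simp
    ultimately have "(\<lambda>n. w n ((1 - t) *\<^sub>R y + t *\<^sub>R z)) \<longlonglongrightarrow> (1 - t) * l y + t * l z" by simp
    moreover have "(\<lambda>n. w n ((1 - t) *\<^sub>R y + t *\<^sub>R z)) \<longlonglongrightarrow> l ((1 - t) *\<^sub>R y + t *\<^sub>R z)"
      using t by (intro l(1) mix yz) auto
    ultimately show "l ((1 - t) *\<^sub>R y + t *\<^sub>R z) = (1 - t) * l y + t * l z"
      by (rule LIMSEQ_unique[rotated])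
  qed
  then have uA: "u \<in> A\<^sub>1 X" unfolding A\<^sub>1_def using ul Ac_continuous[OF w(1)] by blast
  have ule: "u y \<le> v' y / v' x" if v': "v' \<in> V'" and y: "y \<in> X" for v' y
  proof (rule field_le_epsilon)
    fix e :: real assume "0 < e"
    then obtain m where m: "(1/2::real)^m < e / 2" using real_arch_pow_inv[of "e/2" "1/2"] by auto
    obtain n where n: "m \<le> n" "v n = v'" using vinf[OF v'] by blast
    have "u y \<le> W (Suc n) y" using l(2)[OF y] y by (simp add: u_def)
    also have "\<dots> \<le> a n y + 2 * (1/2)^n" using w(5)[OF y, of n] by (simp add: W_def)
    also have "(1/2::real)^n \<le> (1/2)^m" using n(1) by (intro power_decreasing) auto
    finally show "u y \<le> v' y / v' x + e" using m n(2) by (simp add: a_def)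
  qed
  show thesis
  proof (rule that[OF uA])
    show le1: "0 \<le> u y \<and> u y \<le> 1" if y: "y \<in> X" for y
      using LIMSEQ_le_const[OF ul[OF y], of 0] w(3)[OF y] ule[of "indicat_real X" y] y xX by (auto simp: V'_def)
    have "1 \<le> u x" using LIMSEQ_le_const[OF ul[OF xX], of 1] w(2) by blast
    then show "u x = 1" using le1[OF xX] by simp
    show "u y * v' x \<le> v' y" if "v' \<in> V" "y \<in> X" for v' y
      using ule[of v' y] V'(5)[of v'] that by (simp add: V'_def field_simps)
  qed
qed

text \<open>These form a countable, uniformly dense part of the span of \<open>D\<close>;
  \<open>simplex_peak\<close> handles countably many functions.\<close>

fun rational_combination :: "(rat \<times> ('a \<Rightarrow> real)) list \<Rightarrow> 'a \<Rightarrow> real" where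
  "rational_combination [] = (\<lambda>_. 0)"
| "rational_combination ((q, h) # xs) = (\<lambda>y. of_rat q * h y + rational_combination xs y)"

lemma countable_rational_combinations: "countable D \<Longrightarrow> countable (rational_combination ` lists (UNIV \<times> D))"
  by (intro countable_image countable_lists countable_SIGMA) auto

lemma rational_combination_approx:
  assumes D: "D \<subseteq> A\<^sub>c X" and v: "v \<in> span D" and e: "0 < e"
  shows "\<exists>r\<in>rational_combination ` lists (UNIV \<times> D). r \<in> A\<^sub>c X \<and> (\<forall>y\<in>X. \<bar>v y - r y\<bar> < e)"
  using v e
proof (induction arbitrary: e rule: span_induct_alt)
  case base
  show ?case
  proof (intro bexI[of _ "rational_combination []"] conjI ballI)
    show "rational_combination [] \<in> A\<^sub>c X" using subspace_0[OF subspace_Ac] by (simp add: zero_fun_def)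
    show "rational_combination [] \<in> rational_combination ` lists (UNIV \<times> D)" by (rule imageI) simp
    show "\<bar>0 y - rational_combination [] y\<bar> < e" for y :: 'a using base by simp
  qed
next
  case (step c h u)
  have "0 < e / 2" using step.prems by simp
  from step.IH[OF this] obtain r where r0: "r \<in> rational_combination ` lists (UNIV \<times> D)" "r \<in> A\<^sub>c X"
    "\<forall>y\<in>X. \<bar>u y - r y\<bar> < e / 2" by blast
  obtain xs where xs: "r = rational_combination xs" "xs \<in> lists (UNIV \<times> D)" using r0(1) by (rule imageE)
  have r: "r = rational_combination xs" "xs \<in> lists (UNIV \<times> D)" "r \<in> A\<^sub>c X" "\<And>y. y \<in> X \<Longrightarrow> \<bar>u y - r y\<bar> < e / 2"
    using r0 xs by blast+
  have hA: "h \<in> A\<^sub>c X" using step.hyps(1) D by blast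
  obtain C where C: "0 < C" "\<And>y. y \<in> X \<Longrightarrow> \<bar>h y\<bar> \<le> C" using Ac_bound[OF hA] by blast
  have "c < c + e / (2 * C)" using step.prems C(1) by simp
  then obtain q where q: "c < real_of_rat q" "real_of_rat q < c + e / (2 * C)" using of_rat_dense by blast
  have qd: "\<bar>c - of_rat q\<bar> \<le> e / (2 * C)" using q by linarith
  show ?case
  proof (intro bexI conjI ballI)
    show "rational_combination ((q, h) # xs) \<in> rational_combination ` lists (UNIV \<times> D)"
      using r(2) step.hyps(1) by (intro imageI) auto
    show "rational_combination ((q, h) # xs) \<in> A\<^sub>c X" using Ac_lincomb[OF hA r(3), of "of_rat q" 1] r(1) by simp
    fix y assume y: "y \<in> X"
    have "\<bar>(c - of_rat q) * h y\<bar> \<le> e / (2 * C) * C"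
      unfolding abs_mult using qd C(2)[OF y] C(1) step.prems by (intro mult_mono) auto
    also have "\<dots> = e / 2" using C(1) by simp
    finally have "\<bar>c * h y - of_rat q * h y\<bar> \<le> e / 2" by (simp add: left_diff_distrib)
    moreover have "(c *\<^sub>R h + u) y - rational_combination ((q, h) # xs) y
        = (c * h y - of_rat q * h y) + (u y - r y)"
      using r(1) by (simp add: scaleR_fun_def)
    ultimately show "\<bar>(c *\<^sub>R h + u) y - rational_combination ((q, h) # xs) y\<bar> < e"
      using r(4)[OF y] by linarith
  qed
qed

text \<open>If \<open>w\<close> is as in \<open>simplex_peak\<close> for the rational combinations of \<open>D\<close>, then \<open>\<delta>\<^sub>y - w(y) \<delta>\<^sub>x\<close> is a positive functional on the
  span of \<open>D\<close>, so up to \<open>D\<close>-equivalence \<open>y = w(y) x + (1 - w(y)) z\<close>. This gives \<open>\<bar>b\<bar> \<le> C (1 - w)\<close> whenever \<open>b\<close> is affine,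
  depends on \<open>D\<close> only and \<open>b x = 0\<close>.\<close>

lemma simplex_dominated_functional:
  assumes simplex: "choquet_simplex X" and H: "subspace H" "A\<^sub>1 X \<subseteq> H" "H \<subseteq> sigma_closure (A\<^sub>c X)" "H \<subseteq> A\<^sub>b X"
    and x: "x \<in> extreme_points X" and s: "linear_functional_on H s"
    and pos: "\<And>a. a \<in> H \<Longrightarrow> (\<And>y. y \<in> X \<Longrightarrow> 0 \<le> a y) \<Longrightarrow> 0 \<le> s a \<and> s a \<le> L * a x"
    and a: "a \<in> H"
  shows "s a = s (indicat_real X) * a x"
proof -
  have xX: "x \<in> X" using x by (rule ext_in)
  have AcA1: "A\<^sub>c X \<subseteq> A\<^sub>1 X" unfolding A\<^sub>c_def A\<^sub>1_def by (auto intro!: exI[of _ "\<lambda>_. _"])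
  have oneH: "indicat_real X \<in> H" using Ac_one AcA1 H(2) by blast
  have Hlc: "p *\<^sub>R u + q *\<^sub>R v \<in> H" if "u \<in> H" "v \<in> H" for u v p q
    using that H(1) by (intro subspace_add subspace_scale)
  have slc: "s (p *\<^sub>R u + q *\<^sub>R v) = p * s u + q * s v" if "u \<in> H" "v \<in> H" for u v p q
    using s that subspace_scale[OF H(1)] unfolding linear_functional_on_def by simp
  \<comment> \<open>Subtracting the value at \<open>x\<close> reduces the claim to functions that
    vanish at \<open>x\<close>.\<close>
  define b where "b = 1 *\<^sub>R a + (- a x) *\<^sub>R indicat_real X"
  have bH: "b \<in> H" unfolding b_def using a oneH by (rule Hlc)
  have bx: "b x = 0" using xX by (simp add: b_def scaleR_fun_def)
  have baff: "b ((1 - t) *\<^sub>R y + t *\<^sub>R z) = (1 - t) * b y + t * b z" if "y \<in> X" "z \<in> X" "0 \<le> t" "t \<le> 1" for y z t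
    using bH H(4) that unfolding A\<^sub>b_def affine_functions_def by auto
  have "bounded (b ` X)" using bH H(4) by (auto simp: A\<^sub>b_def)
  then obtain C where C: "0 < C" "\<And>y. y \<in> X \<Longrightarrow> \<bar>b y\<bar> \<le> C" unfolding bounded_pos by auto
  obtain D0 where D0: "countable D0" "D0 \<subseteq> A\<^sub>c X" "b \<in> sigma_closure D0"
    using sigma_closure_countable[of b "A\<^sub>c X"] bH H(3) by blast
  define D where "D = insert (indicat_real X) D0"
  have D: "countable D" "D \<subseteq> A\<^sub>c X" "b \<in> sigma_closure D" "indicat_real X \<in> D"
    using D0(1,2) Ac_one sigma_closure_mono[OF D0(3), of D] by (auto simp: D_def)
  define E where "E = span D"
  have E: "subspace E" "E \<subseteq> A\<^sub>c X" "indicat_real X \<in> E"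
    using span_Ac[OF D(2)] span_base[OF D(4)] by (auto simp: E_def)
  define V where "V = {r \<in> rational_combination ` lists (UNIV \<times> D). r \<in> A\<^sub>c X \<and> (\<forall>y\<in>X. 0 \<le> r y) \<and> 0 < r x}"
  obtain w where w: "w \<in> A\<^sub>1 X" "w x = 1" "\<And>y. y \<in> X \<Longrightarrow> 0 \<le> w y \<and> w y \<le> 1"
    "\<And>v y. v \<in> V \<Longrightarrow> y \<in> X \<Longrightarrow> w y * v x \<le> v y"
  proof (rule simplex_peak[OF simplex x, of V])
    show "countable V" unfolding V_def
      by (rule countable_subset[OF _ countable_rational_combinations[OF D(1)]]) auto
  qed (auto simp: V_def)
  have wE: "w y * v x \<le> v y" if v: "v \<in> E" "\<And>y. y \<in> X \<Longrightarrow> 0 \<le> v y" and y: "y \<in> X" for v y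
  proof (rule field_le_epsilon)
    fix e :: real assume e: "0 < e"
    \<comment> \<open>Raised by \<open>e/2\<close> first, so that the approximating rational
      combination stays above \<open>v\<close> and is thus nonnegative, and positive at
      \<open>x\<close>, as membership in \<open>V\<close> requires.\<close>
    define v' where "v' = 1 *\<^sub>R v + (e/2) *\<^sub>R indicat_real X"
    have "v' \<in> span D" unfolding v'_def using v(1) E unfolding E_def by (intro subspace_add subspace_scale) auto
    then obtain r where r: "r \<in> rational_combination ` lists (UNIV \<times> D)" "r \<in> A\<^sub>c X" "\<And>y. y \<in> X \<Longrightarrow> \<bar>v' y - r y\<bar> < e / 2"
      using rational_combination_approx[OF D(2), of v' "e/2"] e by auto
    have bnd: "v y < r y" "r y < v y + e" if "y \<in> X" for y
    proof -
      have "v' y = v y + e / 2" using that by (simp add: v'_def scaleR_fun_def)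
      then show "v y < r y" "r y < v y + e" using r(3)[OF that] by linarith+
    qed
    have "r \<in> V" unfolding V_def using r(1,2) bnd(1) v(2) xX by (auto intro: less_imp_le order_le_less_trans)
    then have "w y * r x \<le> r y" using y by (rule w(4))
    moreover have "w y * v x \<le> w y * r x" using bnd(1)[OF xX] w(3)[OF y] by (intro mult_left_mono) auto
    ultimately show "w y * v x \<le> v y + e" using bnd(2)[OF y] by linarith
  qed
  have bound: "\<bar>b y\<bar> \<le> C * (1 - w y)" if y: "y \<in> X" for y
  proof -
    define t where "t = w y"
    have t: "0 \<le> t" "t \<le> 1" using w(3)[OF y] by (auto simp: t_def)
    have "\<exists>z\<in>X. \<forall>h\<in>D. h y = (1 - t) * h z + t * h x"
    proof (cases "t = 1")
      case True
      \<comment> \<open>Division by \<open>1 - t\<close> is impossible here; \<open>wE\<close> for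
        \<open>c + h\<close> and \<open>c - h\<close>, both nonnegative, squeezes \<open>h y\<close>
        to \<open>h x\<close>.\<close>
      have "h y = h x" if h: "h \<in> D" for h
      proof -
        have hE: "h \<in> E" using h span_base by (auto simp: E_def)
        obtain c where c: "\<And>y. y \<in> X \<Longrightarrow> \<bar>h y\<bar> \<le> c" using Ac_bound D(2) h by blast
        have m: "c *\<^sub>R indicat_real X + r *\<^sub>R h \<in> E" for r using E(1,3) hE by (intro subspace_add subspace_scale)
        have nn: "0 \<le> (c *\<^sub>R indicat_real X + r *\<^sub>R h) y" if "r = 1 \<or> r = -1" "y \<in> X" for r y
          using c[OF that(2)] that by (auto simp: scaleR_fun_def abs_le_iff)
        have "w y * (c *\<^sub>R indicat_real X + 1 *\<^sub>R h) x \<le> (c *\<^sub>R indicat_real X + 1 *\<^sub>R h) y"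
          "w y * (c *\<^sub>R indicat_real X + (-1) *\<^sub>R h) x \<le> (c *\<^sub>R indicat_real X + (-1) *\<^sub>R h) y"
          by (rule wE[OF m nn y]; simp)+
        then show ?thesis using True xX y by (simp add: t_def scaleR_fun_def)
      qed
      then show ?thesis using xX True by (intro bexI[of _ x]) auto
    next
      case False
      then have t1: "t < 1" using t by simp
      have "linear_functional_on E (\<lambda>v. (v y - t * v x) / (1 - t))"
        unfolding linear_functional_on_def
        by (simp add: scaleR_fun_def add_divide_distrib diff_divide_distrib algebra_simps)
      then obtain z where z: "z \<in> X" "\<And>v. v \<in> E \<Longrightarrow> (v y - t * v x) / (1 - t) = v z"
      proof (rule functional_is_evaluation[OF compact convex nonempty order_refl E(1,2)])
        fix v c assume v: "v \<in> E" "\<And>x. x \<in> X \<Longrightarrow> v x \<le> c"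
        have "c *\<^sub>R indicat_real X + (-1) *\<^sub>R v \<in> E" using E(1,3) v(1) by (intro subspace_add subspace_scale)
        then have "w y * (c *\<^sub>R indicat_real X + (-1) *\<^sub>R v) x \<le> (c *\<^sub>R indicat_real X + (-1) *\<^sub>R v) y"
          by (rule wE) (use v(2) y in \<open>auto simp: scaleR_fun_def\<close>)
        then have "t * (c - v x) \<le> c - v y" using xX y by (simp add: t_def scaleR_fun_def)
        then show "(v y - t * v x) / (1 - t) \<le> c" using t1 by (simp add: field_simps)
      qed blast
      show ?thesis
      proof (intro bexI[of _ z] ballI)
        fix h assume "h \<in> D"
        then have "(h y - t * h x) / (1 - t) = h z" using z(2) span_base by (auto simp: E_def)
        then show "h y = (1 - t) * h z + t * h x" using t1 by (simp add: field_simps)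
      qed (rule z(1))
    qed
    then obtain z where z: "z \<in> X" "\<And>h. h \<in> D \<Longrightarrow> h y = (1 - t) * h z + t * h x" by blast
    have "b y = b ((1 - t) *\<^sub>R z + t *\<^sub>R x)"
    proof (rule sigma_closure_determined[OF D(3)])
      fix h assume h: "h \<in> D"
      have "h ((1 - t) *\<^sub>R z + t *\<^sub>R x) = (1 - t) * h z + t * h x"
        using D(2) h by (intro Ac_mix z xX t) auto
      then show "h y = h ((1 - t) *\<^sub>R z + t *\<^sub>R x)" using z(2)[OF h] by linarith
    qed
    also have "\<dots> = (1 - t) * b z" using baff[OF z(1) xX t] bx by simp
    finally have "\<bar>b y\<bar> = (1 - t) * \<bar>b z\<bar>" using t by (simp add: abs_mult)
    also have "\<dots> \<le> (1 - t) * C" using C(2)[OF z(1)] t by (intro mult_left_mono) auto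
    finally show ?thesis by (simp add: t_def mult.commute)
  qed
  have wH: "w \<in> H" using w(1) H(2) by blast
  \<comment> \<open>This is \<open>C (1 - w)\<close> on \<open>X\<close>, a member of
    \<open>H\<close> through \<open>A\<^sub>1 X \<subseteq> H\<close>. It dominates both
    \<open>b\<close> and \<open>- b\<close> and vanishes at \<open>x\<close>, so
    \<open>0 \<le> s g \<le> L * g x = 0\<close> forces \<open>s b = 0\<close>.\<close>
  define g where "g = C *\<^sub>R indicat_real X + (- C) *\<^sub>R w"
  have gH: "g \<in> H" unfolding g_def using oneH wH by (rule Hlc)
  have gy: "g y = C * (1 - w y)" if "y \<in> X" for y using that by (simp add: g_def scaleR_fun_def algebra_simps)
  have "0 \<le> s g \<and> s g \<le> L * g x"
    using w(3) C(1) gy by (intro pos[OF gH]) (auto intro!: mult_nonneg_nonneg)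
  then have sg: "s g = 0" using gy[OF xX] w(2) by simp
  have "0 \<le> 1 * s g + r * s b" if "r = 1 \<or> r = -1" for r
  proof -
    have "0 \<le> (1 *\<^sub>R g + r *\<^sub>R b) y" if "y \<in> X" for y
      using bound[OF that] gy[OF that] \<open>r = 1 \<or> r = -1\<close> by (auto simp: scaleR_fun_def abs_le_iff)
    then have "0 \<le> s (1 *\<^sub>R g + r *\<^sub>R b)" using pos[OF Hlc[OF gH bH]] by blast
    then show ?thesis unfolding slc[OF gH bH] .
  qed
  from this[of 1] this[of "-1"] have "s b = 0" using sg by simp
  moreover have "s b = 1 * s a + (- a x) * s (indicat_real X)" unfolding b_def using a oneH by (rule slc)
  ultimately show ?thesis by simp
qed

end

section \<open>Center and multipliers\<close>

lemma scaleR_fun_apply: "(r *\<^sub>R f) x = r *\<^sub>R f x"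
  by (simp add: scaleR_fun_def)

lemma linear_functional_lincomb:
  assumes "linear_functional_on E s" "subspace E" "u \<in> E" "v \<in> E"
  shows "s (p *\<^sub>R u + q *\<^sub>R v) = p * s u + q * s v"
  using assms(1,3,4) subspace_scale[OF assms(2)] unfolding linear_functional_on_def by simp

context compact_convex
begin

lemma Ab_bounded: "f \<in> A\<^sub>b X \<Longrightarrow> \<exists>C>0. \<forall>x\<in>X. \<bar>f x\<bar> \<le> C"
  unfolding A\<^sub>b_def by (auto simp: bounded_pos)

lemma Ab_outside: "f \<in> A\<^sub>b X \<Longrightarrow> x \<notin> X \<Longrightarrow> f x = 0"
  by (simp add: A\<^sub>b_def affine_functions_def functions_on_def)

lemma sup_norm_upper:
  assumes "f \<in> A\<^sub>b X" "x \<in> X"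
  shows "\<bar>f x\<bar> \<le> sup_norm X f"
  unfolding sup_norm_def
proof (rule cSUP_upper[OF assms(2)])
  show "bdd_above ((\<lambda>x. \<bar>f x\<bar>) ` X)" using Ab_bounded[OF assms(1)] by (auto intro: bdd_aboveI2)
qed

lemma sup_norm_le: "(\<And>x. x \<in> X \<Longrightarrow> \<bar>f x\<bar> \<le> C) \<Longrightarrow> sup_norm X f \<le> C"
  unfolding sup_norm_def using nonempty by (rule cSUP_least)

lemma Ac_subset_A1: "A\<^sub>c X \<subseteq> A\<^sub>1 X"
  unfolding A\<^sub>c_def A\<^sub>1_def by (auto intro!: exI[of _ "\<lambda>_. _"])

context
  fixes H assumes H: "intermediate_function_space X H"
begin

lemma H_subspace: "subspace H" and H_one: "indicat_real X \<in> H" and H_Ab: "H \<subseteq> A\<^sub>b X"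
  using H Ac_one by (auto simp: intermediate_function_space_def)

lemma H_lincomb: "u \<in> H \<Longrightarrow> v \<in> H \<Longrightarrow> p *\<^sub>R u + q *\<^sub>R v \<in> H"
  using H_subspace by (intro subspace_add subspace_scale)

lemma nonneg_pointwise: "a \<in> H \<Longrightarrow> (\<And>x. x \<in> X \<Longrightarrow> 0 \<le> a x) \<Longrightarrow> 0 \<le> a"
  unfolding le_fun_def using Ab_outside H_Ab by (metis subsetD order_refl zero_fun_def)

lemma operator_functional:
  assumes T: "T \<in> order_bounded_operators X H" and x: "x \<in> X"
  obtains l where "linear_functional_on H (\<lambda>a. T a x + l * a x)"
    "\<And>a. a \<in> H \<Longrightarrow> (\<And>y. y \<in> X \<Longrightarrow> 0 \<le> a y) \<Longrightarrow> 0 \<le> T a x + l * a x \<and> T a x + l * a x \<le> 2 * l * a x"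
proof -
  obtain l where l: "0 \<le> l" "\<And>a. a \<in> H \<Longrightarrow> 0 \<le> a \<Longrightarrow> - (l *\<^sub>R a) \<le> T a \<and> T a \<le> l *\<^sub>R a"
    and Tl: "T \<in> linear_maps_on H" using T unfolding order_bounded_operators_def by blast
  show thesis
  proof (rule that[of l])
    show "linear_functional_on H (\<lambda>a. T a x + l * a x)"
      using Tl unfolding linear_functional_on_def linear_maps_on_def
      by (simp add: scaleR_fun_def distrib_left)
    fix a assume a: "a \<in> H" "\<And>y. y \<in> X \<Longrightarrow> 0 \<le> a y"
    have "0 \<le> a" using a by (rule nonneg_pointwise)
    then have "- (l *\<^sub>R a) \<le> T a \<and> T a \<le> l *\<^sub>R a" using l(2) a(1) by blast
    then have "- (l * a x) \<le> T a x \<and> T a x \<le> l * a x" by (auto simp: le_fun_def scaleR_fun_def)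
    then show "0 \<le> T a x + l * a x \<and> T a x + l * a x \<le> 2 * l * a x" by auto
  qed
qed

text \<open>The hypothesis \<open>ZM\<close> contains the inclusion of the center in the
  multipliers. Conversely a multiplier \<open>u\<close> has to define an operator: by the minimum
  principle the product \<open>b\<close> is determined by its values on \<open>ext X\<close>, so the
  map from \<open>a\<close> to \<open>b\<close> is linear, and inequalities on \<open>ext X\<close>
  between \<open>T a\<close> and multiples of \<open>a\<close> or of the constant spread to
  \<open>X\<close>.\<close>

lemma center_eq_multipliers:
  assumes sigma: "H \<subseteq> sigma_closure (A\<^sub>c X)"
    and ZM: "\<And>T a. T \<in> order_bounded_operators X H \<Longrightarrow> a \<in> H \<Longrightarrow>
      \<exists>b\<in>H. \<forall>x\<in>extreme_points X. b x = T (indicat_real X) x * a x"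
  shows "center X H = multipliers X H"
proof
  show "center X H \<subseteq> multipliers X H"
  proof
    fix u assume "u \<in> center X H"
    then obtain T where T: "u = T (indicat_real X)" "T \<in> order_bounded_operators X H"
      unfolding center_def by blast
    have "u \<in> H" using T H_one unfolding order_bounded_operators_def by blast
    then show "u \<in> multipliers X H" unfolding multipliers_def using ZM[OF T(2)] T(1) by blast
  qed
next
  have nn: "0 \<le> b x" if b: "b \<in> H" "\<And>e. e \<in> extreme_points X \<Longrightarrow> 0 \<le> b e" for b x
  proof (cases "x \<in> X")
    case True
    show ?thesis by (rule minimum_principle[OF _ b(2) True]) (use b(1) sigma in auto)
  next
    case False then show ?thesis using Ab_outside[of b x] H_Ab b(1) by auto
  qed
  have mono: "b x \<le> c x" if b: "b \<in> H" "c \<in> H" "\<And>e. e \<in> extreme_points X \<Longrightarrow> b e \<le> c e" for b c x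
  proof -
    have "0 \<le> (c - b) x"
    proof (rule nn[OF subspace_diff[OF H_subspace b(2,1)]])
      fix e assume "e \<in> extreme_points X"
      then show "0 \<le> (c - b) e" using b(3)[of e] by simp
    qed
    then show ?thesis by simp
  qed
  have uniq: "b = c" if "b \<in> H" "c \<in> H" "\<And>e. e \<in> extreme_points X \<Longrightarrow> b e = c e" for b c
  proof
    fix x
    have "b x \<le> c x" by (rule mono[OF that(1,2)]) (simp add: that(3))
    moreover have "c x \<le> b x" by (rule mono[OF that(2,1)]) (simp add: that(3))
    ultimately show "b x = c x" by (rule antisym)
  qed
  show "multipliers X H \<subseteq> center X H"
  proof
    fix u assume "u \<in> multipliers X H"
    then have uH: "u \<in> H" and u: "\<forall>a\<in>H. \<exists>b\<in>H. \<forall>x\<in>extreme_points X. b x = u x * a x"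
      unfolding multipliers_def by auto
    obtain U where U: "0 < U" "\<And>x. x \<in> X \<Longrightarrow> \<bar>u x\<bar> \<le> U" using Ab_bounded uH H_Ab by blast
    obtain T0 where T0: "\<And>a. a \<in> H \<Longrightarrow> T0 a \<in> H \<and> (\<forall>x\<in>extreme_points X. T0 a x = u x * a x)"
      using u by metis
    define T where "T a = (if a \<in> H then T0 a else 0)" for a
    have TH: "T a \<in> H" and Te: "\<And>x. x \<in> extreme_points X \<Longrightarrow> T a x = u x * a x" if "a \<in> H" for a
      using T0[OF that] that by (auto simp: T_def)
    have bnd: "\<bar>T a x\<bar> \<le> U * N" if a: "a \<in> H" and N: "\<And>e. e \<in> extreme_points X \<Longrightarrow> \<bar>a e\<bar> \<le> N" and x: "x \<in> X" for a N x
    proof -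
      have uN: "(U * N) *\<^sub>R indicat_real X \<in> H" "(- (U * N)) *\<^sub>R indicat_real X \<in> H"
        using H_one H_subspace subspace_scale by blast+
      have ext: "\<bar>T a e\<bar> \<le> U * N" if e: "e \<in> extreme_points X" for e
        unfolding Te[OF a e] abs_mult using U(2)[OF ext_in[OF e]] N[OF e] U(1) by (intro mult_mono) auto
      have "T a x \<le> ((U * N) *\<^sub>R indicat_real X) x"
        by (rule mono[OF TH[OF a] uN(1)]) (use ext ext_in in \<open>force simp: scaleR_fun_def\<close>)
      moreover have "((- (U * N)) *\<^sub>R indicat_real X) x \<le> T a x"
        by (rule mono[OF uN(2) TH[OF a]]) (use ext ext_in in \<open>force simp: scaleR_fun_def\<close>)
      ultimately show ?thesis using x by (simp add: scaleR_fun_def abs_le_iff)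
    qed
    have "T \<in> order_bounded_operators X H"
      unfolding order_bounded_operators_def linear_maps_on_def
    proof (intro CollectI conjI ballI allI impI)
      fix a c assume "a \<in> H" "c \<in> H"
      then show "T (a + c) = T a + T c"
        using H_subspace Te TH by (intro uniq) (auto simp: subspace_add distrib_left)
    next
      fix r a assume "a \<in> H"
      then show "T (r *\<^sub>R a) = r *\<^sub>R T a"
        using H_subspace Te TH by (intro uniq) (auto simp: subspace_scale scaleR_fun_apply)
    next
      show "T a = 0" if "a \<notin> H" for a using that by (simp add: T_def)
      show "T a \<in> H" if "a \<in> H" for a using TH that .
      show "\<exists>C. \<forall>a\<in>H. sup_norm X (T a) \<le> C * sup_norm X a"
      proof (intro exI[of _ U] ballI sup_norm_le)
        fix a x assume a: "a \<in> H" and x: "x \<in> X"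
        show "\<bar>T a x\<bar> \<le> U * sup_norm X a"
          using a H_Ab ext_in by (intro bnd[OF a _ x] sup_norm_upper) auto
      qed
      show "\<exists>l\<ge>0. \<forall>a\<in>H. 0 \<le> a \<longrightarrow> - (l *\<^sub>R a) \<le> T a \<and> T a \<le> l *\<^sub>R a"
      proof (intro exI[of _ U] conjI ballI impI)
        show "0 \<le> U" using U(1) by simp
        fix a assume a: "a \<in> H" and "0 \<le> a"
        then have a0: "0 \<le> a x" for x by (simp add: le_fun_def)
        have UaH: "U *\<^sub>R a \<in> H" "(- U) *\<^sub>R a \<in> H" using a H_subspace subspace_scale by blast+
        have ub: "\<bar>T a e\<bar> \<le> U * a e" if e: "e \<in> extreme_points X" for e
          unfolding Te[OF a e] abs_mult using U(2)[OF ext_in[OF e]] a0[of e] by (simp add: mult_right_mono)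
        have "T a e \<le> (U *\<^sub>R a) e" "((- U) *\<^sub>R a) e \<le> T a e" if "e \<in> extreme_points X" for e
          using ub[OF that] by (simp_all add: scaleR_fun_apply abs_le_iff)
        then have "T a x \<le> (U *\<^sub>R a) x" and *: "((- U) *\<^sub>R a) x \<le> T a x" for x
          using mono[OF TH[OF a] UaH(1)] mono[OF UaH(2) TH[OF a]] by blast+
        then show "T a \<le> U *\<^sub>R a" by (simp add: le_fun_def)
        have "((- U) *\<^sub>R a) x \<le> T a x" for x by (rule *)
        then show "- (U *\<^sub>R a) \<le> T a" by (simp add: le_fun_def scaleR_fun_apply)
      qed
    qed
    moreover have "T (indicat_real X) = u"
      using H_one uH TH Te ext_in by (intro uniq) auto
    ultimately show "u \<in> center X H" unfolding center_def by blast
  qed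
qed

section \<open>States and extreme evaluations\<close>

lemma state_bound:
  assumes \<phi>: "\<phi> \<in> state_space X H" and a: "a \<in> H" "sup_norm X a \<le> 1"
  shows "\<bar>\<phi> a\<bar> \<le> 1"
proof -
  obtain C where C: "\<And>a. a \<in> H \<Longrightarrow> \<bar>\<phi> a\<bar> \<le> C * sup_norm X a"
    using \<phi> unfolding state_space_def dual_space_def by blast
  have sn: "0 \<le> sup_norm X a" if "a \<in> H" for a
    using sup_norm_upper[of a] nonempty H_Ab that by (meson abs_ge_zero ex_in_conv order_trans subsetD)
  \<comment> \<open>\<open>dual_norm\<close> is a real supremum and informative only for a bounded
    set; the bound comes from the continuity of \<open>\<phi>\<close>.\<close>
  have "bdd_above ((\<lambda>a. \<bar>\<phi> a\<bar>) ` {a \<in> H. sup_norm X a \<le> 1})"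
  proof (rule bdd_aboveI2)
    fix a assume "a \<in> {a \<in> H. sup_norm X a \<le> 1}"
    then have "\<bar>\<phi> a\<bar> \<le> C * sup_norm X a" "0 \<le> sup_norm X a" "sup_norm X a \<le> 1" using C sn by auto
    moreover have "C * sup_norm X a \<le> \<bar>C\<bar> * 1"
      using calculation by (intro mult_mono) auto
    ultimately show "\<bar>\<phi> a\<bar> \<le> \<bar>C\<bar> * 1" by linarith
  qed
  then have "\<bar>\<phi> a\<bar> \<le> dual_norm X H \<phi>" unfolding dual_norm_def
    using a by (intro cSUP_upper) auto
  then show ?thesis using \<phi> by (simp add: state_space_def)
qed

lemma state_linear: "\<phi> \<in> state_space X H \<Longrightarrow> linear_functional_on H \<phi>"
  by (simp add: state_space_def dual_space_def linear_maps_on_def linear_functional_on_def)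

text \<open>Norm at most 1 together with value 1 at the constant forces positivity:
  \<open>1 - a / N\<close> has values in the unit interval, so its image is at most 1.\<close>

lemma state_nonneg:
  assumes \<phi>: "\<phi> \<in> state_space X H" and a: "a \<in> H" "\<And>x. x \<in> X \<Longrightarrow> 0 \<le> a x"
  shows "0 \<le> \<phi> a"
proof -
  obtain N where N: "0 < N" "\<And>x. x \<in> X \<Longrightarrow> \<bar>a x\<bar> \<le> N" using Ab_bounded a(1) H_Ab by blast
  define b where "b = 1 *\<^sub>R indicat_real X + (- (1/N)) *\<^sub>R a"
  have bH: "b \<in> H" unfolding b_def using H_one a(1) by (rule H_lincomb)
  have "\<bar>b x\<bar> \<le> 1" if x: "x \<in> X" for x
  proof -
    have "0 \<le> a x / N" "a x / N \<le> 1" using a(2)[OF x] N(1) N(2)[OF x] by auto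
    then show ?thesis using x by (simp add: b_def scaleR_fun_def)
  qed
  then have "\<bar>\<phi> b\<bar> \<le> 1" using state_bound[OF \<phi> bH] sup_norm_le by blast
  moreover have "\<phi> b = 1 * \<phi> (indicat_real X) + (- (1/N)) * \<phi> a"
    unfolding b_def using state_linear[OF \<phi>] H_subspace H_one a(1) by (rule linear_functional_lincomb)
  moreover have "\<phi> (indicat_real X) = 1" using \<phi> by (simp add: state_space_def)
  ultimately have "0 \<le> \<phi> a / N" by simp
  then show ?thesis using N(1) by (simp add: zero_le_divide_iff)
qed

lemma evaluation_state:
  assumes x: "x \<in> X"
  shows "evaluation H x \<in> state_space X H"
  unfolding state_space_def dual_space_def linear_maps_on_def
proof (intro CollectI conjI ballI allI impI)
  show "\<exists>C. \<forall>a\<in>H. \<bar>evaluation H x a\<bar> \<le> C * sup_norm X a"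
    by (rule exI[of _ 1]) (use sup_norm_upper[OF _ x] H_Ab in \<open>auto simp: evaluation_def\<close>)
  have "0 \<in> {a \<in> H. sup_norm X a \<le> 1}"
    using subspace_0[OF H_subspace] sup_norm_le[of 0 1] by simp
  then show "dual_norm X H (evaluation H x) \<le> 1" unfolding dual_norm_def
  proof (intro cSUP_least)
    fix a assume "a \<in> {a \<in> H. sup_norm X a \<le> 1}"
    then show "\<bar>evaluation H x a\<bar> \<le> 1"
      using sup_norm_upper[OF _ x, of a] H_Ab by (auto simp: evaluation_def)
  qed auto
qed (use H_subspace H_one x in \<open>auto simp: evaluation_def subspace_add subspace_scale scaleR_fun_apply\<close>)

text \<open>If the evaluation at \<open>x\<close> is \<open>p \<phi> + q \<rho>\<close> with states
  and positive weights, then \<open>\<phi>\<close> is positive and dominated by \<open>1/p\<close>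
  times the evaluation, hence a multiple of it, and the value at the constant makes the factor
  1.\<close>

lemma simplex_evaluation_extreme:
  assumes simplex: "choquet_simplex X" and A1: "A\<^sub>1 X \<subseteq> H" and sigma: "H \<subseteq> sigma_closure (A\<^sub>c X)"
    and x: "x \<in> extreme_points X"
  shows "evaluation H x \<in> extreme_points (state_space X H)"
proof -
  have xX: "x \<in> X" using x by (rule ext_in)
  have half: "\<phi> = evaluation H x"
    if \<phi>: "\<phi> \<in> state_space X H" and \<rho>: "\<rho> \<in> state_space X H" and p: "0 < p" "0 < q"
      and eq: "evaluation H x = p *\<^sub>R \<phi> + q *\<^sub>R \<rho>" for \<phi> \<rho> p q
  proof
    fix a show "\<phi> a = evaluation H x a"
    proof (cases "a \<in> H")
      case True
      have "\<phi> a = \<phi> (indicat_real X) * a x"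
      proof (rule simplex_dominated_functional[OF simplex H_subspace A1 sigma H_Ab x state_linear[OF \<phi>] _ True])
        fix b assume b: "b \<in> H" "\<And>y. y \<in> X \<Longrightarrow> 0 \<le> b y"
        have "b x = p * \<phi> b + q * \<rho> b"
          using fun_cong[OF eq, of b] b(1) by (simp add: evaluation_def scaleR_fun_def)
        moreover have "0 \<le> \<phi> b" "0 \<le> \<rho> b" using state_nonneg \<phi> \<rho> b by blast+
        ultimately have "p * \<phi> b \<le> b x" using p by simp
        then show "0 \<le> \<phi> b \<and> \<phi> b \<le> (1/p) * b x" using \<open>0 \<le> \<phi> b\<close> p by (simp add: field_simps)
      qed
      then show ?thesis using True \<phi> by (simp add: state_space_def evaluation_def)
    next
      case False then show ?thesis
        using \<phi> by (simp add: state_space_def dual_space_def linear_maps_on_def evaluation_def)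
    qed
  qed
  show ?thesis unfolding extreme_points_def extreme_point_of_def
  proof (intro CollectI conjI ballI notI)
    show "evaluation H x \<in> state_space X H" using xX by (rule evaluation_state)
    fix \<phi> \<rho> assume s: "\<phi> \<in> state_space X H" "\<rho> \<in> state_space X H" and "evaluation H x \<in> open_segment \<phi> \<rho>"
    then obtain u where u: "\<phi> \<noteq> \<rho>" "0 < u" "u < 1" "evaluation H x = (1 - u) *\<^sub>R \<phi> + u *\<^sub>R \<rho>"
      unfolding in_segment by blast
    have "\<phi> = evaluation H x" by (rule half[OF s _ u(2,4)]) (use u(3) in simp)
    moreover have "\<rho> = evaluation H x"
      by (rule half[OF s(2,1) u(2), of "1 - u"]) (use u in \<open>simp_all add: add.commute\<close>)
    ultimately show False using u(1) by simp
  qed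
qed

lemma simplex_center_eq_multipliers:
  assumes simplex: "choquet_simplex X" and A1: "A\<^sub>1 X \<subseteq> H" and sigma: "H \<subseteq> sigma_closure (A\<^sub>c X)"
  shows "center X H = multipliers X H"
proof (rule center_eq_multipliers[OF sigma])
  fix T a assume T: "T \<in> order_bounded_operators X H" and a: "a \<in> H"
  have "T a x = T (indicat_real X) x * a x" if x: "x \<in> extreme_points X" for x
  proof -
    have xX: "x \<in> X" using x by (rule ext_in)
    obtain l where l: "linear_functional_on H (\<lambda>a. T a x + l * a x)"
      "\<And>a. a \<in> H \<Longrightarrow> (\<And>y. y \<in> X \<Longrightarrow> 0 \<le> a y) \<Longrightarrow> 0 \<le> T a x + l * a x \<and> T a x + l * a x \<le> 2 * l * a x"
      using operator_functional[OF T xX] by blast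
    have "T a x + l * a x = (T (indicat_real X) x + l * indicat_real X x) * a x"
      using simplex_dominated_functional[OF simplex H_subspace A1 sigma H_Ab x l a] .
    then show ?thesis using xX by (simp add: distrib_right)
  qed
  moreover have "T a \<in> H" using T a unfolding order_bounded_operators_def by blast
  ultimately show "\<exists>b\<in>H. \<forall>x\<in>extreme_points X. b x = T (indicat_real X) x * a x" by blast
qed

end

end

section \<open>Affine functions of the first Baire class\<close>

lemma convex_closure_tvs:
  fixes S :: "'a::topological_vector_space set"
  assumes "convex S"
  shows "convex (closure S)"
proof -
  have c: "continuous_on A (\<lambda>y. u *\<^sub>R x + v *\<^sub>R y)" "continuous_on A (\<lambda>y. u *\<^sub>R y + v *\<^sub>R x)"
    for A and u v :: real and x :: 'a
    by (intro continuous_on_add tvs_continuous_on_scaleR continuous_on_const continuous_on_id)+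
  show ?thesis unfolding convex_def
  proof (intro ballI allI impI)
    fix x y and u v :: real
    assume xy: "x \<in> closure S" "y \<in> closure S" and uv: "0 \<le> u" "0 \<le> v" "u + v = 1"
    have 1: "u *\<^sub>R x' + v *\<^sub>R y \<in> closure S" if "x' \<in> S" for x'
    proof -
      have "(\<lambda>y. u *\<^sub>R x' + v *\<^sub>R y) ` S \<subseteq> closure S"
        using assms that uv closure_subset unfolding convex_def by blast
      then have "(\<lambda>y. u *\<^sub>R x' + v *\<^sub>R y) ` closure S \<subseteq> closure S"
        by (intro image_closure_subset c) auto
      then show ?thesis using xy(2) by blast
    qed
    have "(\<lambda>x. u *\<^sub>R x + v *\<^sub>R y) ` closure S \<subseteq> closure S"
      using 1 by (intro image_closure_subset c) auto
    then show "u *\<^sub>R x + v *\<^sub>R y \<in> closure S" using xy(1) by blast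
  qed
qed

text \<open>A Baire category argument. The limit is below \<open>\<gamma>\<close> or above
  \<open>\<gamma>'\<close>, so the closed sets \<open>A m\<close> and \<open>B m\<close> cover
  \<open>Q\<close>. On \<open>A m\<close> it is at most \<open>\<gamma> < d\<close> and on
  \<open>B m\<close> at least \<open>\<gamma>' > c\<close>, so by density neither has interior
  points. With a single threshold, points at which the limit equals it could escape both
  families.\<close>

lemma baire_one_no_gap:
  fixes f :: "'a::t2_space \<Rightarrow> real"
  assumes Q: "compact Q" "Q \<noteq> {}" and g: "\<And>n. continuous_on Q (g n)"
    and lim: "\<And>x. x \<in> Q \<Longrightarrow> (\<lambda>n. g n x) \<longlonglongrightarrow> f x" and cd: "c < d"
    and lo: "Q \<subseteq> closure {x\<in>Q. f x \<le> c}" and hi: "Q \<subseteq> closure {x\<in>Q. d \<le> f x}"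
  shows False
proof -
  define \<gamma> where "\<gamma> = (c + d) / 2"
  define \<gamma>' where "\<gamma>' = (c + \<gamma>) / 2"
  have cd': "c < \<gamma>'" "\<gamma>' < \<gamma>" "\<gamma> < d" using cd by (auto simp: \<gamma>_def \<gamma>'_def)
  define A where "A m = (\<Inter>n\<in>{m..}. Q \<inter> g n -` {..\<gamma>})" for m
  define B where "B m = (\<Inter>n\<in>{m..}. Q \<inter> g n -` {\<gamma>'..})" for m
  have cl: "closedin (top_of_set Q) (A m)" "closedin (top_of_set Q) (B m)" for m
    unfolding A_def B_def by (intro closedin_INT continuous_closedin_preimage g; simp)+
  have cov: "Q = \<Union>(range A \<union> range B)"
  proof
    show "\<Union>(range A \<union> range B) \<subseteq> Q" by (auto simp: A_def B_def)
    show "Q \<subseteq> \<Union>(range A \<union> range B)"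
    proof
      fix x assume x: "x \<in> Q"
      show "x \<in> \<Union>(range A \<union> range B)"
      proof (cases "f x < \<gamma>")
        case True
        then have "\<forall>\<^sub>F n in sequentially. g n x < \<gamma>" using lim[OF x] by (rule order_tendstoD(2)[rotated])
        then obtain m where "\<forall>n\<ge>m. g n x < \<gamma>" by (auto simp: eventually_sequentially)
        then have "x \<in> A m" using x by (auto simp: A_def intro: less_imp_le)
        then show ?thesis by blast
      next
        case False
        then have "\<gamma>' < f x" using cd' by simp
        then have "\<forall>\<^sub>F n in sequentially. \<gamma>' < g n x" using lim[OF x] by (rule order_tendstoD(1)[rotated])
        then obtain m where "\<forall>n\<ge>m. \<gamma>' < g n x" by (auto simp: eventually_sequentially)
        then have "x \<in> B m" using x by (auto simp: B_def intro: less_imp_le)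
        then show ?thesis by blast
      qed
    qed
  qed
  have noint: "top_of_set Q interior_of T = {}" if T: "T \<in> range A \<union> range B" for T
  proof (rule ccontr)
    assume "top_of_set Q interior_of T \<noteq> {}"
    then obtain x U where U: "openin (top_of_set Q) U" "x \<in> U" "U \<subseteq> T" by (auto simp: interior_of_def)
    obtain O' where O': "open O'" "U = Q \<inter> O'" using U(1) by (auto simp: openin_open)
    have xQ: "x \<in> Q" "x \<in> O'" using U(2) O'(2) by auto
    obtain y where y: "y \<in> Q" "f y \<le> c" "y \<in> O'"
      using lo xQ closure_iff_nhds_not_empty[of x "{x\<in>Q. f x \<le> c}"] O'(1) by blast
    obtain z where z: "z \<in> Q" "d \<le> f z" "z \<in> O'"
      using hi xQ closure_iff_nhds_not_empty[of x "{x\<in>Q. d \<le> f x}"] O'(1) by blast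
    have yz: "y \<in> T" "z \<in> T" using y z O'(2) U(3) by auto
    from T show False
    proof
      assume "T \<in> range A"
      then obtain m where m: "T = A m" by blast
      have "f z \<le> \<gamma>"
        by (rule LIMSEQ_le_const2[OF lim[OF z(1)]]) (use yz(2) m in \<open>auto simp: A_def\<close>)
      then show False using z(2) cd' by simp
    next
      assume "T \<in> range B"
      then obtain m where m: "T = B m" by blast
      have "\<gamma>' \<le> f y"
        by (rule LIMSEQ_le_const[OF lim[OF y(1)]]) (use yz(1) m in \<open>auto simp: B_def\<close>)
      then show False using y(2) cd' by simp
    qed
  qed
  have H: "Hausdorff_space (top_of_set Q)" by (rule Hausdorff_space_subtopology[OF Hausdorff_space_euclidean_t2])
  have "compact_space (top_of_set Q)" using Q(1) by (simp add: compact_space_subtopology)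
  then have "locally_compact_space (top_of_set Q)" "regular_space (top_of_set Q)"
    using H by (auto intro: compact_imp_locally_compact_space compact_Hausdorff_imp_regular_space)
  then have "top_of_set Q interior_of \<Union>(range A \<union> range B) = {}"
    using noint cl by (intro Baire_category_alt) auto
  then show False unfolding cov[symmetric] using Q(2) interior_of_topspace[of "top_of_set Q"] by simp
qed

context compact_convex
begin

text \<open>On the compact set \<open>X\<close> the given topology is the weak one from
  \<open>A\<^sub>c X\<close>: each point outside \<open>O'\<close> is pushed above 1 by some
  function that is 0 at \<open>y\<close>, and by compactness finitely many suffice.\<close>

lemma Ac_neighbourhood:
  assumes y: "y \<in> X" "y \<in> O'" and O': "open O'"
  obtains F where "finite F" "F \<subseteq> A\<^sub>c X" "\<And>a. a \<in> F \<Longrightarrow> a y = 0" "\<And>z. z \<in> X \<Longrightarrow> (\<And>a. a \<in> F \<Longrightarrow> a z \<le> 1) \<Longrightarrow> z \<in> O'"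
proof -
  have "\<exists>a\<in>A\<^sub>c X. a y = 0 \<and> a z = 2" if z: "z \<in> X - O'" for z
  proof -
    have "z \<noteq> y" "z \<in> X" using z y by auto
    then obtain a where a: "a \<in> A\<^sub>c X" "a z \<noteq> a y" using Ac_separates y(1) by blast
    define k where "k = 2 / (a z - a y)"
    have "(\<lambda>x. k * a x + (- (k * a y)) * indicat_real X x) \<in> A\<^sub>c X" using a(1) Ac_one by (rule Ac_lincomb)
    moreover have "k * a z + (- (k * a y)) * indicat_real X z = 2"
    proof -
      have "k * a z - k * a y = k * (a z - a y)" by (simp add: right_diff_distrib)
      also have "\<dots> = 2" using a(2) by (simp add: k_def del: right_diff_distrib_numeral)
      finally show ?thesis using \<open>z \<in> X\<close> by simp
    qed
    ultimately show ?thesis using y(1) by (intro bexI[of _ "\<lambda>x. k * a x + (- (k * a y)) * indicat_real X x"]) auto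
  qed
  then obtain a where a: "\<And>z. z \<in> X - O' \<Longrightarrow> a z \<in> A\<^sub>c X \<and> a z y = 0 \<and> a z z = 2" by metis
  have "\<exists>T. open T \<and> X \<inter> a z -` {1<..} = X \<inter> T" if "z \<in> X - O'" for z
    using continuous_openin_preimage_gen[OF Ac_continuous, of "a z" "{1<..}"] a[OF that] by (auto simp: openin_open)
  then obtain T where T: "\<And>z. z \<in> X - O' \<Longrightarrow> open (T z) \<and> X \<inter> a z -` {1<..} = X \<inter> T z" by metis
  have "compact (X - O')" using compact O' by (rule compact_diff)
  moreover have "X - O' \<subseteq> (\<Union>z\<in>X - O'. T z)"
  proof
    fix z assume z: "z \<in> X - O'"
    then have "z \<in> X \<inter> a z -` {1<..}" using a[OF z] by auto
    then show "z \<in> (\<Union>z\<in>X - O'. T z)" using T[OF z] z by blast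
  qed
  ultimately obtain Z where Z: "Z \<subseteq> X - O'" "finite Z" "X - O' \<subseteq> (\<Union>z\<in>Z. T z)"
    using compactE_image[of "X - O'" "X - O'" T] T by metis
  show thesis
  proof (rule that[of "a ` Z"])
    show "finite (a ` Z)" "a ` Z \<subseteq> A\<^sub>c X" using Z a by auto
    show "b y = 0" if "b \<in> a ` Z" for b using that Z a by auto
    fix z assume z: "z \<in> X" and le: "\<And>b. b \<in> a ` Z \<Longrightarrow> b z \<le> 1"
    show "z \<in> O'"
    proof (rule ccontr)
      assume "z \<notin> O'"
      then obtain q where q: "q \<in> Z" "z \<in> T q" using z Z(3) by blast
      then have "1 < a q z" using T[of q] Z(1) z by blast
      then show False using le[of "a q"] q(1) by auto
    qed
  qed
qed

text \<open>The barycenter of the normalized restriction of \<open>\<mu>\<close> to \<open>B\<close>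
  stays in every compact convex \<open>Q\<close> around \<open>B\<close>. For a null set both sides
  vanish, whatever the point.\<close>

lemma set_barycenter:
  assumes \<mu>: "radon_prob X \<mu>" and B: "B \<in> sets \<mu>"
    and Q: "compact Q" "convex Q" "Q \<noteq> {}" "Q \<subseteq> X" "B \<subseteq> Q"
  obtains y where "y \<in> Q" "\<And>a. a \<in> A\<^sub>c X \<Longrightarrow> integral\<^sup>L \<mu> (\<lambda>x. indicator B x * a x) = measure \<mu> B * a y"
proof -
  interpret prob_space \<mu> using \<mu> by (rule radon_prob_space)
  have int: "integrable \<mu> (\<lambda>x. indicator B x * a x)" if "a \<in> A\<^sub>c X" for a
    using B radon_integrable[OF compact \<mu> Ac_continuous[OF that]] integrable_mult_indicator[of B \<mu> a] by simp
  show thesis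
  proof (cases "measure \<mu> B = 0")
    case True
    obtain y where y: "y \<in> Q" using Q by blast
    have "emeasure \<mu> B = 0" using True by (simp add: emeasure_eq_measure)
    then have "AE x in \<mu>. x \<notin> B" using B AE_iff_null_sets null_setsI by blast
    then have "AE x in \<mu>. indicator B x * a x = 0" for a :: "'a \<Rightarrow> real" by (auto elim: AE_mp)
    then have "integral\<^sup>L \<mu> (\<lambda>x. indicator B x * a x) = 0" for a :: "'a \<Rightarrow> real" by (rule integral_eq_zero_AE)
    then show thesis using that[OF y] True by simp
  next
    case False
    then have pos: "0 < measure \<mu> B" by (simp add: zero_less_measure_iff)
    have "linear_functional_on (A\<^sub>c X) (\<lambda>a. integral\<^sup>L \<mu> (\<lambda>x. indicator B x * a x) / measure \<mu> B)"
      unfolding linear_functional_on_def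
    proof (intro conjI ballI allI)
      fix u v assume uv: "u \<in> A\<^sub>c X" "v \<in> A\<^sub>c X"
      show "integral\<^sup>L \<mu> (\<lambda>x. indicator B x * (u + v) x) / measure \<mu> B =
        integral\<^sup>L \<mu> (\<lambda>x. indicator B x * u x) / measure \<mu> B + integral\<^sup>L \<mu> (\<lambda>x. indicator B x * v x) / measure \<mu> B"
        using int[OF uv(1)] int[OF uv(2)] by (simp add: distrib_left add_divide_distrib)
      show "integral\<^sup>L \<mu> (\<lambda>x. indicator B x * (r *\<^sub>R u) x) / measure \<mu> B =
        r * (integral\<^sup>L \<mu> (\<lambda>x. indicator B x * u x) / measure \<mu> B)" for r
        by (simp add: scaleR_fun_apply mult.left_commute)
    qed
    then obtain y where y: "y \<in> Q" "\<And>a. a \<in> A\<^sub>c X \<Longrightarrow> integral\<^sup>L \<mu> (\<lambda>x. indicator B x * a x) / measure \<mu> B = a y"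
    proof (rule functional_is_evaluation[OF Q(1-4) subspace_Ac order_refl])
      fix a c assume a: "a \<in> A\<^sub>c X" "\<And>x. x \<in> Q \<Longrightarrow> a x \<le> c"
      have "integrable \<mu> (\<lambda>x. indicator B x * c)" using B by (simp add: emeasure_eq_measure)
      with int[OF a(1)] have "integral\<^sup>L \<mu> (\<lambda>x. indicator B x * a x) \<le> integral\<^sup>L \<mu> (\<lambda>x. indicator B x * c)"
        by (rule integral_mono) (use Q(5) a(2) in \<open>auto simp: indicator_def\<close>)
      also have "\<dots> = measure \<mu> B * c" using B sets.sets_into_space[OF B] by (simp add: Int_absorb2)
      finally show "integral\<^sup>L \<mu> (\<lambda>x. indicator B x * a x) / measure \<mu> B \<le> c"
        using pos by (simp add: divide_le_eq mult.commute)
    qed blast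
    show thesis
    proof (rule that[OF y(1)])
      fix a assume "a \<in> A\<^sub>c X"
      from y(2)[OF this] pos show "integral\<^sup>L \<mu> (\<lambda>x. indicator B x * a x) = measure \<mu> B * a y"
        by (simp add: field_simps)
    qed
  qed
qed

text \<open>For affine \<open>f\<close> the set function \<open>B \<mapsto> \<mu>(B) f(r\<^sub>B)\<close>, \<open>r\<^sub>B\<close> the barycenter of \<open>\<mu>\<close> on \<open>B\<close>, has a density \<open>k\<close>. If \<open>k > f\<close>
  on a set of positive measure, then on the closed convex hull \<open>Q\<close> of a suitable compact piece of it both
  \<open>{f \<le> c}\<close> and \<open>{f \<ge> d}\<close> are dense, which a function of the first Baire class does not allow.\<close>

lemma baire_one_barycenter_le:
  assumes aff: "\<And>x y t. x \<in> X \<Longrightarrow> y \<in> X \<Longrightarrow> 0 \<le> t \<Longrightarrow> t \<le> 1 \<Longrightarrow> f ((1 - t) *\<^sub>R x + t *\<^sub>R y) = (1 - t) * f x + t * f y"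
    and bnd: "\<And>x. x \<in> X \<Longrightarrow> \<bar>f x\<bar> \<le> C"
    and g: "\<And>n. continuous_on X (g n)" and lim: "\<And>x. x \<in> X \<Longrightarrow> (\<lambda>n. g n x) \<longlonglongrightarrow> f x"
    and \<mu>: "radon_prob X \<mu>" and r: "is_barycenter X \<mu> r"
  shows "f r \<le> integral\<^sup>L \<mu> f"
proof (rule ccontr)
  assume contra: "\<not> f r \<le> integral\<^sup>L \<mu> f"
  interpret prob_space \<mu> using \<mu> by (rule radon_prob_space)
  have sp: "space \<mu> = X" using \<mu> by (rule radon_space)
  have rX: "r \<in> X" using r by (simp add: is_barycenter_def)
  have BX: "B \<subseteq> X" if "B \<in> sets \<mu>" for B using sets.sets_into_space[OF that] sp by simp
  have fm: "f \<in> borel_measurable \<mu>"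
    by (rule borel_measurable_LIMSEQ_real[of _ g]) (use lim sp radon_measurable[OF \<mu> g] in auto)
  have fi: "integrable \<mu> f" using \<mu> fm bnd by (rule radon_bounded_integrable)
  have bnd2: "0 \<le> f x + C" "- C \<le> f x" if "x \<in> X" for x using bnd[OF that] by linarith+
  have ai: "integrable \<mu> (\<lambda>x. indicator B x * a x)" if "a \<in> A\<^sub>c X" "B \<in> sets \<mu>" for a B
    using that radon_integrable[OF compact \<mu> Ac_continuous[OF that(1)]] integrable_mult_indicator[of B \<mu> a] by simp
  have "\<exists>y. y \<in> X \<and> (\<forall>a\<in>A\<^sub>c X. integral\<^sup>L \<mu> (\<lambda>x. indicator B x * a x) = measure \<mu> B * a y)" if "B \<in> sets \<mu>" for B
    using set_barycenter[OF \<mu> that compact convex nonempty order_refl BX[OF that]] by metis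
  then obtain bc where bc: "\<And>B. B \<in> sets \<mu> \<Longrightarrow> bc B \<in> X"
    "\<And>B a. B \<in> sets \<mu> \<Longrightarrow> a \<in> A\<^sub>c X \<Longrightarrow> integral\<^sup>L \<mu> (\<lambda>x. indicator B x * a x) = measure \<mu> B * a (bc B)" by metis
  have bc_unique: "bc B = y" if B: "B \<in> sets \<mu>" "0 < measure \<mu> B" and y: "y \<in> X"
    "\<And>a. a \<in> A\<^sub>c X \<Longrightarrow> integral\<^sup>L \<mu> (\<lambda>x. indicator B x * a x) = measure \<mu> B * a y" for B y
  proof (rule Ac_separates[OF bc(1)[OF B(1)] y(1)])
    fix a assume "a \<in> A\<^sub>c X"
    then have "measure \<mu> B * a (bc B) = measure \<mu> B * a y" using bc(2)[OF B(1)] y(2) by metis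
    then show "a (bc B) = a y" using B(2) by simp
  qed
  define G where "G B = measure \<mu> B * f (bc B)" for B
  \<comment> \<open>The barycenter of a disjoint union is the mixture of the two barycenters,
    weighted by their measures, and \<open>f\<close> is affine.\<close>
  have Gadd: "G (A \<union> B) = G A + G B" if AB: "A \<in> sets \<mu>" "B \<in> sets \<mu>" "A \<inter> B = {}" for A B
  proof (cases "measure \<mu> (A \<union> B) = 0")
    case True
    have "measure \<mu> A \<le> measure \<mu> (A \<union> B)" "measure \<mu> B \<le> measure \<mu> (A \<union> B)"
      using AB by (auto intro: finite_measure_mono)
    then have "measure \<mu> A = 0" "measure \<mu> B = 0" using True by (auto intro: antisym)
    then show ?thesis using True by (simp add: G_def)
  next
    case False
    define m where "m = measure \<mu> (A \<union> B)"
    have m: "0 < m" using False by (simp add: m_def zero_less_measure_iff)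
    have mAB: "m = measure \<mu> A + measure \<mu> B" unfolding m_def using AB by (intro finite_measure_Union)
    define t where "t = measure \<mu> B / m"
    have t: "0 \<le> t" "t \<le> 1" "m * (1 - t) = measure \<mu> A" "m * t = measure \<mu> B"
      using m mAB by (auto simp: t_def right_diff_distrib)
    have mx: "(1 - t) *\<^sub>R bc A + t *\<^sub>R bc B \<in> X" using bc(1) AB t by (intro mix) auto
    have "bc (A \<union> B) = (1 - t) *\<^sub>R bc A + t *\<^sub>R bc B"
    proof (rule bc_unique[OF _ _ mx])
      fix a assume a: "a \<in> A\<^sub>c X"
      have "integral\<^sup>L \<mu> (\<lambda>x. indicator (A \<union> B) x * a x) =
          integral\<^sup>L \<mu> (\<lambda>x. indicator A x * a x + indicator B x * a x)"
        using AB(3) by (intro Bochner_Integration.integral_cong refl) (auto simp: indicator_def)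
      also have "\<dots> = measure \<mu> A * a (bc A) + measure \<mu> B * a (bc B)"
        using ai[OF a] AB bc(2)[OF _ a] by simp
      also have "\<dots> = m * ((1 - t) * a (bc A) + t * a (bc B))"
        unfolding distrib_left mult.assoc[symmetric] t ..
      also have "(1 - t) * a (bc A) + t * a (bc B) = a ((1 - t) *\<^sub>R bc A + t *\<^sub>R bc B)"
        using a bc(1) AB t by (intro Ac_mix[symmetric]) auto
      finally show "integral\<^sup>L \<mu> (\<lambda>x. indicator (A \<union> B) x * a x) = measure \<mu> (A \<union> B) * a ((1 - t) *\<^sub>R bc A + t *\<^sub>R bc B)"
        by (simp add: m_def)
    qed (use AB m in \<open>auto simp: m_def\<close>)
    then have "G (A \<union> B) = m * ((1 - t) * f (bc A) + t * f (bc B))"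
      unfolding G_def m_def[symmetric] using aff[of "bc A" "bc B" t] bc(1) AB t by simp
    also have "\<dots> = G A + G B" unfolding distrib_left mult.assoc[symmetric] t G_def ..
    finally show ?thesis .
  qed
  have Gb: "0 \<le> G B + C * measure \<mu> B" "G B + C * measure \<mu> B \<le> 2 * C * measure \<mu> B" if "B \<in> sets \<mu>" for B
  proof -
    have "- C \<le> f (bc B)" "f (bc B) \<le> C" using bnd[OF bc(1)[OF that]] by auto
    then have "measure \<mu> B * (- C) \<le> G B" "G B \<le> measure \<mu> B * C"
      unfolding G_def by (intro mult_left_mono; simp)+
    then show "0 \<le> G B + C * measure \<mu> B" "G B + C * measure \<mu> B \<le> 2 * C * measure \<mu> B"
      by (simp_all add: mult.commute)
  qed
  have Ge: "G {} = 0" by (simp add: G_def)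
  \<comment> \<open>\<open>G\<close> is signed; adding \<open>C * measure \<mu> B\<close> makes it
    positive. The density \<open>k\<close> is therefore that of \<open>G\<close> raised by
    \<open>C\<close>, hence the \<open>d + C\<close> in the comparisons below.\<close>
  define N where "N = measure_of (space \<mu>) (sets \<mu>) (\<lambda>B. ennreal (G B + C * measure \<mu> B))"
  have Ns: "sets N = sets \<mu>" unfolding N_def by simp
  \<comment> \<open>Finite additivity is \<open>Gadd\<close>. Continuity at the empty set follows
    from the upper bound \<open>2 * C * measure \<mu> B\<close> and gives countable
    additivity.\<close>
  have ca: "countably_additive (sets \<mu>) (\<lambda>B. ennreal (G B + C * measure \<mu> B))"
  proof (rule sets.empty_continuous_imp_countably_additive)
    show "positive (sets \<mu>) (\<lambda>B. ennreal (G B + C * measure \<mu> B))" by (simp add: positive_def Ge)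
    show "additive (sets \<mu>) (\<lambda>B. ennreal (G B + C * measure \<mu> B))" unfolding additive_def
    proof (intro ballI impI)
      fix A B assume AB: "A \<in> sets \<mu>" "B \<in> sets \<mu>" "A \<inter> B = {}"
      have "measure \<mu> (A \<union> B) = measure \<mu> A + measure \<mu> B" using AB by (intro finite_measure_Union)
      then have "G (A \<union> B) + C * measure \<mu> (A \<union> B) = (G A + C * measure \<mu> A) + (G B + C * measure \<mu> B)"
        using Gadd[OF AB] by (simp add: distrib_left)
      then show "ennreal (G (A \<union> B) + C * measure \<mu> (A \<union> B)) =
          ennreal (G A + C * measure \<mu> A) + ennreal (G B + C * measure \<mu> B)"
        using Gb AB by simp
    qed
    show "\<forall>A\<in>sets \<mu>. ennreal (G A + C * measure \<mu> A) \<noteq> \<infinity>" by simp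
    fix A :: "nat \<Rightarrow> 'a set" assume A: "range A \<subseteq> sets \<mu>" "decseq A" "(\<Inter>i. A i) = {}"
    have "(\<lambda>i. measure \<mu> (A i)) \<longlonglongrightarrow> measure \<mu> (\<Inter>i. A i)"
      using A by (intro finite_Lim_measure_decseq) auto
    then have m0: "(\<lambda>i. measure \<mu> (A i)) \<longlonglongrightarrow> 0" using A(3) by simp
    have "(\<lambda>i. G (A i) + C * measure \<mu> (A i)) \<longlonglongrightarrow> 0"
    proof (rule real_tendsto_sandwich[of "\<lambda>_. 0" _ _ "\<lambda>i. 2 * C * measure \<mu> (A i)"])
      show "(\<lambda>i. 2 * C * measure \<mu> (A i)) \<longlonglongrightarrow> 0" using tendsto_mult_left[OF m0, of "2 * C"] by simp
      show "\<forall>\<^sub>F i in sequentially. 0 \<le> G (A i) + C * measure \<mu> (A i)"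
        "\<forall>\<^sub>F i in sequentially. G (A i) + C * measure \<mu> (A i) \<le> 2 * C * measure \<mu> (A i)"
        using Gb A(1) by (auto intro!: always_eventually)
    qed simp
    then show "(\<lambda>i. ennreal (G (A i) + C * measure \<mu> (A i))) \<longlonglongrightarrow> 0"
      using tendsto_ennrealI by fastforce
  qed
  have Ne: "emeasure N B = ennreal (G B + C * measure \<mu> B)" if "B \<in> sets \<mu>" for B
    by (rule emeasure_measure_of[OF N_def]) (use that sets.space_closed ca Ns in \<open>auto simp: positive_def Ge\<close>)
  have "absolutely_continuous \<mu> N" unfolding absolutely_continuous_def
  proof
    fix B assume B: "B \<in> null_sets \<mu>"
    then have "B \<in> sets \<mu>" "measure \<mu> B = 0" by (auto simp: measure_eq_0_null_sets)
    then have "emeasure N B = 0" using Ne Gb[of B] by (simp add: G_def)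
    then show "B \<in> null_sets N" using \<open>B \<in> sets \<mu>\<close> Ns by (intro null_setsI) auto
  qed
  then obtain k where k: "k \<in> borel_measurable \<mu>" "density \<mu> k = N" using Radon_Nikodym Ns by blast
  have Nk: "ennreal (G B + C * measure \<mu> B) = (\<integral>\<^sup>+x. k x * indicator B x \<partial>\<mu>)" if "B \<in> sets \<mu>" for B
    using Ne[OF that] emeasure_density[OF k(1) that] k(2) by simp
  \<comment> \<open>Otherwise \<open>k \<le> f + C\<close> almost everywhere, rational
    \<open>c\<close> and \<open>d\<close> being enough to see this, and integration over the whole
    space turns it into \<open>f r \<le> integral\<^sup>L \<mu> f\<close>.\<close>
  have "\<exists>c d. c < d \<and> emeasure \<mu> {x\<in>space \<mu>. f x \<le> c \<and> ennreal (d + C) \<le> k x} \<noteq> 0"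
  proof (rule ccontr)
    assume no: "\<not> ?thesis"
    have "AE x in \<mu>. \<not> (f x \<le> real_of_rat c \<and> ennreal (real_of_rat d + C) \<le> k x)" if "c < d" for c d
    proof -
      have "real_of_rat c < real_of_rat d" using that by (simp add: of_rat_less)
      then have "emeasure \<mu> {x\<in>space \<mu>. f x \<le> real_of_rat c \<and> ennreal (real_of_rat d + C) \<le> k x} = 0"
        using no by blast
      then show ?thesis
        by (intro AE_I[where N = "{x\<in>space \<mu>. f x \<le> real_of_rat c \<and> ennreal (real_of_rat d + C) \<le> k x}"])
          (use fm k(1) in auto)
    qed
    then have "AE x in \<mu>. \<forall>c d. c < d \<longrightarrow> \<not> (f x \<le> real_of_rat c \<and> ennreal (real_of_rat d + C) \<le> k x)"
      by (simp add: AE_all_countable)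
    then have "AE x in \<mu>. k x \<le> ennreal (f x + C)"
    proof (rule AE_mp, intro AE_I2 impI)
      fix x assume x: "x \<in> space \<mu>"
        and *: "\<forall>c d. c < d \<longrightarrow> \<not> (f x \<le> real_of_rat c \<and> ennreal (real_of_rat d + C) \<le> k x)"
      show "k x \<le> ennreal (f x + C)"
      proof (rule ccontr)
        assume "\<not> k x \<le> ennreal (f x + C)"
        then have "ennreal (f x + C) < k x" by simp
        then obtain z where z: "f x + C < z" "ennreal z < k x"
        proof -
          obtain y where y: "ennreal (f x + C) < y" "y < k x" using \<open>ennreal (f x + C) < k x\<close> dense by blast
          then have "y \<noteq> top" by auto
          then have "y = ennreal (enn2real y)" by (simp add: less_top)
          moreover have "f x + C < enn2real y"
            using y(1) calculation by (metis ennreal_leI not_less)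
          ultimately show thesis using that[of "enn2real y"] y(2) by simp
        qed
        obtain c where c: "f x < real_of_rat c" "real_of_rat c < z - C" using of_rat_dense[of "f x" "z - C"] z(1) by auto
        obtain d where d: "real_of_rat c < real_of_rat d" "real_of_rat d < z - C" using of_rat_dense[OF c(2)] by blast
        have "ennreal (real_of_rat d + C) \<le> k x"
          using d(2) z(2) by (meson ennreal_leI le_less_trans less_imp_le less_diff_eq)
        then show False using * c(1) d(1) by (simp add: of_rat_less)
      qed
    qed
    then have "(\<integral>\<^sup>+x. k x \<partial>\<mu>) \<le> (\<integral>\<^sup>+x. ennreal (f x + C) \<partial>\<mu>)" by (rule nn_integral_mono_AE)
    also have "\<dots> = ennreal (integral\<^sup>L \<mu> (\<lambda>x. f x + C))"
      using fi bnd2(1) sp by (intro nn_integral_eq_integral AE_I2) auto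
    also have "integral\<^sup>L \<mu> (\<lambda>x. f x + C) = integral\<^sup>L \<mu> f + C" using fi prob_space by simp
    finally have 1: "(\<integral>\<^sup>+x. k x \<partial>\<mu>) \<le> ennreal (integral\<^sup>L \<mu> f + C)" .
    have "bc (space \<mu>) = r"
    proof (rule bc_unique[OF _ _ rX])
      fix a assume a: "a \<in> A\<^sub>c X"
      have "integral\<^sup>L \<mu> (\<lambda>x. indicator (space \<mu>) x * a x) = integral\<^sup>L \<mu> a"
        by (intro Bochner_Integration.integral_cong) auto
      then show "integral\<^sup>L \<mu> (\<lambda>x. indicator (space \<mu>) x * a x) = measure \<mu> (space \<mu>) * a r"
        using r a prob_space by (simp add: is_barycenter_def)
    qed (use prob_space in auto)
    then have "ennreal (f r + C) = (\<integral>\<^sup>+x. k x * indicator (space \<mu>) x \<partial>\<mu>)"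
      using Nk[of "space \<mu>"] prob_space by (simp add: G_def)
    also have "\<dots> = (\<integral>\<^sup>+x. k x \<partial>\<mu>)" by (intro nn_integral_cong) auto
    finally have "ennreal (f r + C) \<le> ennreal (integral\<^sup>L \<mu> f + C)" using 1 by simp
    moreover have "- C \<le> integral\<^sup>L \<mu> f"
    proof -
      have "integral\<^sup>L \<mu> (\<lambda>_. - C) \<le> integral\<^sup>L \<mu> f"
        using fi bnd2(2) sp by (intro integral_mono) auto
      then show ?thesis using prob_space by simp
    qed
    ultimately show False using contra by (simp add: ennreal_le_iff2)
  qed
  then obtain c d where cd: "c < d" "emeasure \<mu> {x\<in>space \<mu>. f x \<le> c \<and> ennreal (d + C) \<le> k x} \<noteq> 0" by blast
  define A where "A = {x\<in>space \<mu>. f x \<le> c \<and> ennreal (d + C) \<le> k x}"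
  have As: "A \<in> sets \<mu>" unfolding A_def using fm k(1) by measurable
  have "0 < measure \<mu> A" using cd(2) by (simp add: A_def[symmetric] emeasure_eq_measure zero_less_measure_iff)
  then obtain K where K: "compact K" "K \<subseteq> A" "K \<in> sets \<mu>" "0 < measure \<mu> K"
    using radon_inner[OF \<mu> As] by blast
  have KX: "K \<subseteq> X" using K(2) sp by (auto simp: A_def)
  \<comment> \<open>On \<open>K\<close> the density is at least \<open>d + C\<close>, so
    \<open>G B\<close> is at least \<open>d * measure \<mu> B\<close>.\<close>
  have hi: "d \<le> f (bc B)" if B: "B \<in> sets \<mu>" "B \<subseteq> K" "0 < measure \<mu> B" for B
  proof -
    have "ennreal (d + C) * emeasure \<mu> B = (\<integral>\<^sup>+x. ennreal (d + C) * indicator B x \<partial>\<mu>)"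
      using B(1) by (simp add: nn_integral_cmult_indicator)
    also have "\<dots> \<le> (\<integral>\<^sup>+x. k x * indicator B x \<partial>\<mu>)"
      using B(2) K(2) by (intro nn_integral_mono) (auto simp: indicator_def A_def)
    also have "\<dots> = ennreal (G B + C * measure \<mu> B)" using Nk[OF B(1)] by simp
    finally have "ennreal ((d + C) * measure \<mu> B) \<le> ennreal (G B + C * measure \<mu> B)"
      using B(3) by (simp add: emeasure_eq_measure ennreal_mult'')
    then have "(d + C) * measure \<mu> B \<le> G B + C * measure \<mu> B \<or> (d + C) * measure \<mu> B \<le> 0"
      using Gb(1)[OF B(1)] by (auto simp: ennreal_le_iff2)
    then have "(d + C) * measure \<mu> B \<le> G B + C * measure \<mu> B" using Gb(1)[OF B(1)] by auto
    then have "d * measure \<mu> B \<le> f (bc B) * measure \<mu> B" by (simp add: G_def algebra_simps)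
    then show ?thesis using B(3) by simp
  qed
  \<comment> \<open>Removing the open sets that meet \<open>K\<close> in a null set leaves the
    support \<open>S\<close> of \<open>\<mu>\<close> on \<open>K\<close>: it has full measure in
    \<open>K\<close>, and each of its nonempty relatively open parts has positive measure.\<close>
  define \<O> where "\<O> = {O'. open O' \<and> measure \<mu> (K \<inter> O') = 0}"
  define S where "S = K - \<Union>\<O>"
  have Sc: "compact S" unfolding S_def \<O>_def using K(1) by (intro compact_diff) auto
  have SK: "S \<subseteq> K" by (auto simp: S_def)
  then have SX: "S \<subseteq> X" using KX by blast
  have Ss: "S \<in> sets \<mu>" using radon_compact_sets[OF \<mu> Sc SX] .
  have Kopen: "K \<inter> O' \<in> sets \<mu>" "S \<inter> O' \<in> sets \<mu>" if "open O'" for O'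
  proof -
    have "X \<inter> O' \<in> sets \<mu>" using that by (auto simp: radon_sets[OF \<mu>] sets_restrict_space)
    then have "K \<inter> (X \<inter> O') \<in> sets \<mu>" "S \<inter> (X \<inter> O') \<in> sets \<mu>" using K(3) Ss by auto
    moreover have "K \<inter> (X \<inter> O') = K \<inter> O'" "S \<inter> (X \<inter> O') = S \<inter> O'" using KX SX by auto
    ultimately show "K \<inter> O' \<in> sets \<mu>" "S \<inter> O' \<in> sets \<mu>" by simp_all
  qed
  have null: "measure \<mu> (K - S) = 0"
  proof (rule ccontr)
    assume "measure \<mu> (K - S) \<noteq> 0"
    then have "0 < measure \<mu> (K - S)" by (simp add: zero_less_measure_iff)
    then obtain L where L: "compact L" "L \<subseteq> K - S" "L \<in> sets \<mu>" "0 < measure \<mu> L"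
      using radon_inner[OF \<mu>, of "K - S"] K(3) Ss by blast
    have "L \<subseteq> \<Union>\<O>" using L(2) by (auto simp: S_def)
    then obtain \<U> where U: "\<U> \<subseteq> \<O>" "finite \<U>" "L \<subseteq> \<Union>\<U>"
      using compactE[OF L(1), of \<O>] unfolding \<O>_def by blast
    have "measure \<mu> L \<le> measure \<mu> (\<Union>V\<in>\<U>. K \<inter> V)"
      using U L(2) Kopen by (intro finite_measure_mono sets.finite_UN) (auto simp: \<O>_def)
    also have "\<dots> \<le> (\<Sum>V\<in>\<U>. measure \<mu> (K \<inter> V))"
      using U Kopen by (intro finite_measure_subadditive_finite) (auto simp: \<O>_def)
    also have "\<dots> = 0" using U(1) by (intro sum.neutral) (auto simp: \<O>_def)
    finally show False using L(4) by simp
  qed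
  have Spos: "0 < measure \<mu> (S \<inter> O')" if "open O'" "y \<in> S" "y \<in> O'" for y O'
  proof -
    have "0 < measure \<mu> (K \<inter> O')" using that by (auto simp: S_def \<O>_def zero_less_measure_iff)
    moreover have "measure \<mu> (K \<inter> O') \<le> measure \<mu> ((S \<inter> O') \<union> (K - S))"
      using Kopen[OF that(1)] K(3) Ss by (intro finite_measure_mono) auto
    moreover have "\<dots> \<le> measure \<mu> (S \<inter> O') + measure \<mu> (K - S)"
      using Kopen[OF that(1)] K(3) Ss by (intro measure_Un_le) auto
    ultimately show ?thesis using null by linarith
  qed
  have "measure \<mu> K \<le> measure \<mu> S + measure \<mu> (K - S)"
    using measure_Un_le[of S \<mu> "K - S"] K(3) Ss SK by (simp add: Un_absorb1)
  then have Sne: "S \<noteq> {}" using null K(4) by auto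
  define Q where "Q = closure (convex hull S)"
  have hS: "convex hull S \<subseteq> X" using SX convex by (rule hull_minimal)
  have QX: "Q \<subseteq> X" unfolding Q_def using hS compact_imp_closed[OF compact] by (rule closure_minimal)
  have Qc: "compact Q" "convex Q" "Q \<noteq> {}" "S \<subseteq> Q"
  proof -
    have "compact (X \<inter> Q)" using compact by (rule compact_Int_closed) (simp add: Q_def)
    then show "compact Q" using QX by (simp add: Int_absorb1)
    show "convex Q" unfolding Q_def by (rule convex_closure_tvs) (rule convex_convex_hull)
    show SQ: "S \<subseteq> Q" unfolding Q_def by (meson closure_subset hull_subset subset_trans)
    show "Q \<noteq> {}" using SQ Sne by blast
  qed
  define R where "R = {bc B | B. B \<in> sets \<mu> \<and> B \<subseteq> S \<and> 0 < measure \<mu> B}"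
  have RQ: "R \<subseteq> Q"
  proof
    fix y assume "y \<in> R"
    then obtain B where B: "y = bc B" "B \<in> sets \<mu>" "B \<subseteq> S" "0 < measure \<mu> B" unfolding R_def by blast
    obtain z where z: "z \<in> Q" "\<And>a. a \<in> A\<^sub>c X \<Longrightarrow> integral\<^sup>L \<mu> (\<lambda>x. indicator B x * a x) = measure \<mu> B * a z"
      using set_barycenter[OF \<mu> B(2) Qc(1-3) QX] B(3) Qc(4) by blast
    have "bc B = z" using z QX by (intro bc_unique[OF B(2,4)]) auto
    then show "y \<in> Q" using z(1) B(1) by simp
  qed
  \<comment> \<open>Inside a neighbourhood of \<open>y\<close> lies a compact convex set
    \<open>Z\<close> cut out by finitely many affine functions. The part \<open>B\<close> of
    \<open>S\<close> near \<open>y\<close> lies in \<open>Z\<close> and has positive measure, and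
    its barycenter stays in \<open>Z\<close>.\<close>
  have SR: "S \<subseteq> closure R"
  proof
    fix y assume y: "y \<in> S"
    have yX: "y \<in> X" using y SX by blast
    show "y \<in> closure R" unfolding closure_iff_nhds_not_empty
    proof (intro allI impI)
      fix A' V assume AV: "V \<subseteq> A'" "open V" "y \<in> V"
      obtain F where F: "finite F" "F \<subseteq> A\<^sub>c X" "\<And>a. a \<in> F \<Longrightarrow> a y = 0" "\<And>z. z \<in> X \<Longrightarrow> (\<And>a. a \<in> F \<Longrightarrow> a z \<le> 1) \<Longrightarrow> z \<in> V"
        using Ac_neighbourhood[OF yX AV(3,2)] by blast
      define Z where "Z = {z\<in>X. \<forall>a\<in>F. a z \<le> 1}"
      have Zeq: "Z = X \<inter> (\<Inter>a\<in>F. X \<inter> a -` {..1})" by (auto simp: Z_def)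
      have "closedin (top_of_set X) (X \<inter> (\<Inter>a\<in>F. X \<inter> a -` {..1}))"
      proof (cases "F = {}")
        case False
        then show ?thesis using F(2) Ac_continuous
          by (intro closedin_Int closedin_INT continuous_closedin_preimage) auto
      qed simp
      then have Zc: "compact Z" unfolding Zeq using compact closedin_compact by blast
      have Zconv: "convex Z" unfolding convex_alt
      proof (intro ballI allI impI)
        fix p q t assume pq: "p \<in> Z" "q \<in> Z" and t: "0 \<le> t \<and> t \<le> (1::real)"
        have pqX: "p \<in> X" "q \<in> X" using pq by (auto simp: Z_def)
        have "a ((1 - t) *\<^sub>R p + t *\<^sub>R q) \<le> 1" if a: "a \<in> F" for a
        proof -
          have "a ((1 - t) *\<^sub>R p + t *\<^sub>R q) = (1 - t) * a p + t * a q" using a F(2) pqX t by (intro Ac_mix) auto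
          also have "\<dots> \<le> (1 - t) * 1 + t * 1" using pq a t by (intro add_mono mult_left_mono) (auto simp: Z_def)
          finally show ?thesis by simp
        qed
        then show "(1 - t) *\<^sub>R p + t *\<^sub>R q \<in> Z" using mix[OF pqX] t by (auto simp: Z_def)
      qed
      have y1: "a y \<le> 1" "a y < 1" if "a \<in> F" for a using F(3)[OF that] by simp_all
      have yZ: "y \<in> Z" using yX y1(1) by (simp add: Z_def)
      define I where "I = {z\<in>X. \<forall>a\<in>F. a z < 1}"
      have Ieq: "I = X \<inter> (\<Inter>a\<in>F. X \<inter> a -` {..<1})" by (auto simp: I_def)
      have "openin (top_of_set X) I"
      proof (cases "F = {}")
        case False
        then show ?thesis unfolding Ieq using F(1,2) Ac_continuous
          by (intro openin_Int openin_INT2 continuous_openin_preimage_gen) auto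
      qed (simp add: I_def)
      then obtain O' where O': "open O'" "I = X \<inter> O'" by (auto simp: openin_open)
      have "y \<in> I" using yX y1(2) by (simp add: I_def)
      then have "y \<in> O'" using O'(2) by simp
      define B where "B = S \<inter> O'"
      have B: "B \<in> sets \<mu>" "B \<subseteq> S" "0 < measure \<mu> B"
        using Kopen[OF O'(1)] Spos[OF O'(1) y \<open>y \<in> O'\<close>] by (auto simp: B_def)
      have BZ: "B \<subseteq> Z"
      proof
        fix z assume "z \<in> B"
        then have "z \<in> I" using O'(2) SX by (auto simp: B_def)
        then show "z \<in> Z" by (auto simp: I_def Z_def intro: less_imp_le)
      qed
      obtain z where z: "z \<in> Z" "\<And>a. a \<in> A\<^sub>c X \<Longrightarrow> integral\<^sup>L \<mu> (\<lambda>x. indicator B x * a x) = measure \<mu> B * a z"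
        using set_barycenter[OF \<mu> B(1) Zc Zconv _ _ BZ] yZ by (auto simp: Z_def)
      have "bc B = z" using z by (intro bc_unique[OF B(1,3)]) (auto simp: Z_def)
      moreover have "z \<in> V" using z(1) by (intro F(4)) (simp_all add: Z_def)
      ultimately have "bc B \<in> V" by simp
      then show "R \<inter> A' \<noteq> {}" using B AV(1) unfolding R_def by blast
    qed
  qed
  have cvle: "convex {x\<in>X. f x \<le> c}" and cvge: "convex {x\<in>X. d \<le> f x}"
  proof -
    show "convex {x\<in>X. f x \<le> c}" unfolding convex_alt
    proof (intro ballI allI impI)
      fix p q t assume pq: "p \<in> {x\<in>X. f x \<le> c}" "q \<in> {x\<in>X. f x \<le> c}" and t: "0 \<le> t \<and> t \<le> (1::real)"
      have "(1 - t) * f p + t * f q \<le> (1 - t) * c + t * c" using pq t by (intro add_mono mult_left_mono) auto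
      also have "\<dots> = c" by (simp add: left_diff_distrib)
      finally show "(1 - t) *\<^sub>R p + t *\<^sub>R q \<in> {x\<in>X. f x \<le> c}" using aff[of p q t] mix[of p q t] pq t by auto
    qed
    show "convex {x\<in>X. d \<le> f x}" unfolding convex_alt
    proof (intro ballI allI impI)
      fix p q t assume pq: "p \<in> {x\<in>X. d \<le> f x}" "q \<in> {x\<in>X. d \<le> f x}" and t: "0 \<le> t \<and> t \<le> (1::real)"
      have "d = (1 - t) * d + t * d" by (simp add: left_diff_distrib)
      also have "\<dots> \<le> (1 - t) * f p + t * f q" using pq t by (intro add_mono mult_left_mono) auto
      finally show "(1 - t) *\<^sub>R p + t *\<^sub>R q \<in> {x\<in>X. d \<le> f x}" using aff[of p q t] mix[of p q t] pq t by auto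
    qed
  qed
  show False
  proof (rule baire_one_no_gap[OF Qc(1,3), of g f c d])
    show "continuous_on Q (g n)" for n using g QX continuous_on_subset by blast
    show "(\<lambda>n. g n x) \<longlonglongrightarrow> f x" if "x \<in> Q" for x using lim that QX by blast
    show "c < d" by fact
    have "S \<subseteq> {x\<in>X. f x \<le> c}" using SK K(2) sp by (auto simp: A_def)
    then have "convex hull S \<subseteq> {x\<in>X. f x \<le> c}" using cvle by (rule hull_minimal)
    then have "convex hull S \<subseteq> {x\<in>Q. f x \<le> c}" using closure_subset[of "convex hull S"] by (auto simp: Q_def)
    then show "Q \<subseteq> closure {x\<in>Q. f x \<le> c}" unfolding Q_def by (rule closure_mono)
    have "R \<subseteq> {x\<in>X. d \<le> f x}" unfolding R_def using hi SK bc(1) by blast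
    then have "convex hull R \<subseteq> {x\<in>X. d \<le> f x}" using cvge by (rule hull_minimal)
    moreover have "convex hull R \<subseteq> Q" using RQ Qc(2) by (rule hull_minimal)
    ultimately have hR: "convex hull R \<subseteq> {x\<in>Q. d \<le> f x}" by blast
    have "S \<subseteq> closure (convex hull R)"
      using SR closure_mono[OF hull_subset[of R Convex.convex]] by blast
    then have "convex hull S \<subseteq> closure (convex hull R)"
      by (rule hull_minimal) (rule convex_closure_tvs[OF convex_convex_hull])
    then have "Q \<subseteq> closure (convex hull R)" unfolding Q_def by (rule closure_minimal) simp
    then show "Q \<subseteq> closure {x\<in>Q. d \<le> f x}" using closure_mono[OF hR] by blast
  qed
qed

end

section \<open>Separation by sets that are both F_sigma and G_delta\<close>

lemma Lindelof_relative_cover: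
  assumes L: "Lindelof_space (top_of_set A)" and AX: "A \<subseteq> X" and C: "closedin (top_of_set X) C"
    and op: "\<And>U. U \<in> \<U> \<Longrightarrow> openin (top_of_set X) U" and cov: "A \<inter> C \<subseteq> \<Union>\<U>"
  shows "\<exists>\<V>. countable \<V> \<and> \<V> \<subseteq> \<U> \<and> A \<inter> C \<subseteq> \<Union>\<V>"
proof -
  have rel: "openin (top_of_set A) (A \<inter> U)" if "openin (top_of_set X) U" for U
  proof -
    obtain T where "open T" "U = X \<inter> T" using \<open>openin (top_of_set X) U\<close> by (auto simp: openin_open)
    then show ?thesis using AX by (auto simp: openin_open)
  qed
  have "openin (top_of_set X) (X - C)" using C by (simp add: openin_diff)
  from rel[OF this] have AC: "openin (top_of_set A) (A - C)" using AX by (simp add: Diff_eq Int_absorb2 flip: Int_assoc)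
  \<comment> \<open>The set \<open>A - C\<close> completes the cover of \<open>A \<inter> C\<close>
    to an open cover of \<open>A\<close>, to which the Lindelof property applies.\<close>
  have "\<exists>\<W>. countable \<W> \<and> \<W> \<subseteq> insert (A - C) ((\<inter>) A ` \<U>) \<and> A \<subseteq> \<Union>\<W>"
  proof -
    have "\<forall>W\<in>insert (A - C) ((\<inter>) A ` \<U>). openin (top_of_set A) W" using AC rel op by blast
    moreover have "topspace (top_of_set A) \<subseteq> \<Union>(insert (A - C) ((\<inter>) A ` \<U>))" using cov by auto
    ultimately show ?thesis using L unfolding Lindelof_space_alt by (metis topspace_euclidean_subtopology)
  qed
  then obtain \<W> where W: "countable \<W>" "\<W> \<subseteq> insert (A - C) ((\<inter>) A ` \<U>)" "A \<subseteq> \<Union>\<W>" by blast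
  have "countable (\<W> - {A - C})" "\<W> - {A - C} \<subseteq> (\<inter>) A ` \<U>" using W by auto
  then obtain \<V> where V: "countable \<V>" "\<V> \<subseteq> \<U>" "\<W> - {A - C} = (\<inter>) A ` \<V>"
    using countable_subset_image by metis
  have "A \<inter> C \<subseteq> \<Union>\<V>"
  proof
    fix x assume x: "x \<in> A \<inter> C"
    then obtain w where w: "w \<in> \<W>" "x \<in> w" using W(3) by blast
    then have "w \<in> (\<inter>) A ` \<V>" using V(3) x by blast
    then show "x \<in> \<Union>\<V>" using w(2) by blast
  qed
  then show ?thesis using V by blast
qed

lemma gdelta_in_complement: "gdelta_in (top_of_set X) S \<longleftrightarrow> S \<subseteq> X \<and> fsigma_in (top_of_set X) (X - S)"
  by (simp add: gdelta_in_fsigma_in)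

text \<open>\<open>X - P\<close> is a countable union of closed sets, so the Lindelof property
  yields countably many \<open>U n\<close> that cover \<open>A \<inter> Z - P\<close>. Made disjoint
  and kept off \<open>P\<close>, they leave F_sigma sets \<open>U' n\<close>. On each of these
  \<open>S n\<close> decides membership, so the pasted set \<open>T\<close> and its complement are
  both F_sigma.\<close>

lemma paste_separations:
  fixes X :: "'a::t2_space set"
  defines "\<tau> \<equiv> top_of_set X"
  assumes L: "Lindelof_space (top_of_set A)" and AX: "A \<subseteq> X"
    and good: "\<And>U. U \<in> \<G> \<Longrightarrow> openin \<tau> U \<and> fsigma_in \<tau> U \<and>
      (\<exists>S. fsigma_in \<tau> S \<and> gdelta_in \<tau> S \<and> A \<inter> U \<subseteq> S \<and> S \<inter> B = {})"
    and Z: "closedin \<tau> Z" and P: "closedin \<tau> P" "gdelta_in \<tau> P" "P \<inter> B = {}"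
    and cov: "A \<inter> Z \<subseteq> P \<union> \<Union>\<G>"
  shows "\<exists>S. fsigma_in \<tau> S \<and> gdelta_in \<tau> S \<and> A \<inter> Z \<subseteq> S \<and> S \<inter> B = {}"
proof -
  have XP: "fsigma_in \<tau> (X - P)" using P(2) by (simp add: \<tau>_def gdelta_in_complement)
  then obtain C where C: "\<And>j::nat. closedin \<tau> (C j)" "\<Union>(range C) = X - P" by (auto simp: fsigma_in_ascending)
  have "\<exists>\<V>. countable \<V> \<and> \<V> \<subseteq> \<G> \<and> A \<inter> (Z \<inter> C j) \<subseteq> \<Union>\<V>" for j
  proof (rule Lindelof_relative_cover[OF L AX])
    show "closedin (top_of_set X) (Z \<inter> C j)" using Z C(1) by (auto simp: \<tau>_def)
    show "openin (top_of_set X) U" if "U \<in> \<G>" for U using good[OF that] by (simp add: \<tau>_def)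
    show "A \<inter> (Z \<inter> C j) \<subseteq> \<Union>\<G>" using cov C(2) by blast
  qed
  then obtain \<V> where V: "\<And>j. countable (\<V> j)" "\<And>j. \<V> j \<subseteq> \<G>" "\<And>j. A \<inter> (Z \<inter> C j) \<subseteq> \<Union>(\<V> j)" by metis
  define \<W> where "\<W> = insert {} (\<Union>j. \<V> j)"
  have W: "countable \<W>" "\<W> \<noteq> {}" using V(1) by (auto simp: \<W>_def)
  define U where "U = from_nat_into \<W>"
  have UW: "range U = \<W>" using W by (simp add: U_def range_from_nat_into)
  have Ugood: "openin \<tau> (U n) \<and> fsigma_in \<tau> (U n) \<and>
      (\<exists>S. fsigma_in \<tau> S \<and> gdelta_in \<tau> S \<and> A \<inter> U n \<subseteq> S \<and> S \<inter> B = {})" for n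
  proof (cases "U n = {}")
    case True
    then show ?thesis by (auto intro!: exI[of _ "{}"])
  next
    case False
    have "U n \<in> \<W>" using UW by blast
    then have "U n \<in> \<G>" using False V(2) by (auto simp: \<W>_def)
    then show ?thesis by (rule good)
  qed
  then obtain S where S: "\<And>n. fsigma_in \<tau> (S n)" "\<And>n. gdelta_in \<tau> (S n)" "\<And>n. A \<inter> U n \<subseteq> S n" "\<And>n. S n \<inter> B = {}" by metis
  have UX: "U n \<subseteq> X" for n using Ugood[of n] openin_subset[of \<tau> "U n"] by (simp add: \<tau>_def)
  define U' where "U' n = U n \<inter> (X - (\<Union>m<n. U m)) \<inter> (X - P)" for n
  have cl: "closedin \<tau> (X - (\<Union>m\<in>I. U m))" for I
  proof -
    have "openin \<tau> (\<Union>m\<in>I. U m)" using Ugood by blast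
    then show ?thesis using closedin_diff[OF closedin_topspace, of \<tau> "\<Union>m\<in>I. U m"] by (simp add: \<tau>_def)
  qed
  have U'f: "fsigma_in \<tau> (U' n)" for n
    unfolding U'_def using Ugood closed_imp_fsigma_in[OF cl] XP by (intro fsigma_in_Int) auto
  define T where "T = P \<union> (\<Union>n. U' n \<inter> S n)"
  have "fsigma_in \<tau> (\<Union>n. U' n \<inter> S n)"
    by (rule fsigma_in_Union) (auto intro!: fsigma_in_Int U'f S)
  then have Tf: "fsigma_in \<tau> T" unfolding T_def by (rule fsigma_in_Un[OF closed_imp_fsigma_in[OF P(1)]])
  have TX: "T \<subseteq> X" using fsigma_in_subset[OF Tf] by (simp add: \<tau>_def)
  have "X - T = (X - P) \<inter> (X - (\<Union>n\<in>UNIV. U n)) \<union> (\<Union>n. U' n \<inter> (X - S n))"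
  proof
    show "X - T \<subseteq> (X - P) \<inter> (X - (\<Union>n\<in>UNIV. U n)) \<union> (\<Union>n. U' n \<inter> (X - S n))"
    proof
      fix x assume x: "x \<in> X - T"
      show "x \<in> (X - P) \<inter> (X - (\<Union>n\<in>UNIV. U n)) \<union> (\<Union>n. U' n \<inter> (X - S n))"
      proof (cases "\<exists>n. x \<in> U n")
        case True
        then obtain n where n: "x \<in> U n" "\<And>m. m < n \<Longrightarrow> x \<notin> U m" using exists_least_iff[of "\<lambda>n. x \<in> U n"] by blast
        then have "x \<in> U' n" using x by (auto simp: U'_def T_def)
        then show ?thesis using x by (auto simp: T_def)
      next
        case False then show ?thesis using x by (auto simp: T_def)
      qed
    qed
    have dj: "n = m" if "x \<in> U' n" "x \<in> U' m" for n m x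
      using that unfolding U'_def by (cases n m rule: linorder_cases) auto
    have U'X: "U' n \<subseteq> X - P" "U' n \<subseteq> U n" for n by (auto simp: U'_def)
    show "(X - P) \<inter> (X - (\<Union>n\<in>UNIV. U n)) \<union> (\<Union>n. U' n \<inter> (X - S n)) \<subseteq> X - T"
    proof
      fix x assume x: "x \<in> (X - P) \<inter> (X - (\<Union>n\<in>UNIV. U n)) \<union> (\<Union>n. U' n \<inter> (X - S n))"
      have "x \<notin> U' m \<inter> S m" for m using x dj U'X(2)[of m] by blast
      moreover have "x \<in> X - P" using x U'X(1) by blast
      ultimately show "x \<in> X - T" by (auto simp: T_def)
    qed
  qed
  moreover have "fsigma_in \<tau> ((X - P) \<inter> (X - (\<Union>n\<in>UNIV. U n)))"
    using XP closed_imp_fsigma_in[OF cl] by (rule fsigma_in_Int)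
  moreover have "fsigma_in \<tau> (\<Union>n. U' n \<inter> (X - S n))"
  proof (rule fsigma_in_Union)
    have "fsigma_in \<tau> (X - S n)" for n using S(2)[of n] by (simp add: gdelta_in_complement \<tau>_def)
    then show "fsigma_in \<tau> V" if "V \<in> range (\<lambda>n. U' n \<inter> (X - S n))" for V
      using that by (auto intro!: fsigma_in_Int U'f)
  qed simp
  ultimately have "fsigma_in \<tau> (X - T)" by (simp add: fsigma_in_Un)
  then have Tg: "gdelta_in \<tau> T" using TX by (simp add: \<tau>_def gdelta_in_complement)
  have "A \<inter> Z \<subseteq> T"
  proof
    fix x assume x: "x \<in> A \<inter> Z"
    show "x \<in> T"
    proof (cases "x \<in> P")
      case False
      then obtain j where "x \<in> C j" using C(2) x AX by blast
      then obtain V where "V \<in> \<V> j" "x \<in> V" using V(3)[of j] x by blast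
      then have "\<exists>n. x \<in> U n" using UW unfolding \<W>_def by (metis UN_I UNIV_I imageE insertI2)
      then obtain n where n: "x \<in> U n" "\<And>m. m < n \<Longrightarrow> x \<notin> U m" using exists_least_iff[of "\<lambda>n. x \<in> U n"] by blast
      then have "x \<in> U' n" using False x AX by (auto simp: U'_def)
      then show ?thesis using S(3)[of n] n(1) x by (auto simp: T_def)
    qed (simp add: T_def)
  qed
  moreover have "T \<inter> B = {}" using P(3) S(4) by (auto simp: T_def)
  ultimately show ?thesis using Tf Tg by blast
qed

text \<open>The union \<open>W\<close> of all open sets over which \<open>A\<close> can be separated from \<open>B\<close> is everything: otherwise some relatively open
  piece of \<open>X - W\<close> lies in \<open>A\<close> or misses \<open>A\<close>, and in both cases pasting enlarges \<open>W\<close>.\<close>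

lemma resolvable_Lindelof_separation:
  fixes X :: "'a::t2_space set"
  defines "\<tau> \<equiv> top_of_set X"
  assumes X: "compact X" and L: "Lindelof_space (top_of_set A)" and res: "resolvable_in X A"
    and P: "\<And>K. compact K \<Longrightarrow> K \<subseteq> X \<Longrightarrow> K \<inter> B = {} \<Longrightarrow> \<exists>P. closedin \<tau> P \<and> gdelta_in \<tau> P \<and> K \<subseteq> P \<and> P \<inter> B = {}"
    and AB: "A \<inter> B = {}"
  shows "\<exists>S. fsigma_in \<tau> S \<and> gdelta_in \<tau> S \<and> A \<subseteq> S \<and> S \<inter> B = {}"
proof -
  have AX: "A \<subseteq> X" using res by (simp add: resolvable_in_def)
  define \<G> where "\<G> = {U. openin \<tau> U \<and> fsigma_in \<tau> U \<and> (\<exists>S. fsigma_in \<tau> S \<and> gdelta_in \<tau> S \<and> A \<inter> U \<subseteq> S \<and> S \<inter> B = {})}"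
  note paste = paste_separations[OF L AX, of \<G> B, folded \<tau>_def]
  have good: "openin \<tau> U \<and> fsigma_in \<tau> U \<and> (\<exists>S. fsigma_in \<tau> S \<and> gdelta_in \<tau> S \<and> A \<inter> U \<subseteq> S \<and> S \<inter> B = {})"
    if "U \<in> \<G>" for U using that by (simp add: \<G>_def)
  define F where "F = X - \<Union>\<G>"
  have "openin \<tau> (\<Union>\<G>)" using good by blast
  then have Fc: "closedin \<tau> F" unfolding F_def using closedin_diff[OF closedin_topspace, of \<tau> "\<Union>\<G>"] by (simp add: \<tau>_def)
  have "F = {}"
  proof (rule ccontr)
    assume "F \<noteq> {}"
    then obtain V where V: "openin (top_of_set F) V" "V \<noteq> {}" "bounded (indicat_real A ` V)" "diameter (indicat_real A ` V) < 1"
      using res Fc unfolding resolvable_in_def fragmented_on_def \<tau>_def by (meson zero_less_one)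
    \<comment> \<open>A function with values 0 and 1 and diameter below 1 is constant.\<close>
    have "V \<subseteq> A \<or> V \<inter> A = {}"
    proof (rule ccontr)
      assume "\<not> (V \<subseteq> A \<or> V \<inter> A = {})"
      then obtain p q where "p \<in> V" "p \<in> A" "q \<in> V" "q \<notin> A" by blast
      then have "dist (indicat_real A p) (indicat_real A q) \<le> diameter (indicat_real A ` V)"
        by (intro diameter_bounded_bound[OF V(3)] imageI)
      then show False using V(4) \<open>p \<in> A\<close> \<open>q \<notin> A\<close> by simp
    qed
    obtain p where p: "p \<in> V" using V(2) by blast
    obtain O' where O': "open O'" "V = F \<inter> O'" using V(1) by (auto simp: openin_open)
    have pX: "p \<in> X" "p \<in> O'" "p \<in> F" using p O'(2) by (auto simp: F_def)
    obtain f :: "'a \<Rightarrow> real" where f: "continuous_on X f" "\<And>x. x \<in> X \<Longrightarrow> 0 \<le> f x \<and> f x \<le> 1"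
      "\<And>x. x \<in> {p} \<Longrightarrow> f x = 1" "\<And>x. x \<in> X - O' \<Longrightarrow> f x = 0"
    proof (rule urysohn_on[OF X, of "{p}" "X - O'"])
      show "closedin (top_of_set X) {p}" using pX by (intro closed_subset) auto
      show "closedin (top_of_set X) (X - O')" using O'(1) by (auto simp: closedin_closed intro!: exI[of _ "- O'"])
      show "{p} \<inter> (X - O') = {}" using pX by auto
    qed blast
    \<comment> \<open>\<open>Z\<close> is a closed neighbourhood of \<open>p\<close> inside
      \<open>O'\<close>, and \<open>Z'\<close> below is an open one inside \<open>Z\<close> that is
      F_sigma as the union of level sets. Members of \<open>\<G>\<close> must be F_sigma, which an
      arbitrary open neighbourhood need not be.\<close>
    define Z where "Z = {x\<in>X. 1/2 \<le> f x}"
    have lev: "closedin \<tau> {x\<in>X. c \<le> f x}" for c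
      using continuous_closedin_preimage[OF f(1), of "{c..}"] by (simp add: \<tau>_def vimage_def Int_def)
    have Zc: "closedin \<tau> Z" unfolding Z_def by (rule lev)
    have ZO: "Z \<subseteq> O'"
    proof
      fix x assume "x \<in> Z"
      then show "x \<in> O'" using f(4)[of x] by (cases "x \<in> O'") (auto simp: Z_def)
    qed
    \<comment> \<open>If \<open>V\<close> lies in \<open>A\<close>, then \<open>Z \<inter> F\<close>
      is a compact subset of \<open>A\<close>, hence disjoint from \<open>B\<close>, and the
      hypothesis \<open>P\<close> applies; if \<open>V\<close> misses \<open>A\<close>, the empty
      set will do.\<close>
    have "\<exists>P. closedin \<tau> P \<and> gdelta_in \<tau> P \<and> P \<inter> B = {} \<and> A \<inter> Z \<inter> F \<subseteq> P"
    proof (cases "V \<inter> A = {}")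
      case True
      then have "A \<inter> Z \<inter> F = {}" using ZO O'(2) by blast
      then show ?thesis by (intro exI[of _ "{}"]) auto
    next
      case False
      then have VA: "V \<subseteq> A" using \<open>V \<subseteq> A \<or> V \<inter> A = {}\<close> by blast
      have "compact (Z \<inter> F)" using closedin_compact[OF X closedin_Int[OF Zc Fc, unfolded \<tau>_def]] .
      moreover have "Z \<inter> F \<subseteq> X" "Z \<inter> F \<inter> B = {}" using ZO O'(2) VA AB by (auto simp: Z_def)
      ultimately show ?thesis using P[of "Z \<inter> F"] by blast
    qed
    then obtain P' where P': "closedin \<tau> P'" "gdelta_in \<tau> P'" "P' \<inter> B = {}" "A \<inter> Z \<inter> F \<subseteq> P'" by blast
    have "A \<inter> Z \<subseteq> P' \<union> \<Union>\<G>" using P'(4) AX by (auto simp: F_def)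
    from paste[OF good Zc P'(1-3) this]
    obtain S where S: "fsigma_in \<tau> S" "gdelta_in \<tau> S" "A \<inter> Z \<subseteq> S" "S \<inter> B = {}" by blast
    define Z' where "Z' = {x\<in>X. 1/2 < f x}"
    have "openin \<tau> Z'" unfolding Z'_def
      using continuous_openin_preimage_gen[OF f(1), of "{1/2<..}"] by (simp add: \<tau>_def vimage_def Int_def)
    moreover have "Z' = (\<Union>n. {x\<in>X. 1/2 + inverse (real (Suc n)) \<le> f x})"
    proof
      show "Z' \<subseteq> (\<Union>n. {x\<in>X. 1/2 + inverse (real (Suc n)) \<le> f x})"
      proof
        fix x assume x: "x \<in> Z'"
        then have "0 < f x - 1/2" by (simp add: Z'_def)
        then obtain n where "inverse (real (Suc n)) < f x - 1/2" using reals_Archimedean by blast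
        then show "x \<in> (\<Union>n. {x\<in>X. 1/2 + inverse (real (Suc n)) \<le> f x})" using x by (auto simp: Z'_def intro!: exI[of _ n])
      qed
      show "(\<Union>n. {x\<in>X. 1/2 + inverse (real (Suc n)) \<le> f x}) \<subseteq> Z'"
      proof
        fix x assume "x \<in> (\<Union>n. {x\<in>X. 1/2 + inverse (real (Suc n)) \<le> f x})"
        then obtain n where n: "x \<in> X" "1/2 + inverse (real (Suc n)) \<le> f x" by blast
        have "0 < inverse (real (Suc n))" by simp
        then show "x \<in> Z'" using n unfolding Z'_def by (simp del: inverse_positive_iff_positive)
      qed
    qed
    then have "fsigma_in \<tau> Z'" using lev closed_imp_fsigma_in by (auto intro!: fsigma_in_Union)
    moreover have "A \<inter> Z' \<subseteq> S" using S(3) by (auto simp: Z_def Z'_def)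
    ultimately have "Z' \<in> \<G>" using S unfolding \<G>_def by blast
    moreover have "p \<in> Z'" using f(3)[of p] pX by (simp add: Z'_def)
    ultimately show False using pX(3) by (auto simp: F_def)
  qed
  \<comment> \<open>A last pasting, now over the whole of \<open>X\<close> with nothing set
    aside.\<close>
  then have "A \<inter> X \<subseteq> {} \<union> \<Union>\<G>" using AX by (auto simp: F_def)
  moreover have "closedin \<tau> X" using closedin_topspace[of \<tau>] by (simp add: \<tau>_def)
  ultimately have "\<exists>S. fsigma_in \<tau> S \<and> gdelta_in \<tau> S \<and> A \<inter> X \<subseteq> S \<and> S \<inter> B = {}"
    using paste[OF good, of X "{}"] by simp
  then show ?thesis using AX by (simp add: Int_absorb2)
qed

text \<open>\<open>S\<close> and its complement are increasing unions of closed sets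
  \<open>K n\<close> and \<open>L n\<close>; Urysohn functions for these disjoint pairs are
  eventually constant at each point.\<close>

lemma ambiguous_indicator_limit:
  fixes X :: "'a::t2_space set"
  assumes X: "compact X" and S: "fsigma_in (top_of_set X) S" "gdelta_in (top_of_set X) S"
  obtains s :: "nat \<Rightarrow> 'a \<Rightarrow> real" where "\<And>n. continuous_on X (s n)" "\<And>n x. x \<in> X \<Longrightarrow> 0 \<le> s n x \<and> s n x \<le> 1"
    "\<And>x. x \<in> X \<Longrightarrow> (\<lambda>n. s n x) \<longlonglongrightarrow> indicat_real S x"
proof -
  obtain K where K: "\<And>n::nat. closedin (top_of_set X) (K n)" "\<And>n. K n \<subseteq> K (Suc n)" "\<Union>(range K) = S"
    using S(1) unfolding fsigma_in_ascending by blast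
  obtain L where L: "\<And>n::nat. closedin (top_of_set X) (L n)" "\<And>n. L n \<subseteq> L (Suc n)" "\<Union>(range L) = X - S"
    using S(2) unfolding gdelta_in_complement fsigma_in_ascending by blast
  have "K n \<inter> L n = {}" for n using K(3) L(3) by blast
  then have "\<exists>s :: 'a \<Rightarrow> real. continuous_on X s \<and> (\<forall>x\<in>X. 0 \<le> s x \<and> s x \<le> 1) \<and> (\<forall>x\<in>K n. s x = 1) \<and> (\<forall>x\<in>L n. s x = 0)" for n
    using urysohn_on[OF X K(1) L(1), of n n] by metis
  then obtain s :: "nat \<Rightarrow> 'a \<Rightarrow> real" where s: "\<And>n. continuous_on X (s n)" "\<And>n x. x \<in> X \<Longrightarrow> 0 \<le> s n x \<and> s n x \<le> 1"
    "\<And>n x. x \<in> K n \<Longrightarrow> s n x = 1" "\<And>n x. x \<in> L n \<Longrightarrow> s n x = 0" by metis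
  have Km: "K m \<subseteq> K n" and Lm: "L m \<subseteq> L n" if "m \<le> n" for m n
    using lift_Suc_mono_le[of K, OF K(2) that] lift_Suc_mono_le[of L, OF L(2) that] by auto
  show thesis
  proof (rule that[of s])
    fix x assume x: "x \<in> X"
    show "(\<lambda>n. s n x) \<longlonglongrightarrow> indicat_real S x"
    proof (cases "x \<in> S")
      case True
      then obtain m where "x \<in> K m" using K(3) by blast
      then have "\<forall>\<^sub>F n in sequentially. s n x = indicat_real S x"
        unfolding eventually_sequentially
      proof (intro exI[of _ m] allI impI)
        fix n assume "m \<le> n"
        then have "x \<in> K n" using Km \<open>x \<in> K m\<close> by blast
        then show "s n x = indicat_real S x" using s(3) True by simp
      qed
      then show ?thesis by (rule tendsto_eventually)
    next
      case False
      then obtain m where "x \<in> L m" using L(3) x by blast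
      then have "\<forall>\<^sub>F n in sequentially. s n x = indicat_real S x"
        unfolding eventually_sequentially
      proof (intro exI[of _ m] allI impI)
        fix n assume "m \<le> n"
        then have "x \<in> L n" using Lm \<open>x \<in> L m\<close> by blast
        then show "s n x = indicat_real S x" using s(4) False by simp
      qed
      then show ?thesis by (rule tendsto_eventually)
    qed
  qed (use s in auto)
qed

section \<open>Saturated sets, the barycentric formula and affine approximation\<close>

context compact_convex
begin

text \<open>The countable family maps \<open>X\<close> continuously into the metrizable space of
  real sequences. The saturation is the preimage of a compact set there, and closed sets of a
  metrizable space are G_delta.\<close>

lemma closed_saturation:
  assumes D: "countable D" "D \<subseteq> A\<^sub>c X" and K: "compact K" "K \<subseteq> X"
  shows "closedin (top_of_set X) {x\<in>X. \<exists>y\<in>K. \<forall>h\<in>D. h x = h y} \<and>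
    gdelta_in (top_of_set X) {x\<in>X. \<exists>y\<in>K. \<forall>h\<in>D. h x = h y}" (is "closedin _ ?P \<and> _")
proof (cases "K = {}")
  case True then show ?thesis by simp
next
  case False
  define D' where "D' = insert (indicat_real X) D"
  have D': "countable D'" "D' \<subseteq> A\<^sub>c X" "D' \<noteq> {}" using D Ac_one by (auto simp: D'_def)
  define h where "h = from_nat_into D'"
  have hD: "range h = D'" using D' by (simp add: h_def range_from_nat_into)
  define \<pi> where "\<pi> x = (\<lambda>n. h n x)" for x
  have \<pi>c: "continuous_on X \<pi>"
  proof (rule continuous_on_coordinatewise_then_product)
    fix n
    have "h n \<in> A\<^sub>c X" using hD D'(2) by blast
    then show "continuous_on X (\<lambda>x. \<pi> x n)" unfolding \<pi>_def using Ac_continuous by simp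
  qed
  have "compact (\<pi> ` K)" using continuous_on_subset[OF \<pi>c K(2)] K(1) by (rule compact_continuous_image)
  then have cl: "closed (\<pi> ` K)" by (rule compact_imp_closed)
  have eq: "\<pi> x = \<pi> y \<longleftrightarrow> (\<forall>h\<in>D. h x = h y)" if "x \<in> X" "y \<in> X" for x y
  proof -
    have "\<pi> x = \<pi> y \<longleftrightarrow> (\<forall>v\<in>range h. v x = v y)" by (auto simp: \<pi>_def fun_eq_iff)
    also have "\<dots> \<longleftrightarrow> (\<forall>h\<in>D. h x = h y)" unfolding hD D'_def using that by simp
    finally show ?thesis .
  qed
  have Peq: "?P = X \<inter> \<pi> -` (\<pi> ` K)"
  proof
    show "?P \<subseteq> X \<inter> \<pi> -` (\<pi> ` K)" using eq K(2) by blast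
    show "X \<inter> \<pi> -` (\<pi> ` K) \<subseteq> ?P"
    proof
      fix x assume "x \<in> X \<inter> \<pi> -` (\<pi> ` K)"
      then obtain y where "x \<in> X" "y \<in> K" "\<pi> x = \<pi> y" by blast
      then show "x \<in> ?P" using eq[of x y] K(2) by blast
    qed
  qed
  have 1: "closedin (top_of_set X) ?P" unfolding Peq using \<pi>c cl by (rule continuous_closedin_preimage)
  have "X - ?P = (\<Union>n. X \<inter> \<pi> -` {z. inverse (real (Suc n)) \<le> infdist z (\<pi> ` K)})"
  proof
    show "X - ?P \<subseteq> (\<Union>n. X \<inter> \<pi> -` {z. inverse (real (Suc n)) \<le> infdist z (\<pi> ` K)})"
    proof
      fix x assume "x \<in> X - ?P"
      then have x: "x \<in> X" "\<pi> x \<notin> \<pi> ` K" unfolding Peq by auto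
      then have "infdist (\<pi> x) (\<pi> ` K) \<noteq> 0" using in_closed_iff_infdist_zero[OF cl] False by blast
      then have "0 < infdist (\<pi> x) (\<pi> ` K)" using infdist_nonneg[of "\<pi> x" "\<pi> ` K"] by linarith
      then obtain n where "inverse (real (Suc n)) < infdist (\<pi> x) (\<pi> ` K)" using reals_Archimedean by blast
      then show "x \<in> (\<Union>n. X \<inter> \<pi> -` {z. inverse (real (Suc n)) \<le> infdist z (\<pi> ` K)})"
        using x(1) by (auto intro!: exI[of _ n])
    qed
    show "(\<Union>n. X \<inter> \<pi> -` {z. inverse (real (Suc n)) \<le> infdist z (\<pi> ` K)}) \<subseteq> X - ?P"
    proof
      fix x assume "x \<in> (\<Union>n. X \<inter> \<pi> -` {z. inverse (real (Suc n)) \<le> infdist z (\<pi> ` K)})"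
      then obtain n where n: "x \<in> X" "inverse (real (Suc n)) \<le> infdist (\<pi> x) (\<pi> ` K)" by blast
      have "0 < inverse (real (Suc n))" by simp
      then have "infdist (\<pi> x) (\<pi> ` K) \<noteq> 0" using n(2) by linarith
      then show "x \<in> X - ?P" unfolding Peq using n(1) by auto
    qed
  qed
  moreover have "fsigma_in (top_of_set X) (\<Union>n. X \<inter> \<pi> -` {z. inverse (real (Suc n)) \<le> infdist z (\<pi> ` K)})"
  proof (rule fsigma_in_Union)
    fix S assume "S \<in> range (\<lambda>n. X \<inter> \<pi> -` {z. inverse (real (Suc n)) \<le> infdist z (\<pi> ` K)})"
    then obtain n where S: "S = X \<inter> \<pi> -` {z. inverse (real (Suc n)) \<le> infdist z (\<pi> ` K)}" by (rule rangeE)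
    have "closed {z. inverse (real (Suc n)) \<le> infdist z (\<pi> ` K)}"
      by (intro closed_Collect_le continuous_intros)
    then show "fsigma_in (top_of_set X) S"
      unfolding S by (rule closed_imp_fsigma_in[OF continuous_closedin_preimage[OF \<pi>c]])
  qed simp
  ultimately have "fsigma_in (top_of_set X) (X - ?P)" by simp
  then have "gdelta_in (top_of_set X) ?P" unfolding gdelta_in_complement by blast
  then show ?thesis using 1 by blast
qed

lemma baire_one_barycenter:
  assumes aff: "\<And>x y t. x \<in> X \<Longrightarrow> y \<in> X \<Longrightarrow> 0 \<le> t \<Longrightarrow> t \<le> 1 \<Longrightarrow> f ((1 - t) *\<^sub>R x + t *\<^sub>R y) = (1 - t) * f x + t * f y"
    and bnd: "\<And>x. x \<in> X \<Longrightarrow> \<bar>f x\<bar> \<le> C"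
    and g: "\<And>n. continuous_on X (g n)" and lim: "\<And>x. x \<in> X \<Longrightarrow> (\<lambda>n. g n x) \<longlonglongrightarrow> f x"
    and \<mu>: "radon_prob X \<mu>" and r: "is_barycenter X \<mu> r"
  shows "integral\<^sup>L \<mu> f = f r"
proof (rule antisym)
  show "f r \<le> integral\<^sup>L \<mu> f" by (rule baire_one_barycenter_le[OF aff bnd g lim \<mu> r])
  have "(\<lambda>x. - f x) r \<le> integral\<^sup>L \<mu> (\<lambda>x. - f x)"
  proof (rule baire_one_barycenter_le[OF _ _ _ _ \<mu> r])
    show "- f ((1 - t) *\<^sub>R x + t *\<^sub>R y) = (1 - t) * - f x + t * - f y"
      if "x \<in> X" "y \<in> X" "0 \<le> t" "t \<le> 1" for x y t using aff[OF that] by simp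
    show "\<bar>- f x\<bar> \<le> C" if "x \<in> X" for x using bnd[OF that] by simp
    show "continuous_on X (\<lambda>x. - g n x)" for n using g by (rule continuous_on_minus)
    show "(\<lambda>n. - g n x) \<longlonglongrightarrow> - f x" if "x \<in> X" for x using lim[OF that] by (rule tendsto_minus)
  qed
  then show "integral\<^sup>L \<mu> f \<le> f r" by simp
qed

text \<open>A Mazur-type argument: \<open>sandwich_duality\<close> is applied to the convex hulls of the tails of the sequence \<open>(p n, q n)\<close>.\<close>

lemma affine_approximation:
  fixes p q :: "nat \<Rightarrow> 'a \<Rightarrow> real"
  assumes pc: "\<And>n. continuous_on X (p n)" and qc: "\<And>n. continuous_on X (q n)"
    and pb: "\<And>n x. x \<in> X \<Longrightarrow> \<bar>p n x\<bar> \<le> M" and qb: "\<And>n x. x \<in> X \<Longrightarrow> \<bar>q n x\<bar> \<le> M"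
    and plim: "\<And>x. x \<in> X \<Longrightarrow> (\<lambda>n. p n x) \<longlonglongrightarrow> P x" and qlim: "\<And>x. x \<in> X \<Longrightarrow> (\<lambda>n. q n x) \<longlonglongrightarrow> Q x"
    and le: "\<And>x. x \<in> X \<Longrightarrow> P x \<le> b x \<and> b x \<le> Q x"
    and bi: "\<And>\<sigma>. radon_prob X \<sigma> \<Longrightarrow> integrable \<sigma> b"
    and b: "\<And>\<sigma> \<tau>. radon_prob X \<sigma> \<Longrightarrow> radon_prob X \<tau> \<Longrightarrow> (\<And>a. a \<in> A\<^sub>c X \<Longrightarrow> integral\<^sup>L \<sigma> a = integral\<^sup>L \<tau> a) \<Longrightarrow>
      integral\<^sup>L \<sigma> b = integral\<^sup>L \<tau> b"
  obtains a where "\<And>n::nat. a n \<in> A\<^sub>c X" "\<And>n x. x \<in> X \<Longrightarrow> \<bar>a n x\<bar> \<le> M + 1"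
    "\<And>x e. x \<in> X \<Longrightarrow> 0 < e \<Longrightarrow> \<forall>\<^sub>F n in sequentially. P x - e < a n x \<and> a n x < Q x + e"
proof -
  \<comment> \<open>Hulls are taken of pairs, so that \<open>p\<close> and \<open>q\<close> are
    averaged with the same weights.\<close>
  define G where "G m = convex hull {(p i, q i) | i. m \<le> i}" for m
  have GI: "(p i, q i) \<in> G m" if "m \<le> i" for i m unfolding G_def by (rule hull_inc) (use that in blast)
  have Gsub: "G m \<subseteq> T" if "convex T" "\<And>i. m \<le> i \<Longrightarrow> (p i, q i) \<in> T" for m T
    unfolding G_def by (rule hull_minimal) (use that in auto)
  have strip: "convex {u :: ('a \<Rightarrow> real) \<times> ('a \<Rightarrow> real). c \<le> fst u x \<and> snd u x \<le> d}" for c d x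
    unfolding convex_alt
  proof (intro ballI allI impI)
    fix u v :: "('a \<Rightarrow> real) \<times> ('a \<Rightarrow> real)" and t :: real
    assume *: "u \<in> {u. c \<le> fst u x \<and> snd u x \<le> d}" "v \<in> {u. c \<le> fst u x \<and> snd u x \<le> d}" "0 \<le> t \<and> t \<le> 1"
    have "c = (1 - t) * c + t * c" "d = (1 - t) * d + t * d" by (simp_all add: left_diff_distrib)
    moreover have "(1 - t) * c + t * c \<le> (1 - t) * fst u x + t * fst v x"
      "(1 - t) * snd u x + t * snd v x \<le> (1 - t) * d + t * d"
      using * by (intro add_mono mult_left_mono; simp)+
    ultimately show "(1 - t) *\<^sub>R u + t *\<^sub>R v \<in> {u. c \<le> fst u x \<and> snd u x \<le> d}"
      by (simp add: scaleR_fun_apply)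
  qed
  \<comment> \<open>Were this false, \<open>sandwich_duality\<close> would give measures with equal
    integrals on \<open>A\<^sub>c X\<close> for which, in the limit, the
    \<open>\<sigma>\<close>-integral of \<open>P\<close> exceeds the \<open>\<tau>\<close>-integral
    of \<open>Q\<close> by \<open>2 * \<delta>\<close>. But \<open>P \<le> b \<le> Q\<close>, and
    \<open>b\<close> has the same integral under both.\<close>
  have "\<exists>a f g. (f, g) \<in> G m \<and> a \<in> A\<^sub>c X \<and> (\<forall>x\<in>X. f x \<le> a x + inverse (real (Suc m)) \<and> a x \<le> g x + inverse (real (Suc m)))" for m
  proof (rule ccontr)
    assume no: "\<not> ?thesis"
    define \<delta> where "\<delta> = inverse (real (Suc m))"
    have \<delta>: "0 < \<delta>" by (simp add: \<delta>_def)
    obtain \<sigma> \<tau> where st: "radon_prob X \<sigma>" "radon_prob X \<tau>" "\<And>a. a \<in> A\<^sub>c X \<Longrightarrow> integral\<^sup>L \<sigma> a = integral\<^sup>L \<tau> a"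
      "\<And>f g. (f, g) \<in> G m \<Longrightarrow> 2 * \<delta> \<le> integral\<^sup>L \<sigma> f - integral\<^sup>L \<tau> g"
    proof (rule sandwich_duality[of "G m" \<delta>])
      show "G m \<noteq> {}" using GI[of m m] by blast
      have "G m \<subseteq> {f. continuous_on X f} \<times> {f. continuous_on X f}"
        by (rule Gsub[OF subspace_imp_convex[OF subspace_Times[OF subspace_continuous subspace_continuous]]]) (use pc qc in auto)
      then show "continuous_on X f \<and> continuous_on X g" if "(f, g) \<in> G m" for f g using that by blast
      fix f g f' g' t assume fg: "(f, g) \<in> G m" "(f', g') \<in> G m" "0 \<le> t" "t \<le> (1::real)"
      have "(1 - t) *\<^sub>R (f, g) + t *\<^sub>R (f', g') \<in> G m"
        using convex_convex_hull fg unfolding G_def convex_alt by blast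
      then show "(\<lambda>x. (1 - t) * f x + t * f' x, \<lambda>x. (1 - t) * g x + t * g' x) \<in> G m"
        by (simp add: plus_fun_def scaleR_fun_def)
    next
      fix f g a assume "(f, g) \<in> G m" "a \<in> A\<^sub>c X" "\<And>x. x \<in> X \<Longrightarrow> f x \<le> a x + \<delta> \<and> a x \<le> g x + \<delta>"
      then show False using no unfolding \<delta>_def by blast
    qed blast
    interpret S: prob_space \<sigma> using st(1) by (rule radon_prob_space)
    interpret T: prob_space \<tau> using st(2) by (rule radon_prob_space)
    have sp: "space \<sigma> = X" "space \<tau> = X" using radon_space st by auto
    have Pm: "P \<in> borel_measurable \<sigma>"
      by (rule borel_measurable_LIMSEQ_real[of _ p]) (use plim sp radon_measurable[OF st(1) pc] in auto)
    have Qm: "Q \<in> borel_measurable \<tau>"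
      by (rule borel_measurable_LIMSEQ_real[of _ q]) (use qlim sp radon_measurable[OF st(2) qc] in auto)
    have Pb: "\<bar>P x\<bar> \<le> M" "\<bar>Q x\<bar> \<le> M" if "x \<in> X" for x
      using LIMSEQ_le_const2[OF tendsto_rabs[OF plim[OF that]]] LIMSEQ_le_const2[OF tendsto_rabs[OF qlim[OF that]]]
        pb[OF that] qb[OF that] by blast+
    have Pi: "integrable \<sigma> P" using st(1) Pm Pb(1) by (rule radon_bounded_integrable)
    have Qi: "integrable \<tau> Q" using st(2) Qm Pb(2) by (rule radon_bounded_integrable)
    have "(\<lambda>i. integral\<^sup>L \<sigma> (p i)) \<longlonglongrightarrow> integral\<^sup>L \<sigma> P"
      by (rule integral_dominated_convergence[where w = "\<lambda>_. M"])
        (use Pm radon_measurable[OF st(1) pc] plim pb sp in auto)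
    moreover have "(\<lambda>i. integral\<^sup>L \<tau> (q i)) \<longlonglongrightarrow> integral\<^sup>L \<tau> Q"
      by (rule integral_dominated_convergence[where w = "\<lambda>_. M"])
        (use Qm radon_measurable[OF st(2) qc] qlim qb sp in auto)
    ultimately have "(\<lambda>i. integral\<^sup>L \<sigma> (p i) - integral\<^sup>L \<tau> (q i)) \<longlonglongrightarrow> integral\<^sup>L \<sigma> P - integral\<^sup>L \<tau> Q"
      by (rule tendsto_diff)
    then have "2 * \<delta> \<le> integral\<^sup>L \<sigma> P - integral\<^sup>L \<tau> Q"
      by (rule LIMSEQ_le_const) (use st(4) GI in blast)
    moreover have "integral\<^sup>L \<sigma> P \<le> integral\<^sup>L \<sigma> b" using Pi bi[OF st(1)] le sp by (intro integral_mono) auto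
    moreover have "integral\<^sup>L \<tau> b \<le> integral\<^sup>L \<tau> Q" using Qi bi[OF st(2)] le sp by (intro integral_mono) auto
    moreover have "integral\<^sup>L \<sigma> b = integral\<^sup>L \<tau> b" using st(1-3) by (rule b)
    ultimately show False using \<delta> by linarith
  qed
  then obtain a f g where afg: "\<And>m. (f m, g m) \<in> G m" "\<And>m. a m \<in> A\<^sub>c X"
    "\<And>m x. x \<in> X \<Longrightarrow> f m x \<le> a m x + inverse (real (Suc m)) \<and> a m x \<le> g m x + inverse (real (Suc m))" by metis
  have inv1: "inverse (real (Suc m)) \<le> 1" for m by (simp add: inverse_le_1_iff)
  show thesis
  proof (rule that[of a])
    show "a n \<in> A\<^sub>c X" for n by (rule afg(2))
    show "\<bar>a n x\<bar> \<le> M + 1" if x: "x \<in> X" for n x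
    proof -
      have "- M \<le> p i x" "q i x \<le> M" for i using pb[OF x, of i] qb[OF x, of i] by linarith+
      then have "G n \<subseteq> {u. - M \<le> fst u x \<and> snd u x \<le> M}" by (intro Gsub strip) auto
      then have "- M \<le> f n x" "g n x \<le> M" using afg(1)[of n] by auto
      then show ?thesis using afg(3)[OF x, of n] inv1[of n] by linarith
    qed
    fix x and e :: real assume x: "x \<in> X" and e: "0 < e"
    have "\<forall>\<^sub>F n in sequentially. P x - e/2 < p n x" "\<forall>\<^sub>F n in sequentially. q n x < Q x + e/2"
      using order_tendstoD(1)[OF plim[OF x], of "P x - e/2"] order_tendstoD(2)[OF qlim[OF x], of "Q x + e/2"] e by auto
    then have "\<forall>\<^sub>F n in sequentially. P x - e/2 < p n x \<and> q n x < Q x + e/2" by (rule eventually_conj)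
    then obtain n0 where n0: "\<And>n. n0 \<le> n \<Longrightarrow> P x - e/2 < p n x \<and> q n x < Q x + e/2" by (auto simp: eventually_sequentially)
    have "0 < e / 2" using e by simp
    then obtain n1 where n1: "inverse (real (Suc n1)) < e / 2" using reals_Archimedean by blast
    show "\<forall>\<^sub>F n in sequentially. P x - e < a n x \<and> a n x < Q x + e"
      unfolding eventually_sequentially
    proof (intro exI[of _ "max n0 n1"] allI impI)
      fix n assume n: "max n0 n1 \<le> n"
      have "G n \<subseteq> {u. P x - e/2 \<le> fst u x \<and> snd u x \<le> Q x + e/2}"
        using n0 n by (intro Gsub strip) (auto intro: less_imp_le)
      then have "P x - e/2 \<le> f n x" "g n x \<le> Q x + e/2" using afg(1)[of n] by auto
      moreover have "inverse (real (Suc n)) \<le> inverse (real (Suc n1))" using n by (intro le_imp_inverse_le) auto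
      ultimately show "P x - e < a n x \<and> a n x < Q x + e" using afg(3)[OF x, of n] n1 by linarith
    qed
  qed
qed

lemma affine_mix: "f \<in> affine_functions X \<Longrightarrow> x \<in> X \<Longrightarrow> y \<in> X \<Longrightarrow> 0 \<le> t \<Longrightarrow> t \<le> 1 \<Longrightarrow>
    f ((1 - t) *\<^sub>R x + t *\<^sub>R y) = (1 - t) * f x + t * f y"
  by (simp add: affine_functions_def)

lemma squeeze:
  fixes a :: "nat \<Rightarrow> real"
  assumes "\<And>e. 0 < e \<Longrightarrow> \<forall>\<^sub>F n in sequentially. l - e < a n \<and> a n < l + e"
  shows "a \<longlonglongrightarrow> l"
proof (rule tendstoI)
  fix e :: real assume "0 < e"
  from assms[OF this] show "\<forall>\<^sub>F n in sequentially. dist (a n) l < e"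
    by (rule eventually_mono) (simp add: dist_real_def abs_less_iff)
qed

text \<open>The case \<open>P = Q = f\<close> of \<open>affine_approximation\<close>. Its hypothesis
  on equal integrals holds by the barycentric formula for affine functions of the first Baire
  class.\<close>

lemma A1_approximation:
  assumes f: "f \<in> A\<^sub>1 X" "f \<in> A\<^sub>b X"
  obtains a C where "\<And>n::nat. a n \<in> A\<^sub>c X" "\<And>n x. x \<in> X \<Longrightarrow> \<bar>a n x\<bar> \<le> C" "\<And>x. x \<in> X \<Longrightarrow> (\<lambda>n. a n x) \<longlonglongrightarrow> f x"
proof -
  obtain C where C: "0 < C" "\<And>x. x \<in> X \<Longrightarrow> \<bar>f x\<bar> \<le> C" using Ab_bounded[OF f(2)] by blast
  obtain g0 where g0: "\<And>n::nat. continuous_on X (g0 n)" "\<And>x. x \<in> X \<Longrightarrow> (\<lambda>n. g0 n x) \<longlonglongrightarrow> f x"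
    using f(1) unfolding A\<^sub>1_def by blast
  have aff: "f \<in> affine_functions X" using f(1) by (simp add: A\<^sub>1_def)
  \<comment> \<open>Truncation at a bound of \<open>f\<close> leaves the limit unchanged and makes
    the sequence bounded.\<close>
  define g where "g n x = max (- C) (min C (g0 n x))" for n x
  have gc: "continuous_on X (g n)" for n unfolding g_def by (intro continuous_intros g0(1))
  have gb: "\<bar>g n x\<bar> \<le> C" for n x using C(1) by (auto simp: g_def)
  have gl: "(\<lambda>n. g n x) \<longlonglongrightarrow> f x" if x: "x \<in> X" for x
  proof -
    have "(\<lambda>n. g n x) \<longlonglongrightarrow> max (- C) (min C (f x))"
      unfolding g_def by (intro tendsto_max tendsto_min tendsto_const g0(2) x)
    moreover have "max (- C) (min C (f x)) = f x" using C(2)[OF x] by (auto simp: abs_le_iff)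
    ultimately show ?thesis by simp
  qed
  show thesis
  proof (rule affine_approximation[OF gc gc _ _ gl gl, where M = C and b = f])
    show "integrable \<sigma> f" if \<sigma>: "radon_prob X \<sigma>" for \<sigma>
    proof (rule radon_bounded_integrable[OF \<sigma> _ C(2)])
      show "f \<in> borel_measurable \<sigma>"
        by (rule borel_measurable_LIMSEQ_real[of _ g]) (use gl radon_space[OF \<sigma>] radon_measurable[OF \<sigma> gc] in auto)
    qed
    fix \<sigma> \<tau> assume st: "radon_prob X \<sigma>" "radon_prob X \<tau>" "\<And>a. a \<in> A\<^sub>c X \<Longrightarrow> integral\<^sup>L \<sigma> a = integral\<^sup>L \<tau> a"
    obtain r where r: "is_barycenter X \<sigma> r" using barycenter_exists[OF st(1)] by blast
    then have r': "is_barycenter X \<tau> r" using st(3) by (simp add: is_barycenter_def)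
    have "integral\<^sup>L \<sigma> f = f r" by (rule baire_one_barycenter[OF affine_mix[OF aff] C(2) gc gl st(1) r])
    moreover have "integral\<^sup>L \<tau> f = f r" by (rule baire_one_barycenter[OF affine_mix[OF aff] C(2) gc gl st(2) r'])
    ultimately show "integral\<^sup>L \<sigma> f = integral\<^sup>L \<tau> f" by simp
  next
    fix a assume a: "\<And>n::nat. a n \<in> A\<^sub>c X" "\<And>n x. x \<in> X \<Longrightarrow> \<bar>a n x\<bar> \<le> C + 1"
      "\<And>x e. x \<in> X \<Longrightarrow> 0 < e \<Longrightarrow> \<forall>\<^sub>F n in sequentially. f x - e < a n x \<and> a n x < f x + e"
    show thesis by (rule that[OF a(1,2) squeeze[OF a(3)]])
  qed (use gb in auto)
qed

lemma limit_in_sigma_closure: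
  assumes g: "\<And>n::nat. g n \<in> sigma_closure (A\<^sub>c X)" "\<And>n x. x \<in> X \<Longrightarrow> \<bar>g n x\<bar> \<le> C"
    and out: "\<And>n x. x \<notin> X \<Longrightarrow> g n x = 0" "\<And>x. x \<notin> X \<Longrightarrow> f x = 0"
    and lim: "\<And>x. x \<in> X \<Longrightarrow> (\<lambda>n. g n x) \<longlonglongrightarrow> f x"
  shows "f \<in> sigma_closure (A\<^sub>c X)"
proof (rule sigma_closure.limit[of g])
  have "\<bar>g n x\<bar> \<le> max C 0" for n x using g(2)[of x n] out(1)[of x n] by (cases "x \<in> X") auto
  then show "\<exists>C. \<forall>n x. \<bar>g n x\<bar> \<le> C" by blast
  show "(\<lambda>n. g n x) \<longlonglongrightarrow> f x" for x using lim out by (cases "x \<in> X") auto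
qed (rule g(1))

lemma A1_subset_sigma_closure:
  assumes f: "f \<in> A\<^sub>1 X" "f \<in> A\<^sub>b X"
  shows "f \<in> sigma_closure (A\<^sub>c X)"
proof -
  obtain a C where a: "\<And>n::nat. a n \<in> A\<^sub>c X" "\<And>n x. x \<in> X \<Longrightarrow> \<bar>a n x\<bar> \<le> C" "\<And>x. x \<in> X \<Longrightarrow> (\<lambda>n. a n x) \<longlonglongrightarrow> f x"
    using A1_approximation[OF f] by blast
  show ?thesis
  proof (rule limit_in_sigma_closure[OF _ a(2) _ _ a(3)])
    show "a n \<in> sigma_closure (A\<^sub>c X)" for n using a(1) by (rule sigma_closure.base)
    show "a n x = 0" if "x \<notin> X" for n x using a(1)[of n] that by (simp add: Ac_iff)
    show "f x = 0" if "x \<notin> X" for x using Ab_outside[OF f(2) that] .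
  qed
qed

section \<open>Transfer from the extreme points to the whole set\<close>

lemma countable_support:
  fixes g :: "nat \<Rightarrow> 'a \<Rightarrow> real"
  assumes "\<And>n. g n \<in> sigma_closure (A\<^sub>c X)"
  obtains D where "countable D" "D \<subseteq> A\<^sub>c X" "\<And>n. g n \<in> sigma_closure D"
proof -
  obtain D where D: "\<And>n. countable (D n) \<and> D n \<subseteq> A\<^sub>c X \<and> g n \<in> sigma_closure (D n)"
    using sigma_closure_countable[OF assms] by metis
  show thesis
  proof (rule that[of "\<Union>n. D n"])
    show "g n \<in> sigma_closure (\<Union>n. D n)" for n using D sigma_closure_mono by blast
  qed (use D in auto)
qed

text \<open>Convergence at the extreme points becomes almost everywhere convergence for a measure
  that represents \<open>y\<close> on a countable \<open>D\<close> determining all the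
  \<open>g n\<close>; dominated convergence brings it back to \<open>y\<close>.\<close>

lemma convergent_from_extreme_points:
  fixes g :: "nat \<Rightarrow> 'a \<Rightarrow> real"
  assumes g: "\<And>n. g n \<in> sigma_closure (A\<^sub>c X)" "\<And>n x. x \<in> X \<Longrightarrow> \<bar>g n x\<bar> \<le> C"
    and lim: "\<And>e. e \<in> extreme_points X \<Longrightarrow> convergent (\<lambda>n. g n e)" and y: "y \<in> X"
  shows "convergent (\<lambda>n. g n y)"
proof -
  obtain D where D: "countable D" "D \<subseteq> A\<^sub>c X" "\<And>n. g n \<in> sigma_closure D"
    using countable_support[of g] g(1) by blast
  obtain \<mu> where \<mu>: "radon_prob X \<mu>" "\<And>h. h \<in> D \<Longrightarrow> integral\<^sup>L \<mu> h = h y"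
    "AE z in \<mu>. \<exists>e\<in>extreme_points X. \<forall>h\<in>D. h e = h z" using countable_choquet[OF D(1,2) y] by blast
  interpret prob_space \<mu> using \<mu>(1) by (rule radon_prob_space)
  have gm: "g n \<in> borel_measurable \<mu>" "integral\<^sup>L \<mu> (g n) = g n y" for n
    using sigma_closure_integral[OF D(3,2) \<mu>(1,2)] by auto
  have "AE z in \<mu>. (\<lambda>n. g n z) \<longlonglongrightarrow> lim (\<lambda>n. g n z)"
    using \<mu>(3)
  proof (rule AE_mp, intro AE_I2 impI)
    fix z assume "\<exists>e\<in>extreme_points X. \<forall>h\<in>D. h e = h z"
    then obtain e where e: "e \<in> extreme_points X" "\<forall>h\<in>D. h e = h z" by blast
    have "g n e = g n z" for n by (rule sigma_closure_determined[OF D(3)]) (use e(2) in blast)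
    then have "convergent (\<lambda>n. g n z)" using lim[OF e(1)] by simp
    then show "(\<lambda>n. g n z) \<longlonglongrightarrow> lim (\<lambda>n. g n z)" by (simp add: convergent_LIMSEQ_iff)
  qed
  moreover have "(\<lambda>z. lim (\<lambda>n. g n z)) \<in> borel_measurable \<mu>" using gm(1) by (rule borel_measurable_lim_metric)
  ultimately have "(\<lambda>n. integral\<^sup>L \<mu> (g n)) \<longlonglongrightarrow> integral\<^sup>L \<mu> (\<lambda>z. lim (\<lambda>n. g n z))"
    by (intro integral_dominated_convergence[where w = "\<lambda>_. C"]) (use gm(1) g(2) radon_space[OF \<mu>(1)] in auto)
  then show ?thesis unfolding gm(2) by (rule convergentI)
qed

text \<open>The key to part (b): a strongly affine \<open>b\<close> that agrees on \<open>ext X\<close> with a Baire-one function \<open>c\<close>. Let \<open>S \<supseteq> ext X\<close> be an ambiguous set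
  on which \<open>b = c\<close>. The Baire-one functions equal to \<open>c\<close> on \<open>S\<close> and to \<open>-M\<close>, respectively \<open>M\<close>, off \<open>S\<close> enclose \<open>b\<close>,
  and continuous affine functions squeezed between their approximants tend to \<open>b\<close> on \<open>S\<close>, hence on \<open>X\<close>.\<close>

lemma affine_baire_one_from_extreme_points:
  assumes L: "Lindelof_space (top_of_set (extreme_points X))" and res: "resolvable_in X (extreme_points X)"
    and b: "b \<in> sigma_closure (A\<^sub>c X)" "b \<in> affine_functions X" and bM: "\<And>x. x \<in> X \<Longrightarrow> \<bar>b x\<bar> \<le> M"
    and c: "\<And>n::nat. continuous_on X (cn n)" "\<And>n x. x \<in> X \<Longrightarrow> \<bar>cn n x\<bar> \<le> M" "\<And>x. x \<in> X \<Longrightarrow> (\<lambda>n. cn n x) \<longlonglongrightarrow> c x"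
    and bc: "\<And>e. e \<in> extreme_points X \<Longrightarrow> b e = c e"
  shows "b \<in> A\<^sub>1 X"
proof -
  have eX: "extreme_points X \<subseteq> X" using ext_in by blast
  have M0: "0 \<le> M" using bM nonempty by fastforce
  obtain D0 where D0: "countable D0" "D0 \<subseteq> A\<^sub>c X" "b \<in> sigma_closure D0"
    using sigma_closure_countable[OF b(1)] by blast
  obtain E where E: "\<And>f. continuous_on X f \<Longrightarrow> countable (E f) \<and> E f \<subseteq> A\<^sub>c X \<and>
      (\<forall>y\<in>X. \<forall>z\<in>X. (\<forall>h\<in>E f. h y = h z) \<longrightarrow> f y = (f z :: real))"
    using continuous_determined_by_countable by metis
  \<comment> \<open>\<open>D1\<close> determines both \<open>b\<close> and \<open>c\<close>, so the
    set \<open>B\<close> where they differ is a union of \<open>D1\<close>-classes. The saturation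
    of a compact set disjoint from \<open>B\<close> is then still disjoint from \<open>B\<close>, as
    the separation lemma demands.\<close>
  define D1 where "D1 = D0 \<union> (\<Union>n. E (cn n))"
  have D1: "countable D1" "D1 \<subseteq> A\<^sub>c X" using D0 E[OF c(1)] by (auto simp: D1_def)
  have det: "b y = b z \<and> c y = c z" if yz: "y \<in> X" "z \<in> X" and eq: "\<forall>h\<in>D1. h y = h z" for y z
  proof
    show "b y = b z" by (rule sigma_closure_determined[OF D0(3)]) (use eq in \<open>auto simp: D1_def\<close>)
    have "cn n y = cn n z" for n using E[OF c(1), of n] yz eq unfolding D1_def by blast
    then have "(\<lambda>n. cn n y) \<longlonglongrightarrow> c z" using c(3)[OF yz(2)] by simp
    then show "c y = c z" using c(3)[OF yz(1)] LIMSEQ_unique by blast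
  qed
  define B where "B = {x\<in>X. b x \<noteq> c x}"
  have "extreme_points X \<inter> B = {}" using bc by (auto simp: B_def)
  obtain S where S: "fsigma_in (top_of_set X) S" "gdelta_in (top_of_set X) S" "extreme_points X \<subseteq> S" "S \<inter> B = {}"
  proof (rule resolvable_Lindelof_separation[OF compact L res, of B, THEN exE])
    fix K assume K: "compact K" "K \<subseteq> X" "K \<inter> B = {}"
    define P where "P = {x\<in>X. \<exists>y\<in>K. \<forall>h\<in>D1. h x = h y}"
    have "closedin (top_of_set X) P \<and> gdelta_in (top_of_set X) P"
      unfolding P_def by (rule closed_saturation[OF D1 K(1,2)])
    moreover have "K \<subseteq> P" using K(2) by (auto simp: P_def)
    moreover have "P \<inter> B = {}"
    proof (rule ccontr)
      assume "P \<inter> B \<noteq> {}"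
      then obtain x y where "x \<in> X" "y \<in> K" "\<forall>h\<in>D1. h x = h y" "b x \<noteq> c x" by (auto simp: P_def B_def)
      then have "y \<in> B" using det[of x y] K(2) by (auto simp: B_def)
      then show False using K(3) \<open>y \<in> K\<close> by blast
    qed
    ultimately show "\<exists>P. closedin (top_of_set X) P \<and> gdelta_in (top_of_set X) P \<and> K \<subseteq> P \<and> P \<inter> B = {}" by blast
  qed (use \<open>extreme_points X \<inter> B = {}\<close> in blast)+
  have SX: "S \<subseteq> X" using fsigma_in_subset[OF S(1)] by simp
  obtain s :: "nat \<Rightarrow> 'a \<Rightarrow> real" where s: "\<And>n. continuous_on X (s n)" "\<And>n x. x \<in> X \<Longrightarrow> 0 \<le> s n x \<and> s n x \<le> 1"
    "\<And>x. x \<in> X \<Longrightarrow> (\<lambda>n. s n x) \<longlonglongrightarrow> indicat_real S x"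
    using ambiguous_indicator_limit[OF compact S(1,2)] by blast
  define p where "p k n x = cn n x * s n x + k * M * (1 - s n x)" for k n x
  define P where "P k x = c x * indicat_real S x + k * M * (1 - indicat_real S x)" for k x
  have pc: "continuous_on X (p k n)" for k n unfolding p_def by (intro continuous_intros c(1) s(1))
  have pl: "(\<lambda>n. p k n x) \<longlonglongrightarrow> P k x" if "x \<in> X" for k x
    unfolding p_def P_def by (intro tendsto_intros c(3) s(3) that)
  have pb: "\<bar>p k n x\<bar> \<le> M" if x: "x \<in> X" and k: "\<bar>k\<bar> = 1" for k n x
  proof -
    have "\<bar>p k n x\<bar> \<le> \<bar>cn n x * s n x\<bar> + \<bar>k * M * (1 - s n x)\<bar>" unfolding p_def by (rule abs_triangle_ineq)
    also have "\<dots> = \<bar>cn n x\<bar> * s n x + M * (1 - s n x)" using s(2)[OF x, of n] k M0 by (simp add: abs_mult)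
    also have "\<dots> \<le> M * s n x + M * (1 - s n x)" using c(2)[OF x, of n] s(2)[OF x, of n] by (intro add_right_mono mult_right_mono) auto
    also have "\<dots> = M" by (simp add: right_diff_distrib)
    finally show ?thesis .
  qed
  have PS: "P k x = b x" if "x \<in> S" for k x using that S(4) SX by (auto simp: P_def B_def)
  have encl: "P (-1) x \<le> b x \<and> b x \<le> P 1 x" if x: "x \<in> X" for x
    using bM[OF x] PS[of x] by (cases "x \<in> S") (auto simp: P_def abs_le_iff)
  obtain a where a: "\<And>n::nat. a n \<in> A\<^sub>c X" "\<And>n x. x \<in> X \<Longrightarrow> \<bar>a n x\<bar> \<le> M + 1"
    "\<And>x e. x \<in> X \<Longrightarrow> 0 < e \<Longrightarrow> \<forall>\<^sub>F n in sequentially. P (-1) x - e < a n x \<and> a n x < P 1 x + e"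
  proof (rule affine_approximation[OF pc pc _ _ pl pl encl])
    show "\<bar>p (-1) n x\<bar> \<le> M" "\<bar>p 1 n x\<bar> \<le> M" if "x \<in> X" for n x using pb[OF that] by auto
    show "integrable \<sigma> b" if \<sigma>: "radon_prob X \<sigma>" for \<sigma>
    proof -
      obtain r where "is_barycenter X \<sigma> r" using barycenter_exists[OF \<sigma>] by blast
      then have "b \<in> borel_measurable \<sigma>"
        using sigma_closure_integral[OF b(1) order_refl \<sigma>] by (simp add: is_barycenter_def)
      then show ?thesis by (rule radon_bounded_integrable[OF \<sigma> _ bM])
    qed
    fix \<sigma> \<tau> assume st: "radon_prob X \<sigma>" "radon_prob X \<tau>" "\<And>a. a \<in> A\<^sub>c X \<Longrightarrow> integral\<^sup>L \<sigma> a = integral\<^sup>L \<tau> a"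
    obtain r where r: "is_barycenter X \<sigma> r" using barycenter_exists[OF st(1)] by blast
    then have r': "is_barycenter X \<tau> r" using st(3) by (simp add: is_barycenter_def)
    show "integral\<^sup>L \<sigma> b = integral\<^sup>L \<tau> b"
      using sigma_closure_integral[OF b(1) order_refl st(1), of r] sigma_closure_integral[OF b(1) order_refl st(2), of r] r r'
      by (simp add: is_barycenter_def)
  next
    fix a :: "nat \<Rightarrow> 'a \<Rightarrow> real"
    assume *: "\<And>n. a n \<in> A\<^sub>c X" "\<And>n x. x \<in> X \<Longrightarrow> \<bar>a n x\<bar> \<le> M + 1"
      "\<And>x e. x \<in> X \<Longrightarrow> 0 < e \<Longrightarrow> \<forall>\<^sub>F n in sequentially. P (-1) x - e < a n x \<and> a n x < P 1 x + e"
    show thesis by (rule that[OF *])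
  qed
  have aS: "(\<lambda>n. a n x) \<longlonglongrightarrow> b x" if "x \<in> S" for x
    by (rule squeeze) (use a(3)[of x] PS[OF that] that SX in auto)
  have "(\<lambda>n. a n y) \<longlonglongrightarrow> b y" if y: "y \<in> X" for y
  proof -
    \<comment> \<open>Two additions matter: with the \<open>a n\<close> in \<open>D\<close> their
      integrals are their values at \<open>y\<close>, and with the functions that determine the
      \<open>s n\<close> membership in \<open>S\<close> is shared by \<open>D\<close>-equivalent
      points, so almost every point lies in \<open>S\<close>.\<close>
    define D where "D = D1 \<union> range a \<union> (\<Union>n. E (s n))"
    have D: "countable D" "D \<subseteq> A\<^sub>c X" using D1 a(1) E[OF s(1)] by (auto simp: D_def)
    have bD: "b \<in> sigma_closure D" using D0(3) by (rule sigma_closure_mono) (auto simp: D_def D1_def)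
    obtain \<mu> where \<mu>: "radon_prob X \<mu>" "\<And>h. h \<in> D \<Longrightarrow> integral\<^sup>L \<mu> h = h y"
      "AE z in \<mu>. \<exists>e\<in>extreme_points X. \<forall>h\<in>D. h e = h z" using countable_choquet[OF D y] by blast
    interpret prob_space \<mu> using \<mu>(1) by (rule radon_prob_space)
    have bint: "b \<in> borel_measurable \<mu>" "integral\<^sup>L \<mu> b = b y"
      using sigma_closure_integral[OF bD D(2) \<mu>(1,2)] by auto
    have "AE z in \<mu>. (\<lambda>n. a n z) \<longlonglongrightarrow> b z"
      using \<mu>(3)
    proof (rule AE_mp, intro AE_I2 impI)
      fix z assume z: "z \<in> space \<mu>" and "\<exists>e\<in>extreme_points X. \<forall>h\<in>D. h e = h z"
      then obtain e where e: "e \<in> extreme_points X" "\<forall>h\<in>D. h e = h z" by blast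
      have zX: "z \<in> X" using z radon_space[OF \<mu>(1)] by simp
      have "s n e = s n z" for n using E[OF s(1), of n] e eX zX unfolding D_def by blast
      then have "(\<lambda>n. s n z) \<longlonglongrightarrow> indicat_real S e" using s(3)[of e] e(1) eX by auto
      then have "indicat_real S z = indicat_real S e" using s(3)[OF zX] LIMSEQ_unique by blast
      then have "z \<in> S" using e(1) S(3) by (auto simp: indicator_def split: if_splits)
      then show "(\<lambda>n. a n z) \<longlonglongrightarrow> b z" by (rule aS)
    qed
    then have "(\<lambda>n. integral\<^sup>L \<mu> (a n)) \<longlonglongrightarrow> integral\<^sup>L \<mu> b"
      by (intro integral_dominated_convergence[where w = "\<lambda>_. M + 1"])
        (use bint(1) radon_measurable[OF \<mu>(1) Ac_continuous[OF a(1)]] a(2) radon_space[OF \<mu>(1)] in auto)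
    moreover have "integral\<^sup>L \<mu> (a n) = a n y" for n by (rule \<mu>(2)) (simp add: D_def)
    ultimately show ?thesis using bint(2) by simp
  qed
  then show ?thesis unfolding A\<^sub>1_def using b(2) Ac_continuous[OF a(1)] by blast
qed

lemma Lindelof_center_eq_multipliers:
  assumes H: "intermediate_function_space X (A\<^sub>1 X)"
    and L: "Lindelof_space (top_of_set (extreme_points X))" and res: "resolvable_in X (extreme_points X)"
  shows "center X (A\<^sub>1 X) = multipliers X (A\<^sub>1 X)"
proof -
  have Ab: "A\<^sub>1 X \<subseteq> A\<^sub>b X" using H_Ab[OF H] .
  have sigma: "A\<^sub>1 X \<subseteq> sigma_closure (A\<^sub>c X)" using A1_subset_sigma_closure Ab by blast
  show ?thesis
  proof (rule center_eq_multipliers[OF H sigma])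
    fix T a assume T: "T \<in> order_bounded_operators X (A\<^sub>1 X)" and a: "a \<in> A\<^sub>1 X"
    have TA: "T v \<in> A\<^sub>1 X" if "v \<in> A\<^sub>1 X" for v using T that unfolding order_bounded_operators_def by blast
    define u where "u = T (indicat_real X)"
    have u: "u \<in> A\<^sub>1 X" unfolding u_def using TA H_one[OF H] .
    have Te: "T v e = u e * v e" if v: "v \<in> A\<^sub>c X" and e: "e \<in> extreme_points X" for v e
    proof -
      obtain l where l: "linear_functional_on (A\<^sub>1 X) (\<lambda>a. T a e + l * a e)"
        "\<And>a. a \<in> A\<^sub>1 X \<Longrightarrow> (\<And>y. y \<in> X \<Longrightarrow> 0 \<le> a y) \<Longrightarrow> 0 \<le> T a e + l * a e \<and> T a e + l * a e \<le> 2 * l * a e"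
        using operator_functional[OF H T ext_in[OF e]] by blast
      have lin: "linear_functional_on (A\<^sub>c X) (\<lambda>a. T a e + l * a e)"
        using l(1) Ac_subset_A1 unfolding linear_functional_on_def by (meson subsetD)
      have "T v e + l * v e = (T (indicat_real X) e + l * indicat_real X e) * v e"
        by (rule dominated_by_extreme_point[OF e lin _ v]) (use l(2) Ac_subset_A1 in blast)
      then show ?thesis using ext_in[OF e] by (simp add: u_def distrib_right)
    qed
    obtain an Ca where an: "\<And>n::nat. an n \<in> A\<^sub>c X" "\<And>n x. x \<in> X \<Longrightarrow> \<bar>an n x\<bar> \<le> Ca" "\<And>x. x \<in> X \<Longrightarrow> (\<lambda>n. an n x) \<longlonglongrightarrow> a x"
      using A1_approximation[OF a] a Ab by blast
    obtain un Cu where un: "\<And>n::nat. un n \<in> A\<^sub>c X" "\<And>n x. x \<in> X \<Longrightarrow> \<bar>un n x\<bar> \<le> Cu" "\<And>x. x \<in> X \<Longrightarrow> (\<lambda>n. un n x) \<longlonglongrightarrow> u x"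
      using A1_approximation[OF u] u Ab by blast
    have TnA: "T (an n) \<in> A\<^sub>1 X" for n using TA an(1) Ac_subset_A1 by blast
    have "\<exists>C. \<forall>v\<in>A\<^sub>1 X. sup_norm X (T v) \<le> C * sup_norm X v"
      using T by (simp add: order_bounded_operators_def)
    then obtain CT where CT: "\<And>v. v \<in> A\<^sub>1 X \<Longrightarrow> sup_norm X (T v) \<le> CT * sup_norm X v" by blast
    have Tb: "\<bar>T (an n) x\<bar> \<le> \<bar>CT\<bar> * Ca" if x: "x \<in> X" for n x
    proof -
      have anH: "an n \<in> A\<^sub>1 X" using an(1) Ac_subset_A1 by blast
      have "\<bar>T (an n) x\<bar> \<le> sup_norm X (T (an n))" using TnA Ab by (intro sup_norm_upper x) auto
      also have "\<dots> \<le> CT * sup_norm X (an n)" using CT[OF anH] .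
      also have "\<dots> \<le> \<bar>CT\<bar> * Ca"
      proof (rule mult_mono)
        have "\<bar>an n x\<bar> \<le> sup_norm X (an n)" using anH Ab by (intro sup_norm_upper x) auto
        then show "0 \<le> sup_norm X (an n)" by simp
      qed (use sup_norm_le an(2) in auto)
      finally show ?thesis .
    qed
    have elim: "(\<lambda>n. T (an n) e) \<longlonglongrightarrow> u e * a e" if e: "e \<in> extreme_points X" for e
      unfolding Te[OF an(1) e] by (intro tendsto_intros an(3) ext_in e)
    \<comment> \<open>The norm bound on \<open>T\<close> keeps the sequence bounded and its limits
      at the extreme points are known, so it converges everywhere.\<close>
    have "convergent (\<lambda>n. T (an n) y)" if "y \<in> X" for y
      by (rule convergent_from_extreme_points[OF _ Tb _ that]) (use sigma TnA elim convergentI in blast)+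
    then obtain b0 where b0: "\<And>y. y \<in> X \<Longrightarrow> (\<lambda>n. T (an n) y) \<longlonglongrightarrow> b0 y"
      unfolding convergent_def by metis
    define b where "b y = (if y \<in> X then b0 y else 0)" for y
    have bl: "(\<lambda>n. T (an n) y) \<longlonglongrightarrow> b y" if "y \<in> X" for y using b0[OF that] that by (simp add: b_def)
    have be: "b e = u e * a e" if e: "e \<in> extreme_points X" for e
      using bl[OF ext_in[OF e]] elim[OF e] by (rule LIMSEQ_unique)
    have bsig: "b \<in> sigma_closure (A\<^sub>c X)"
    proof (rule limit_in_sigma_closure[OF _ Tb _ _ bl])
      show "T (an n) \<in> sigma_closure (A\<^sub>c X)" for n using TnA sigma by blast
      show "T (an n) x = 0" if "x \<notin> X" for n x using Ab_outside that TnA Ab by blast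
      show "b x = 0" if "x \<notin> X" for x using that by (simp add: b_def)
    qed
    have baff: "b \<in> affine_functions X" unfolding b_def
    proof (rule affine_restrict)
      fix x y t assume xy: "x \<in> X" "y \<in> X" and t: "t \<in> {0..(1::real)}"
      have "(\<lambda>n. (1 - t) * T (an n) x + t * T (an n) y) \<longlonglongrightarrow> (1 - t) * b0 x + t * b0 y"
        by (intro tendsto_intros b0 xy)
      moreover have "(1 - t) * T (an n) x + t * T (an n) y = T (an n) ((1 - t) *\<^sub>R x + t *\<^sub>R y)" for n
        using TnA[of n] xy t by (intro affine_mix[symmetric]) (auto simp: A\<^sub>1_def)
      ultimately have "(\<lambda>n. T (an n) ((1 - t) *\<^sub>R x + t *\<^sub>R y)) \<longlonglongrightarrow> (1 - t) * b0 x + t * b0 y" by simp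
      moreover have "(\<lambda>n. T (an n) ((1 - t) *\<^sub>R x + t *\<^sub>R y)) \<longlonglongrightarrow> b0 ((1 - t) *\<^sub>R x + t *\<^sub>R y)"
        using t by (intro b0 mix xy) auto
      ultimately show "b0 ((1 - t) *\<^sub>R x + t *\<^sub>R y) = (1 - t) * b0 x + t * b0 y"
        by (rule LIMSEQ_unique[rotated])
    qed
    \<comment> \<open>One constant for \<open>b\<close>, bounded through the norm of
      \<open>T\<close>, and for the approximants \<open>un n * an n\<close> of the product.\<close>
    define M where "M = max (\<bar>CT\<bar> * Ca) (Cu * Ca)"
    have bb: "\<bar>b x\<bar> \<le> M" if x: "x \<in> X" for x
    proof -
      have "\<bar>b x\<bar> \<le> \<bar>CT\<bar> * Ca" by (rule LIMSEQ_le_const2[OF tendsto_rabs[OF bl[OF x]]]) (use Tb[OF x] in blast)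
      then show ?thesis by (simp add: M_def)
    qed
    have "b \<in> A\<^sub>1 X"
    proof (rule affine_baire_one_from_extreme_points[OF L res bsig baff bb])
      show "continuous_on X (\<lambda>x. un n x * an n x)" for n by (intro continuous_intros Ac_continuous un an)
      show "\<bar>un n x * an n x\<bar> \<le> M" if x: "x \<in> X" for n x
      proof -
        have "0 \<le> Cu" using un(2)[OF x, of n] by linarith
        then have "\<bar>un n x * an n x\<bar> \<le> Cu * Ca"
          unfolding abs_mult using un(2)[OF x] an(2)[OF x] by (intro mult_mono) auto
        then show ?thesis by (simp add: M_def)
      qed
      show "(\<lambda>n. un n x * an n x) \<longlonglongrightarrow> u x * a x" if "x \<in> X" for x by (intro tendsto_intros un(3) an(3) that)
    qed (use be in auto)
    then show "\<exists>b\<in>A\<^sub>1 X. \<forall>x\<in>extreme_points X. b x = T (indicat_real X) x * a x"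
      using be unfolding u_def by blast
  qed
qed

end

lemma empty_center_eq_multipliers:
  assumes "intermediate_function_space ({} :: 'a::{real_vector,topological_space} set) H"
  shows "center {} H = multipliers {} H"
proof -
  have "subspace H" "H \<subseteq> A\<^sub>b {}" using assms by (auto simp: intermediate_function_space_def)
  have "f = 0" if "f \<in> H" for f
    using that \<open>H \<subseteq> A\<^sub>b {}\<close> by (auto simp: A\<^sub>b_def affine_functions_def functions_on_def fun_eq_iff)
  then have H: "H = {0}" using subspace_0[OF \<open>subspace H\<close>] by blast
  have one: "indicat_real ({} :: 'a set) = 0" by (simp add: fun_eq_iff)
  have eq: "center {} H = {0}"
  proof
    show "center {} H \<subseteq> {0}" unfolding center_def order_bounded_operators_def H
      by (auto simp: linear_maps_on_def one)
    \<comment> \<open>On the empty set every function has the same, unspecified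
      \<open>sup_norm\<close>, so the constant 1 serves in the norm bound.\<close>
    have "(\<lambda>_. 0) \<in> order_bounded_operators {} H"
      unfolding order_bounded_operators_def linear_maps_on_def H
      by (auto intro!: exI[of _ 1] simp: sup_norm_def)
    then show "{0} \<subseteq> center {} H" unfolding center_def by (auto intro!: exI[of _ "\<lambda>_. 0"])
  qed
  have "multipliers {} H = {0}"
    unfolding multipliers_def H by (simp add: extreme_points_def extreme_point_of_def)
  with eq show ?thesis by simp
qed

theorem proposition6p9:
  fixes X :: "'a::locally_convex_space set"
    and H :: "('a \<Rightarrow> real) set"
  assumes "compact X" and "convex X"
    and "intermediate_function_space X H"
  shows "(choquet_simplex X \<and> A\<^sub>1 X \<subseteq> H \<and> H \<subseteq> sigma_closure (A\<^sub>c X) \<longrightarrow>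
            (\<forall>x\<in>extreme_points X. evaluation H x \<in> extreme_points (state_space X H)) \<and>
            center X H = multipliers X H)
       \<and> (H = A\<^sub>1 X \<and> Lindelof_space (top_of_set (extreme_points X)) \<and> resolvable_in X (extreme_points X) \<longrightarrow>
            center X H = multipliers X H)"
proof (cases "X = {}")
  case True
  have "intermediate_function_space {} H" using assms(3) unfolding True .
  then have "center X H = multipliers X H" unfolding True by (rule empty_center_eq_multipliers)
  moreover have "extreme_points X = {}" unfolding True by (simp add: extreme_points_def extreme_point_of_def)
  ultimately show ?thesis by blast
next
  case False
  interpret compact_convex X by standard (use assms False in auto)
  show ?thesis
    using simplex_evaluation_extreme[OF assms(3)] simplex_center_eq_multipliers[OF assms(3)]
      Lindelof_center_eq_multipliers assms(3) by blast
qed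

end
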